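(* Assume $0<\alpha<1$ and $e\in\mathrm{Swath}(\alpha)$. Let $\lambda=(\lambda_1,\ldots,\lambda_n)=\lambda_e(x_e(\alpha))$ be the vector of eigenvalues of $x_e(\alpha)$ in direction $e$, and let $\tilde q(t)=a_2t^2+a_1t+a_0$ where \[ a_2=\Big(\sum_j\lambda_j\Big)^2\sum_j\lambda_j^2-2\alpha^2\Big(\sum_j\lambda_j\Big)\sum_j\lambda_j^3+\alpha^4\sum_j\lambda_j^4,\] \[ a_1=2\alpha^4\sum_j\lambda_j^3-2\Big(\sum_j\lambda_j\Big)^3,\qquad a_0=(n-\alpha^2)\Big(\sum_j\lambda_j\Big)^2 .\] Then $\tilde q$ is strictly convex. Define $e'=\frac{1}{1+t_e(\alpha)}\big(e+t_e(\alpha)\,x_e(\alpha)\big)$ where $t_e(\alpha)$ is the minimizer of $\tilde q$. Then (i) $e'\in\mathrm{Swath}(\alpha)$; (ii) $\langle c,e\rangle>\langle c,e'\rangle$; (iii) $b^Ty_e(\alpha)\le b^Ty_{e'}(\alpha)$. Moreover, if, beginning with $e_0\in\mathrm{Swath}(\alpha)$, this rule is applied recursively to create a sequence $e_0,e_1,\ldots$, then for every $i=0,1,\ldots$, \[ \frac{\mathrm{gap}_{e_{j+1}}}{\mathrm{gap}_{e_j}}\le 1-\frac{\kappa}{\kappa+\sqrt n}\quad\text{for } j=i\text{ or } j=i+1\text{ (possibly both)},\qquad \kappa:=\alpha\sqrt{\tfrac{1-\alpha}{8}}.\]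
   Context: $\mathcal{E}$ is a finite-dimensional real Euclidean space with inner product $\langle\cdot,\cdot\rangle$. A homogeneous polynomial $p:\mathcal{E}\to\mathbb{R}$ of degree $n$ is hyperbolic in direction $e$ if $p(e)\ne0$ and for every $x$ the univariate polynomial $t\mapsto p(x+te)$ has only real roots. The hyperbolicity cone $\Lambda_{++}$ is the connected component of $\{p\neq0\}$ containing $e$; $\Lambda_+$ is its closure. Assume (replacing $p$ by $-p$ if needed) $p>0$ on $\Lambda_{++}$, and assume $\Lambda_+$ is regular (pointed, with nonempty interior). Let $f(x)=-\ln p(x)$ on $\Lambda_{++}$, with gradient $g(e)$ and Hessian $H(e)$ with respect to $\langle\cdot,\cdot\rangle$; for $e\in\Lambda_{++}$ define $\langle u,v\rangle_e=\langle u,H(e)v\rangle$ and $\|v\|_e=\langle v,v\rangle_e^{1/2}$, and for $\alpha>0$, $K_e(\alpha)=\{x:\langle e,x\rangle_e\ge\alpha\|x\|_e\}$, with dual cone $K_e(\alpha)^*=\{s:\langle x,s\rangle\ge0\ \forall x\in K_e(\alpha)\}$. The eigenvalues of $x$ in direction $e$ are the roots (with multiplicity) of $\lambda\mapsto p(\lambda e-x)$. The hyperbolic program is HP: $\min\langle c,x\rangle$ s.t. $Ax=b$, $x\in\Lambda_+$, where $A:\mathcal{E}\to\mathbb{R}^m$ is linear of full rank, $b\neq0$, and $c$ is not in the image of the adjoint $A^*$. For $e\in\Lambda_{++}$, $\mathrm{QP}_e(\alpha)$ is $\min\langle c,x\rangle$ s.t. $Ax=b$, $x\in K_e(\alpha)$,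 with dual $\mathrm{QP}_e(\alpha)^*$: $\max b^Ty$ s.t. $A^*y+s=c$, $s\in K_e(\alpha)^*$. $\mathrm{Swath}(\alpha)=\{e\in\Lambda_{++}: Ae=b \text{ and } \mathrm{QP}_e(\alpha)\text{ has an optimal solution}\}$. For $e\in\mathrm{Swath}(\alpha)$, $x_e(\alpha)$ denotes the (unique) optimal solution of $\mathrm{QP}_e(\alpha)$, $(y_e(\alpha),s_e(\alpha))$ the optimal solution of $\mathrm{QP}_e(\alpha)^*$, and $\mathrm{gap}_e:=\langle c,e\rangle-b^Ty_e(\alpha)$ $(=\langle c,e-x_e(\alpha)\rangle)$. The quadratic's coefficients are renamed $a_2,a_1,a_0$ here to avoid clashing with $b,c$. *)

theory Defs
  imports "HOL-Analysis.Analysis" "HOL-Computational_Algebra.Polynomial" "HOL-Library.Multiset"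
begin

inductive poly_fun :: "('a::real_inner \<Rightarrow> real) \<Rightarrow> bool" where
  pf_const: "poly_fun (\<lambda>x. k)"
| pf_lin: "poly_fun (\<lambda>x. inner a x)"
| pf_add: "poly_fun f \<Longrightarrow> poly_fun g \<Longrightarrow> poly_fun (\<lambda>x. f x + g x)"
| pf_mult: "poly_fun f \<Longrightarrow> poly_fun g \<Longrightarrow> poly_fun (\<lambda>x. f x * g x)"

definition homogeneous_of_degree :: "('a::real_vector \<Rightarrow> real) \<Rightarrow> nat \<Rightarrow> bool" where
  "homogeneous_of_degree p n \<longleftrightarrow> (\<forall>s x. p (s *\<^sub>R x) = s ^ n * p x)"

definition line_poly :: "('a::real_vector \<Rightarrow> real) \<Rightarrow> 'a \<Rightarrow> 'a \<Rightarrow> real poly" where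
  "line_poly p x d = (THE q. \<forall>t. poly q t = p (x + t *\<^sub>R d))"

definition hyperbolic :: "('a::real_inner \<Rightarrow> real) \<Rightarrow> nat \<Rightarrow> 'a \<Rightarrow> bool" where
  "hyperbolic p n d \<longleftrightarrow> poly_fun p \<and> homogeneous_of_degree p n \<and> p d \<noteq> 0 \<and>
     (\<forall>x. \<forall>z::complex. poly (map_poly complex_of_real (line_poly p x d)) z = 0 \<longrightarrow> z \<in> \<real>)"

definition hcone :: "('a::real_normed_vector \<Rightarrow> real) \<Rightarrow> 'a \<Rightarrow> 'a set" where
  "hcone p d = connected_component_set {x. p x \<noteq> 0} d"

definition hcone_closed :: "('a::real_normed_vector \<Rightarrow> real) \<Rightarrow> 'a \<Rightarrow> 'a set" where
  "hcone_closed p d = closure (hcone p d)"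

definition regular_cone :: "('a::real_normed_vector) set \<Rightarrow> bool" where
  "regular_cone K \<longleftrightarrow> K \<inter> uminus ` K = {0} \<and> interior K \<noteq> {}"

definition eigenvalues :: "('a::real_vector \<Rightarrow> real) \<Rightarrow> 'a \<Rightarrow> 'a \<Rightarrow> real multiset" where
  "eigenvalues p e x = proots (line_poly p (- x) e)"

definition barrier :: "('a \<Rightarrow> real) \<Rightarrow> 'a \<Rightarrow> real" where
  "barrier p x = - ln (p x)"

definition local_inner :: "('a::real_normed_vector \<Rightarrow> real) \<Rightarrow> 'a \<Rightarrow> 'a \<Rightarrow> 'a \<Rightarrow> real" where
  "local_inner p e u v =
     deriv (\<lambda>s. deriv (\<lambda>t. barrier p (e + s *\<^sub>R u + t *\<^sub>R v)) 0) 0"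

definition local_norm :: "('a::real_normed_vector \<Rightarrow> real) \<Rightarrow> 'a \<Rightarrow> 'a \<Rightarrow> real" where
  "local_norm p e v = sqrt (local_inner p e v v)"

definition Kcone :: "('a::real_normed_vector \<Rightarrow> real) \<Rightarrow> 'a \<Rightarrow> real \<Rightarrow> 'a set" where
  "Kcone p e \<alpha> = {x. local_inner p e e x \<ge> \<alpha> * local_norm p e x}"

definition dual_cone :: "('a::real_inner) set \<Rightarrow> 'a set" where
  "dual_cone K = {s. \<forall>x\<in>K. inner x s \<ge> 0}"

definition qp_feasible :: "('a::real_normed_vector \<Rightarrow> real) \<Rightarrow> ('a \<Rightarrow> 'b) \<Rightarrow> 'b \<Rightarrow> 'a \<Rightarrow> real \<Rightarrow> 'a \<Rightarrow> bool" where
  "qp_feasible p A b e \<alpha> x \<longleftrightarrow> A x = b \<and> x \<in> Kcone p e \<alpha>"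

definition qp_optimal :: "('a::real_inner \<Rightarrow> real) \<Rightarrow> ('a \<Rightarrow> 'b) \<Rightarrow> 'b \<Rightarrow> 'a \<Rightarrow> 'a \<Rightarrow> real \<Rightarrow> 'a \<Rightarrow> bool" where
  "qp_optimal p A b c e \<alpha> x \<longleftrightarrow> qp_feasible p A b e \<alpha> x \<and>
     (\<forall>x'. qp_feasible p A b e \<alpha> x' \<longrightarrow> inner c x \<le> inner c x')"

definition dual_feasible :: "('a::real_inner \<Rightarrow> real) \<Rightarrow> ('a \<Rightarrow> 'b::real_inner) \<Rightarrow> 'a \<Rightarrow> 'a \<Rightarrow> real \<Rightarrow> 'b \<Rightarrow> 'a \<Rightarrow> bool" where
  "dual_feasible p A c e \<alpha> y s \<longleftrightarrow> adjoint A y + s = c \<and> s \<in> dual_cone (Kcone p e \<alpha>)"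

definition dual_optimal :: "('a::real_inner \<Rightarrow> real) \<Rightarrow> ('a \<Rightarrow> 'b::real_inner) \<Rightarrow> 'b \<Rightarrow> 'a \<Rightarrow> 'a \<Rightarrow> real \<Rightarrow> 'b \<Rightarrow> 'a \<Rightarrow> bool" where
  "dual_optimal p A b c e \<alpha> y s \<longleftrightarrow> dual_feasible p A c e \<alpha> y s \<and>
     (\<forall>y' s'. dual_feasible p A c e \<alpha> y' s' \<longrightarrow> inner b y' \<le> inner b y)"

definition swath :: "('a::real_inner \<Rightarrow> real) \<Rightarrow> 'a \<Rightarrow> ('a \<Rightarrow> 'b) \<Rightarrow> 'b \<Rightarrow> 'a \<Rightarrow> real \<Rightarrow> 'a set" where
  "swath p d A b c \<alpha> = {e \<in> hcone p d. A e = b \<and> (\<exists>x. qp_optimal p A b c e \<alpha> x)}"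

definition x_opt :: "('a::real_inner \<Rightarrow> real) \<Rightarrow> ('a \<Rightarrow> 'b) \<Rightarrow> 'b \<Rightarrow> 'a \<Rightarrow> 'a \<Rightarrow> real \<Rightarrow> 'a" where
  "x_opt p A b c e \<alpha> = (THE x. qp_optimal p A b c e \<alpha> x)"

definition ys_opt :: "('a::real_inner \<Rightarrow> real) \<Rightarrow> ('a \<Rightarrow> 'b::real_inner) \<Rightarrow> 'b \<Rightarrow> 'a \<Rightarrow> 'a \<Rightarrow> real \<Rightarrow> 'b \<times> 'a" where
  "ys_opt p A b c e \<alpha> = (SOME (y, s). dual_optimal p A b c e \<alpha> y s)"

definition y_opt :: "('a::real_inner \<Rightarrow> real) \<Rightarrow> ('a \<Rightarrow> 'b::real_inner) \<Rightarrow> 'b \<Rightarrow> 'a \<Rightarrow> 'a \<Rightarrow> real \<Rightarrow> 'b" where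
  "y_opt p A b c e \<alpha> = fst (ys_opt p A b c e \<alpha>)"

definition gap :: "('a::real_inner \<Rightarrow> real) \<Rightarrow> ('a \<Rightarrow> 'b::real_inner) \<Rightarrow> 'b \<Rightarrow> 'a \<Rightarrow> 'a \<Rightarrow> real \<Rightarrow> real" where
  "gap p A b c e \<alpha> = inner c e - inner b (y_opt p A b c e \<alpha>)"

definition qcoeffs :: "nat \<Rightarrow> real \<Rightarrow> real multiset \<Rightarrow> real \<times> real \<times> real" where
  "qcoeffs n \<alpha> L =
    (let s1 = (\<Sum>\<^sub># (image_mset (\<lambda>l. l) L));
         s2 = (\<Sum>\<^sub># (image_mset (\<lambda>l. l ^ 2) L));
         s3 = (\<Sum>\<^sub># (image_mset (\<lambda>l. l ^ 3) L));
         s4 = (\<Sum>\<^sub># (image_mset (\<lambda>l. l ^ 4) L))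
     in (s1 ^ 2 * s2 - 2 * \<alpha> ^ 2 * s1 * s3 + \<alpha> ^ 4 * s4,
         2 * \<alpha> ^ 4 * s3 - 2 * s1 ^ 3,
         (real n - \<alpha> ^ 2) * s1 ^ 2))"

definition qtilde :: "('a::real_inner \<Rightarrow> real) \<Rightarrow> nat \<Rightarrow> ('a \<Rightarrow> 'b) \<Rightarrow> 'b \<Rightarrow> 'a \<Rightarrow> 'a \<Rightarrow> real \<Rightarrow> real \<Rightarrow> real" where
  "qtilde p n A b c e \<alpha> t =
     (case qcoeffs n \<alpha> (eigenvalues p e (x_opt p A b c e \<alpha>)) of
        (a2, a1, a0) \<Rightarrow> a2 * t ^ 2 + a1 * t + a0)"

definition strictly_convex_on :: "real set \<Rightarrow> (real \<Rightarrow> real) \<Rightarrow> bool" where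
  "strictly_convex_on S f \<longleftrightarrow> (\<forall>x\<in>S. \<forall>y\<in>S. x \<noteq> y \<longrightarrow>
     (\<forall>u. 0 < u \<and> u < 1 \<longrightarrow> f ((1 - u) * x + u * y) < (1 - u) * f x + u * f y))"

definition t_step :: "('a::real_inner \<Rightarrow> real) \<Rightarrow> nat \<Rightarrow> ('a \<Rightarrow> 'b) \<Rightarrow> 'b \<Rightarrow> 'a \<Rightarrow> 'a \<Rightarrow> real \<Rightarrow> real" where
  "t_step p n A b c e \<alpha> = (THE t. \<forall>s. qtilde p n A b c e \<alpha> t \<le> qtilde p n A b c e \<alpha> s)"

definition next_point :: "('a::real_inner \<Rightarrow> real) \<Rightarrow> nat \<Rightarrow> ('a \<Rightarrow> 'b) \<Rightarrow> 'b \<Rightarrow> 'a \<Rightarrow> real \<Rightarrow> 'a \<Rightarrow> 'a" where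
  "next_point p n A b c \<alpha> e =
     (let t = t_step p n A b c e \<alpha> in (1 / (1 + t)) *\<^sub>R (e + t *\<^sub>R x_opt p A b c e \<alpha>))"

end

theory Submission
  imports Defs "HOL-Complex_Analysis.Complex_Analysis"
    "HOL-Computational_Algebra.Fundamental_Theorem_Algebra"
begin

text \<open>
  Put \<open>x = x\<^sub>e(\<alpha>)\<close>, let \<open>l\<^sub>i\<close> be its eigenvalues in direction \<open>e\<close> and \<open>\<sigma>\<close> their sum. The optimality
  conditions make the optimal dual slack \<open>s\<^sub>e\<close> a positive multiple of \<open>H(e) (\<sigma> e - \<alpha>\<^sup>2 x)\<close>. It remains
  dual feasible at \<open>E = e + t x\<close> as soon as its dual local norm at \<open>E\<close> is small enough, and the square
  of this norm is at most a multiple of \<open>\<Sum> (1 + t l\<^sub>i)\<^sup>2 (\<sigma> - \<alpha>\<^sup>2 l\<^sub>i)\<^sup>2\<close>, which is the quadratic of the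
  theorem. Its minimiser therefore puts \<open>s\<^sub>e\<close> so deep into the dual cone at \<open>e'\<close> that either the dual
  objective increases substantially or \<open>x\<^sub>e\<^sub>'(\<alpha>)\<close> has a small local norm, which forces the next step
  to be long.

  The bound on the dual norm is a Cauchy-Schwarz inequality for matrices when \<open>p\<close> is a determinant.
  In general, let \<open>y\<^sub>i(\<epsilon>)\<close> be the zeros of \<open>z \<mapsto> p (z E - e - \<epsilon> v)\<close>. On the upper half plane the
  function \<open>\<Sum> (Im y\<^sub>i(\<epsilon>))\<^sup>2 / Im \<epsilon>\<close> is subharmonic, it is bounded by a multiple of \<open>Im \<epsilon>\<close>, and its
  quotient by \<open>Im \<epsilon>\<close> tends to \<open>\<langle>v, v\<rangle>\<^sub>E\<close> nontangentially at infinity. By a Phragmen-Lindelof argument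
  it is at most \<open>\<langle>v, v\<rangle>\<^sub>E Im \<epsilon>\<close> everywhere, and letting \<open>\<epsilon>\<close> tend to \<open>0\<close> along the imaginary axis shows
  that the derivatives \<open>\<xi>\<^sub>i\<close> of the eigenvalues of \<open>e\<close> in the direction \<open>v\<close> satisfy
  \<open>\<Sum> \<xi>\<^sub>i\<^sup>2 \<le> \<langle>v, v\<rangle>\<^sub>E\<close>. This replaces the Helton-Vinnikov theorem.
\<close>

section \<open>Complexification of polynomial functions\<close>

text \<open>The zeros along a complex pencil come with no labelling that is continuous in the
  parameter. Labellings are therefore arbitrary: only symmetric sums are treated as functions of the
  parameter, limits are taken along subsequences, and holomorphy enters through contour integrals.
  The two-term shape of the spectral bound is dictated by the step. Since x = (E - e) / t, the dual
  slack is a combination of <e, .>_e and <E, .>_e, and both are first-order data of the eigenvalues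
  of e in direction E: one is the derivative of ln p, the other comes from differentiating its
  logarithmic derivative in direction E. The constant \<kappa> balances two consecutive steps. With
  \<nu> the local norm of the optimal solution at e', the first step multiplies the gap by at most 1
  - w, where w = \<alpha> (1 - \<alpha>) \<nu> / (4 (n - \<alpha>^2)), and the second by at most 1 /
  (1 + t'), where t' >= \<alpha> / (2 \<nu>). In the product t' w the unknown \<nu> cancels, which
  leaves at least \<alpha>^2 (1 - \<alpha>) / (8 n) = \<kappa>^2 / n. So t' or w is at least
  \<kappa> / sqrt n, and either case yields the stated factor.\<close>

inductive complexifies :: "('a::real_inner \<Rightarrow> real) \<Rightarrow> ('a \<times> 'a \<Rightarrow> complex) \<Rightarrow> bool" where
  cpx_const: "complexifies (\<lambda>x. k) (\<lambda>U. of_real k)"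
| cpx_lin: "complexifies (\<lambda>x. inner a x) (\<lambda>U. Complex (inner a (fst U)) (inner a (snd U)))"
| cpx_add: "complexifies f F \<Longrightarrow> complexifies g G \<Longrightarrow> complexifies (\<lambda>x. f x + g x) (\<lambda>U. F U + G U)"
| cpx_mult: "complexifies f F \<Longrightarrow> complexifies g G \<Longrightarrow> complexifies (\<lambda>x. f x * g x) (\<lambda>U. F U * G U)"

text \<open>A polynomial function carries no syntax from which a complex extension could be
  computed, so \<open>F\<close> is built along a derivation of \<open>poly_fun p\<close>; its basic
  properties are then inductions over \<open>complexifies\<close>.\<close>

lemma poly_fun_complexifies: "poly_fun p \<Longrightarrow> \<exists>F. complexifies p F"
  by (induction rule: poly_fun.induct) (blast intro: complexifies.intros)+

text \<open>The pair \<open>(u, w)\<close> stands for the complex vector \<open>u + i w\<close>.\<close>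

definition cscale :: "complex \<Rightarrow> 'a \<times> 'a \<Rightarrow> 'a::real_vector \<times> 'a" where
  "cscale z U = (Re z *\<^sub>R fst U - Im z *\<^sub>R snd U, Re z *\<^sub>R snd U + Im z *\<^sub>R fst U)"

lemma cscale_of_real [simp]: "cscale (of_real r) U = r *\<^sub>R U"
  by (auto simp: cscale_def prod_eq_iff)

lemma cscale_1 [simp]: "cscale 1 U = U" and cscale_0 [simp]: "cscale 0 U = 0"
  by (auto simp: cscale_def prod_eq_iff)

lemma cscale_cscale: "cscale z (cscale w U) = cscale (z * w) U"
  by (auto simp: cscale_def prod_eq_iff algebra_simps)

lemma cscale_add: "cscale z (U + V) = cscale z U + cscale z V"
  and cscale_minus: "cscale z (- U) = - cscale z U"
  and cscale_diff: "cscale z (U - V) = cscale z U - cscale z V"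
  by (auto simp: cscale_def prod_eq_iff algebra_simps)

lemma tendsto_cscale [tendsto_intros]:
  fixes U :: "'b \<Rightarrow> 'a::real_normed_vector \<times> 'a"
  assumes "(z \<longlongrightarrow> z0) G" "(U \<longlongrightarrow> U0) G"
  shows "((\<lambda>k. cscale (z k) (U k)) \<longlongrightarrow> cscale z0 U0) G"
  unfolding cscale_def by (intro tendsto_intros assms)

lemma complexifies_real: "complexifies p F \<Longrightarrow> F (u, 0) = of_real (p u)"
  by (induction rule: complexifies.induct) (auto simp: complex_eq_iff)

lemma complexifies_cnj: "complexifies p F \<Longrightarrow> F (u, - w) = cnj (F (u, w))"
  by (induction rule: complexifies.induct) (auto simp: complex_eq_iff)

lemma complexifies_continuous: "complexifies p F \<Longrightarrow> continuous_on UNIV F"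
proof (induction rule: complexifies.induct)
  case (cpx_lin a)
  have "continuous_on UNIV (\<lambda>U::'a\<times>'a. of_real (inner a (fst U)) + \<i> * of_real (inner a (snd U)))"
    by (intro continuous_intros)
  then show ?case by (simp add: Complex_eq)
qed (auto intro!: continuous_intros)

text \<open>\<open>Q\<close> is a polynomial in z whose coefficients are polynomials in \<epsilon>;
  evaluating at \<open>[:z:]\<close> fixes z first. In this form \<open>pderiv Q\<close> is the
  derivative in z and \<open>map_poly pderiv Q\<close> the one in \<epsilon>.\<close>

lemma complexifies_bivariate:
  "complexifies p F \<Longrightarrow>
     \<exists>Q :: complex poly poly. \<forall>z \<epsilon>. F (U0 + cscale z U1 + cscale \<epsilon> U2) = poly (poly Q [:z:]) \<epsilon>"
proof (induction rule: complexifies.induct)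
  case (cpx_const k)
  show ?case by (rule exI[of _ "[:[:of_real k:]:]"]) simp
next
  case (cpx_lin a)
  define l where "l U = Complex (inner a (fst U)) (inner a (snd U))" for U :: "'a \<times> 'a"
  have "l (U0 + cscale z U1 + cscale \<epsilon> U2) = l U0 + z * l U1 + \<epsilon> * l U2" for z \<epsilon>
    by (auto simp: l_def cscale_def complex_eq_iff algebra_simps inner_add_right inner_diff_right)
  then show ?case
    by (intro exI[of _ "[:[:l U0, l U2:], [:l U1:]:]"]) (simp add: l_def)
next
  case (cpx_add f F g G)
  then obtain Q R where
    "\<forall>z \<epsilon>. F (U0 + cscale z U1 + cscale \<epsilon> U2) = poly (poly Q [:z:]) \<epsilon>"
    "\<forall>z \<epsilon>. G (U0 + cscale z U1 + cscale \<epsilon> U2) = poly (poly R [:z:]) \<epsilon>" by blast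
  then show ?case by (intro exI[of _ "Q + R"]) simp
next
  case (cpx_mult f F g G)
  then obtain Q R where
    "\<forall>z \<epsilon>. F (U0 + cscale z U1 + cscale \<epsilon> U2) = poly (poly Q [:z:]) \<epsilon>"
    "\<forall>z \<epsilon>. G (U0 + cscale z U1 + cscale \<epsilon> U2) = poly (poly R [:z:]) \<epsilon>" by blast
  then show ?case by (intro exI[of _ "Q * R"]) simp
qed

lemma complexifies_univariate:
  assumes "complexifies p F"
  shows "\<exists>q :: complex poly. \<forall>z. F (U0 + cscale z U1) = poly q z"
proof -
  obtain Q :: "complex poly poly" where
    "\<forall>z \<epsilon>. F (U0 + cscale z 0 + cscale \<epsilon> U1) = poly (poly Q [:z:]) \<epsilon>"
    using complexifies_bivariate[OF assms] by blast
  then have "F (U0 + cscale \<epsilon> U1) = poly (poly Q [:0:]) \<epsilon>" for \<epsilon>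
    by (metis add.right_neutral cscale_0)
  then show ?thesis by blast
qed

text \<open>The bridge from \<open>p\<close> to \<open>F\<close>: identities known on real vectors
  extend to complex ones one variable at a time.\<close>

lemma poly_eqI_of_real:
  fixes q r :: "complex poly"
  assumes "\<And>t::real. poly q (of_real t) = poly r (of_real t)"
  shows "q = r"
proof (rule ccontr)
  assume "q \<noteq> r"
  then have "finite {z. poly (q - r) z = 0}" by (intro poly_roots_finite) simp
  moreover have "range complex_of_real \<subseteq> {z. poly (q - r) z = 0}" using assms by auto
  ultimately have "finite (range complex_of_real)" by (rule finite_subset[rotated])
  then have "finite (UNIV :: real set)" using finite_imageD inj_of_real by blast
  then show False by (simp add: infinite_UNIV_char_0)
qed

locale complexified_form =
  fixes p :: "'a::euclidean_space \<Rightarrow> real" and n :: nat and F :: "'a \<times> 'a \<Rightarrow> complex"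
  assumes cpx: "complexifies p F" and hom: "homogeneous_of_degree p n"
begin

lemma F_real [simp]: "F (u, 0) = of_real (p u)"
  by (rule complexifies_real[OF cpx])

lemma F_tendsto: "(U \<longlongrightarrow> U0) G \<Longrightarrow> ((\<lambda>k. F (U k)) \<longlongrightarrow> F U0) G"
  using complexifies_continuous[OF cpx] continuous_on_tendsto_compose by fastforce

lemma p_scale: "p (s *\<^sub>R x) = s ^ n * p x"
  using hom by (simp add: homogeneous_of_degree_def)

text \<open>Two extensions from the real axis. For real s the identity is polynomial in the
  coefficient of the imaginary direction w and is evaluated at \<i>; for a fixed complex vector it
  is then polynomial in z.\<close>

lemma F_scale: "F (cscale z U) = z ^ n * F U"
proof -
  obtain u w where U: "U = (u, w)" by force
  have real_scale: "F (s *\<^sub>R U) = of_real s ^ n * F U" for s :: real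
  proof -
    obtain q where q: "\<forall>z. F ((u, 0) + cscale z (w, 0)) = poly q z"
      using complexifies_univariate[OF cpx] by blast
    obtain r where r: "\<forall>z. F ((s *\<^sub>R u, 0) + cscale z (s *\<^sub>R w, 0)) = poly r z"
      using complexifies_univariate[OF cpx] by blast
    have "r = smult (of_real s ^ n) q"
    proof (rule poly_eqI_of_real)
      fix t :: real
      have "poly r (of_real t) = F (s *\<^sub>R (u + t *\<^sub>R w), 0)"
        by (simp add: r[rule_format, symmetric] scaleR_add_right mult.commute)
      also have "\<dots> = of_real s ^ n * F (u + t *\<^sub>R w, 0)" by (simp add: p_scale)
      also have "\<dots> = poly (smult (of_real s ^ n) q) (of_real t)"
        by (simp add: q[rule_format, symmetric])
      finally show "poly r (of_real t) = poly (smult (of_real s ^ n) q) (of_real t)" .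
    qed
    then have "poly r \<i> = of_real s ^ n * poly q \<i>" by simp
    then show ?thesis by (simp add: q[rule_format, symmetric] r[rule_format, symmetric] cscale_def U)
  qed
  obtain q where q: "\<forall>z. F (0 + cscale z U) = poly q z"
    using complexifies_univariate[OF cpx] by blast
  have "q = monom (F U) n"
    by (rule poly_eqI_of_real) (simp add: q[rule_format, symmetric] real_scale poly_monom mult.commute)
  then show ?thesis using q by (simp add: poly_monom mult.commute)
qed

text \<open>The zeros with multiplicity as values on \<open>{..<n}\<close>, unconstrained beyond n
  and in no particular order. For U = (- x, 0) they are the eigenvalues of x in direction E; complex
  and perturbed vectors U are needed as well.\<close>

definition root_labelling :: "'a \<Rightarrow> 'a \<times> 'a \<Rightarrow> (nat \<Rightarrow> complex) \<Rightarrow> bool" where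
  "root_labelling E U y \<longleftrightarrow>
     (\<forall>z. F (cscale z (E, 0) + U) = of_real (p E) * (\<Prod>i<n. z - y i))"

lemma root_labelling_zero_iff:
  assumes "root_labelling E U y" "p E \<noteq> 0"
  shows "F (cscale z (E, 0) + U) = 0 \<longleftrightarrow> (\<exists>i<n. z = y i)"
  using assms by (auto simp: root_labelling_def)

text \<open>Reversal fixes the degree: q z / z^n equals r (1 / z) with r 0 = p E, so it tends to a
  nonzero limit at infinity. Comparing with the limit of q z / z^(degree q) forces degree n and
  leading coefficient p E.\<close>

lemma root_labelling_exists:
  assumes "p E \<noteq> 0"
  shows "\<exists>y. root_labelling E U y"
proof -
  obtain q where q: "\<forall>z. F (U + cscale z (E, 0)) = poly q z"
    using complexifies_univariate[OF cpx] by blast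
  obtain r where r: "\<forall>z. F ((E, 0) + cscale z U) = poly r z"
    using complexifies_univariate[OF cpx] by blast
  have qr: "poly q z = z ^ n * poly r (inverse z)" if "z \<noteq> 0" for z
  proof -
    have "U + cscale z (E, 0) = cscale z ((E, 0) + cscale (inverse z) U)"
      using that by (simp add: cscale_add cscale_cscale add.commute)
    then show ?thesis using q r F_scale by metis
  qed
  have r0: "poly r 0 = of_real (p E)" using r[rule_format, of 0] by simp
  have lim: "((\<lambda>z. poly r (inverse z)) \<longlongrightarrow> of_real (p E)) at_infinity"
  proof -
    have "((\<lambda>z. poly r (inverse z)) \<longlongrightarrow> poly r 0) at_infinity"
      by (intro tendsto_intros isCont_tendsto_compose[of _ "poly r"] tendsto_inverse_0) simp
    then show ?thesis by (simp add: r0)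
  qed
  have limq: "((\<lambda>z. poly q z / z ^ n) \<longlongrightarrow> of_real (p E)) at_infinity"
  proof (rule Lim_transform_eventually[OF lim])
    have "poly r (inverse z) = poly q z / z ^ n" if "norm z \<ge> 1" for z
      using qr[of z] that by fastforce
    then show "\<forall>\<^sub>F z in at_infinity. poly r (inverse z) = poly q z / z ^ n"
      by (auto simp: eventually_at_infinity)
  qed
  have q0: "q \<noteq> 0"
  proof
    assume "q = 0"
    then have "((\<lambda>z::complex. 0::complex) \<longlongrightarrow> of_real (p E)) at_infinity" using limq by simp
    then show False using assms tendsto_unique[OF trivial_limit_at_infinity _ tendsto_const] by fastforce
  qed
  have lc: "((\<lambda>z. poly q z / z ^ degree q) \<longlongrightarrow> lead_coeff q) at_infinity"
    by (rule poly_divide_tendsto_aux)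
  have drop: "((\<lambda>z. poly q z / z ^ m) \<longlongrightarrow> 0) at_infinity"
    if a: "((\<lambda>z. poly q z / z ^ a) \<longlongrightarrow> l) at_infinity" "a < m" for a m l
  proof (rule Lim_transform_eventually)
    show "((\<lambda>z. poly q z / z ^ a * inverse z ^ (m - a)) \<longlongrightarrow> 0) at_infinity"
      using a(2) tendsto_mult[OF a(1) tendsto_power[OF tendsto_inverse_0, of "m - a"]] by (simp add: power_0_left)
    have "poly q z / z ^ a * inverse z ^ (m - a) = poly q z / z ^ m" if "norm z \<ge> 1" for z :: complex
      using that a(2) power_add[of z a "m - a"] by (auto simp: field_simps)
    then show "\<forall>\<^sub>F z in at_infinity. poly q z / z ^ a * inverse z ^ (m - a) = poly q z / z ^ m"
      by (auto simp: eventually_at_infinity)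
  qed
  have deg: "degree q = n"
  proof (rule linorder_cases[of "degree q" n])
    assume "degree q < n"
    then show ?thesis
      using drop[OF lc] limq assms tendsto_unique[OF trivial_limit_at_infinity] by fastforce
  next
    assume "n < degree q"
    then show ?thesis
      using drop[OF limq] lc q0 tendsto_unique[OF trivial_limit_at_infinity] by fastforce
  qed
  have lead: "lead_coeff q = of_real (p E)"
    using lc limq deg tendsto_unique[OF trivial_limit_at_infinity] by blast
  obtain y where "smult (lead_coeff q) (\<Prod>i<degree q. [:- y i, 1:]) = q"
    by (rule complex_poly_decompose')
  then have "q = smult (of_real (p E)) (\<Prod>i<n. [:- y i, 1:])" using deg lead by simp
  then have "poly q z = of_real (p E) * (\<Prod>i<n. z - y i)" for z
    by (simp add: poly_prod)
  then show ?thesis unfolding root_labelling_def using q by (metis add.commute)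
qed

end

section \<open>Compactness of labellings and continuity of the zeros\<close>

lemma finite_family_convergent_subseq:
  fixes X :: "nat \<Rightarrow> nat \<Rightarrow> 'b::heine_borel"
  assumes "\<And>i. i < (m::nat) \<Longrightarrow> bounded (range (\<lambda>k. X k i))"
  shows "\<exists>r L. strict_mono (r :: nat \<Rightarrow> nat) \<and> (\<forall>i<m. (\<lambda>k. X (r k) i) \<longlonglongrightarrow> L i)"
  using assms
proof (induction m)
  case 0
  show ?case using strict_mono_id by auto
next
  case (Suc m)
  then obtain r L where r: "strict_mono r" "\<forall>i<m. (\<lambda>k. X (r k) i) \<longlonglongrightarrow> L i" by auto
  have "bounded (range (\<lambda>k. X (r k) m))"
    by (rule bounded_subset[OF Suc.prems[of m]]) auto
  then obtain l r' where r': "strict_mono r'" "((\<lambda>k. X (r k) m) \<circ> r') \<longlonglongrightarrow> l"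
    using bounded_imp_convergent_subsequence by metis
  show ?case
  proof (intro exI[of _ "r \<circ> r'"] exI[of _ "L(m := l)"] conjI allI impI)
    show "strict_mono (r \<circ> r')" using r r' strict_mono_o by blast
    fix i assume "i < Suc m"
    then consider "i < m" | "i = m" by linarith
    then show "(\<lambda>k. X ((r \<circ> r') k) i) \<longlonglongrightarrow> (L(m := l)) i"
    proof cases
      case 1
      then have "((\<lambda>k. X (r k) i) \<circ> r') \<longlonglongrightarrow> L i" using r r' LIMSEQ_subseq_LIMSEQ by blast
      then show ?thesis using 1 by (simp add: o_def)
    qed (use r' in \<open>simp add: o_def\<close>)
  qed
qed

text \<open>Labellings converge only along subsequences; this turns such limits into genuine ones
  for symmetric sums.\<close>

lemma tendsto_if_subsubseq_tendsto:
  fixes X :: "nat \<Rightarrow> 'b::metric_space"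
  assumes "\<And>r. strict_mono (r :: nat \<Rightarrow> nat) \<Longrightarrow> \<exists>r'. strict_mono (r' :: nat \<Rightarrow> nat) \<and> (\<lambda>k. X (r (r' k))) \<longlonglongrightarrow> L"
  shows "X \<longlonglongrightarrow> L"
proof (rule ccontr)
  assume "\<not> X \<longlonglongrightarrow> L"
  then obtain \<epsilon> where \<epsilon>: "\<epsilon> > 0" "\<not> (\<forall>\<^sub>F k in sequentially. dist (X k) L < \<epsilon>)"
    by (auto simp: tendsto_iff)
  then have "infinite {k. \<not> dist (X k) L < \<epsilon>}"
    by (simp add: frequently_cofinite[symmetric] cofinite_eq_sequentially not_eventually)
  then obtain r :: "nat \<Rightarrow> nat" where r: "strict_mono r" "\<And>k. \<not> dist (X (r k)) L < \<epsilon>"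
    using infinite_enumerate[of "{k. \<not> dist (X k) L < \<epsilon>}"] by blast
  obtain r' where "(\<lambda>k. X (r (r' k))) \<longlonglongrightarrow> L" using assms[OF r(1)] by blast
  then have "\<forall>\<^sub>F k in sequentially. dist (X (r (r' k))) L < \<epsilon>" using \<epsilon>(1) by (rule tendstoD)
  then show False using r(2) by (auto simp: eventually_sequentially)
qed

context complexified_form
begin

text \<open>By homogeneity a zero z of large modulus gives F ((E, 0) + U / z) = 0 at a point close
  to (E, 0), where F is nonzero by continuity.\<close>

lemma root_labelling_bounded:
  assumes pE: "p E \<noteq> 0" and U: "U \<longlonglongrightarrow> U0" and y: "\<And>k. root_labelling E (U k) (y k)"
    and i: "i < n"
  shows "bounded (range (\<lambda>k. y k i))"
proof -
  have "(F \<longlongrightarrow> F (E, 0)) (nhds (E, 0))"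
    using F_tendsto[OF filterlim_ident, of "(E, 0)"] by simp
  then have "\<forall>\<^sub>F W in nhds (E, 0). F W \<noteq> 0"
    using pE by (intro tendsto_imp_eventually_ne) auto
  then obtain \<delta> where \<delta>: "\<delta> > 0" "\<And>W. dist W (E, 0) < \<delta> \<Longrightarrow> F W \<noteq> 0"
    by (auto simp: eventually_nhds_metric)
  obtain B where B: "B > 0" "\<And>k. norm (U k) \<le> B"
    using convergent_imp_Bseq[OF convergentI[OF U]] by (auto simp: Bseq_def)
  have "norm (y k i) \<le> 2 * B / \<delta> + 1" for k
  proof (rule ccontr)
    assume "\<not> ?thesis"
    then have big: "norm (y k i) > 2 * B / \<delta>" "norm (y k i) > 0" using B \<delta> by (auto intro: order.strict_trans1[rotated])
    define z where "z = y k i"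
    have zn: "z \<noteq> 0" using big by (auto simp: z_def)
    have "F (cscale z (E, 0) + U k) = 0"
      using root_labelling_zero_iff[OF y pE] i z_def by blast
    moreover have "cscale z (E, 0) + U k = cscale z ((E, 0) + cscale (inverse z) (U k))"
      using zn by (simp add: cscale_add cscale_cscale)
    ultimately have "F ((E, 0) + cscale (inverse z) (U k)) = 0" using zn by (simp add: F_scale)
    moreover have "norm (cscale (inverse z) (U k)) < \<delta>"
    proof -
      have "norm (cscale w V) \<le> 2 * (norm w * norm V)" for w and V :: "'a \<times> 'a"
      proof -
        have "cscale w V = Re w *\<^sub>R V + Im w *\<^sub>R (- snd V, fst V)"
          by (simp add: cscale_def prod_eq_iff)
        moreover have "norm (- snd V, fst V) = norm V"
          by (simp add: norm_prod_def add.commute)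
        ultimately have "norm (cscale w V) \<le> \<bar>Re w\<bar> * norm V + \<bar>Im w\<bar> * norm V"
          by (metis norm_scaleR norm_triangle_ineq)
        also have "\<dots> \<le> norm w * norm V + norm w * norm V"
          by (intro add_mono mult_right_mono abs_Re_le_cmod abs_Im_le_cmod) auto
        finally show ?thesis by simp
      qed
      then have "norm (cscale (inverse z) (U k)) \<le> 2 * (norm (inverse z) * norm (U k))" .
      also have "\<dots> \<le> 2 * (norm (inverse z) * B)" by (intro mult_left_mono B) auto
      also have "\<dots> < \<delta>" using big \<delta> B by (simp add: norm_divide z_def field_simps)
      finally show ?thesis .
    qed
    ultimately show False using \<delta>(2)[of "(E, 0) + cscale (inverse z) (U k)"] by (simp add: dist_norm)
  qed
  then show ?thesis by (auto simp: bounded_iff)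
qed

lemma root_labelling_limit:
  assumes U: "U \<longlonglongrightarrow> U0" and y: "\<And>k. root_labelling E (U k) (y k)"
    and L: "\<And>i. i < n \<Longrightarrow> (\<lambda>k. y k i) \<longlonglongrightarrow> L i"
  shows "root_labelling E U0 L"
  unfolding root_labelling_def
proof
  fix z
  have "(\<lambda>k. F (cscale z (E, 0) + U k)) \<longlonglongrightarrow> F (cscale z (E, 0) + U0)"
    by (intro F_tendsto tendsto_intros U)
  moreover have "(\<lambda>k. of_real (p E) * (\<Prod>i<n. z - y k i)) \<longlonglongrightarrow> of_real (p E) * (\<Prod>i<n. z - L i)"
    by (intro tendsto_intros L) auto
  ultimately show "F (cscale z (E, 0) + U0) = of_real (p E) * (\<Prod>i<n. z - L i)"
    using y unfolding root_labelling_def by (metis (no_types, lifting) LIMSEQ_unique ext)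
qed

lemma root_labelling_subseq:
  assumes pE: "p E \<noteq> 0" and U: "U \<longlonglongrightarrow> U0" and y: "\<And>k. root_labelling E (U k) (y k)"
  shows "\<exists>r L. strict_mono (r :: nat \<Rightarrow> nat) \<and> (\<forall>i<n. (\<lambda>k. y (r k) i) \<longlonglongrightarrow> L i) \<and> root_labelling E U0 L"
proof -
  obtain r L where r: "strict_mono (r :: nat \<Rightarrow> nat)" "\<forall>i<n. (\<lambda>k. y (r k) i) \<longlonglongrightarrow> L i"
    using finite_family_convergent_subseq[of n y] root_labelling_bounded[OF pE U y] by blast
  have "(\<lambda>k. U (r k)) \<longlonglongrightarrow> U0" using LIMSEQ_subseq_LIMSEQ[OF U r(1)] by (simp add: o_def)
  then have "root_labelling E U0 L" by (rule root_labelling_limit) (use r y in auto)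
  then show ?thesis using r by blast
qed

lemma root_labelling_unique:
  assumes pE: "p E \<noteq> 0" and "root_labelling E U y" "root_labelling E U y'"
  shows "image_mset y (mset_set {..<n}) = image_mset y' (mset_set {..<n})"
proof -
  have pr: "proots (\<Prod>i<n. [:- y i, 1:]) = image_mset y (mset_set {..<n})" for y :: "nat \<Rightarrow> complex"
  proof -
    have "proots (\<Prod>i<n. [:- y i, 1:]) = (\<Sum>i<n. {#y i#})" by (subst proots_prod) auto
    also have "\<dots> = image_mset y (mset_set {..<n})" by (induction n) (auto simp: lessThan_Suc)
    finally show ?thesis .
  qed
  have "(\<Prod>i<n. [:- y i, 1:]) = (\<Prod>i<n. [:- y' i, 1:])"
    by (rule poly_eqI_of_real)
      (use assms in \<open>auto simp: root_labelling_def poly_prod dest!: spec\<close>)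
  then show ?thesis using pr by metis
qed

lemma root_labelling_sum_unique:
  assumes "p E \<noteq> 0" "root_labelling E U y" "root_labelling E U y'"
  shows "(\<Sum>i<n. f (y i)) = (\<Sum>i<n. f (y' i))"
proof -
  have *: "(\<Sum>i<n. f (y i)) = \<Sum>\<^sub># (image_mset f (image_mset y (mset_set {..<n})))" for y
    by (simp add: image_mset.compositionality o_def sum_unfold_sum_mset)
  show ?thesis unfolding * root_labelling_unique[OF assms] ..
qed

end

section \<open>Hyperbolic directions\<close>

text \<open>Both \<open>P\<close> and its negation are closed relative to S, so one of them is
  empty. In this form it moves statements about the position of zeros along a connected set of
  parameters.\<close>

lemma connected_sequential_induct:
  fixes S :: "'b::metric_space set"
  assumes S: "connected S" and a: "a \<in> S" "P a"
    and closed: "\<And>X x. (\<And>k. X k \<in> S) \<Longrightarrow> X \<longlonglongrightarrow> x \<Longrightarrow> x \<in> S \<Longrightarrow> (\<And>k. P (X k)) \<Longrightarrow> P x"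
    and open': "\<And>X x. (\<And>k. X k \<in> S) \<Longrightarrow> X \<longlonglongrightarrow> x \<Longrightarrow> x \<in> S \<Longrightarrow> (\<And>k. \<not> P (X k)) \<Longrightarrow> \<not> P x"
    and x: "x \<in> S"
  shows "P x"
proof (rule ccontr)
  assume "\<not> P x"
  define A where "A = closure {x \<in> S. P x}"
  define B where "B = closure {x \<in> S. \<not> P x}"
  have A: "P x" if x: "x \<in> A" "x \<in> S" for x
  proof -
    obtain X where "\<forall>k. X k \<in> {x \<in> S. P x}" "X \<longlonglongrightarrow> x"
      using closure_sequential[THEN iffD1, OF x(1)[unfolded A_def]] by (elim exE conjE)
    then show ?thesis using closed[of X x] x by auto
  qed
  have B: "\<not> P x" if x: "x \<in> B" "x \<in> S" for x
  proof -
    obtain X where "\<forall>k. X k \<in> {x \<in> S. \<not> P x}" "X \<longlonglongrightarrow> x"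
      using closure_sequential[THEN iffD1, OF x(1)[unfolded B_def]] by (elim exE conjE)
    then show ?thesis using open'[of X x] x by auto
  qed
  have AB: "{x \<in> S. P x} \<subseteq> A" "{x \<in> S. \<not> P x} \<subseteq> B"
    unfolding A_def B_def by (rule closure_subset)+
  have "closed A" "closed B" by (auto simp: A_def B_def)
  moreover have "S \<subseteq> A \<union> B" using AB by auto
  moreover have "A \<inter> B \<inter> S = {}" using A B by blast
  moreover have "A \<inter> S \<noteq> {}" using a AB by auto
  moreover have "B \<inter> S \<noteq> {}" using x \<open>\<not> P x\<close> AB by auto
  ultimately show False using S unfolding connected_closed by blast
qed

text \<open>Existence for the definite description in \<open>line_poly\<close>; without it that
  constant would be unspecified.\<close>

lemma complexifies_line_poly:
  "complexifies p F \<Longrightarrow> \<exists>q. \<forall>t. poly q t = p (x + t *\<^sub>R v)"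
proof (induction rule: complexifies.induct)
  case (cpx_const k)
  show ?case by (rule exI[of _ "[:k:]"]) simp
next
  case (cpx_lin a)
  show ?case by (rule exI[of _ "[:inner a x, inner a v:]"]) (simp add: inner_add_right)
next
  case (cpx_add f F g G)
  then show ?case by (metis poly_add)
next
  case (cpx_mult f F g G)
  then show ?case by (metis poly_mult)
qed

lemma poly_map_of_real_complex: "poly (map_poly complex_of_real q) (of_real t) = of_real (poly q t)"
  by (induction q) (simp_all add: map_poly_pCons)

context complexified_form
begin

lemma poly_line_poly: "poly (line_poly p x v) t = p (x + t *\<^sub>R v)"
proof -
  obtain q where q: "\<forall>t. poly q t = p (x + t *\<^sub>R v)" using complexifies_line_poly[OF cpx] by blast
  have "line_poly p x v = q"
    unfolding line_poly_def
  proof (rule the_equality)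
    fix r assume "\<forall>t. poly r t = p (x + t *\<^sub>R v)"
    then have "poly r = poly q" using q by auto
    then show "r = q" by (simp add: poly_eq_poly_eq_iff)
  qed (use q in auto)
  then show ?thesis using q by simp
qed

lemma F_line_poly:
  "F (cscale z (v, 0) + (x, 0)) = poly (map_poly complex_of_real (line_poly p x v)) z"
proof -
  obtain q where q: "\<forall>z. F ((x, 0) + cscale z (v, 0)) = poly q z"
    using complexifies_univariate[OF cpx] by blast
  have "q = map_poly complex_of_real (line_poly p x v)"
    by (rule poly_eqI_of_real)
      (simp add: q[rule_format, symmetric] poly_map_of_real_complex poly_line_poly)
  then show ?thesis using q by (simp add: add.commute)
qed

lemma root_labelling_choice:
  assumes "p E \<noteq> 0"
  obtains y where "\<And>k. root_labelling E (U k) (y k)"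
proof -
  have "\<forall>k. \<exists>y. root_labelling E (U k) y" using root_labelling_exists[OF assms] by blast
  then have "\<exists>y. \<forall>k. root_labelling E (U k) (y k)" by (rule choice)
  then show ?thesis using that by blast
qed

lemma zeros_limit:
  assumes pE: "p E \<noteq> 0" and U: "U \<longlonglongrightarrow> U0" and z: "\<And>k::nat. F (cscale (z k) (E, 0) + U k) = 0"
  shows "\<exists>r z0. strict_mono (r :: nat \<Rightarrow> nat) \<and> (\<lambda>k. z (r k)) \<longlonglongrightarrow> z0 \<and> F (cscale z0 (E, 0) + U0) = 0"
proof -
  obtain y where y: "\<And>k. root_labelling E (U k) (y k)" using root_labelling_choice[OF pE] by blast
  have "bounded (range z)"
  proof (rule bounded_subset)
    show "bounded (\<Union>i<n. range (\<lambda>k. y k i))"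
      using root_labelling_bounded[OF pE U y] by auto
    show "range z \<subseteq> (\<Union>i<n. range (\<lambda>k. y k i))"
      using z root_labelling_zero_iff[OF y pE] by fastforce
  qed
  then obtain z0 r where r: "strict_mono r" "(z \<circ> r) \<longlonglongrightarrow> z0"
    using bounded_imp_convergent_subsequence by metis
  have "(\<lambda>k. F (cscale ((z \<circ> r) k) (E, 0) + (U \<circ> r) k)) \<longlonglongrightarrow> F (cscale z0 (E, 0) + U0)"
    by (intro F_tendsto tendsto_intros r LIMSEQ_subseq_LIMSEQ[OF U])
  then have "F (cscale z0 (E, 0) + U0) = 0" using z by (simp add: LIMSEQ_const_iff)
  then show ?thesis using r by (auto simp: o_def)
qed

text \<open>Plays the part of Hurwitz' theorem: the given zero is some value L i of a limit
  labelling, and the i-th values of the approximating labellings are zeros that converge to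
  it.\<close>

lemma zeros_approximation:
  assumes pE: "p E \<noteq> 0" and U: "U \<longlonglongrightarrow> U0" and z0: "F (cscale z0 (E, 0) + U0) = 0"
  shows "\<exists>r z. strict_mono (r :: nat \<Rightarrow> nat) \<and> z \<longlonglongrightarrow> z0 \<and> (\<forall>k. F (cscale (z k) (E, 0) + U (r k)) = 0)"
proof -
  obtain y where y: "\<And>k. root_labelling E (U k) (y k)" using root_labelling_choice[OF pE] by blast
  obtain r L where r: "strict_mono (r :: nat \<Rightarrow> nat)" "\<forall>i<n. (\<lambda>k. y (r k) i) \<longlonglongrightarrow> L i" "root_labelling E U0 L"
    using root_labelling_subseq[OF pE U y] by blast
  obtain i where i: "i < n" "z0 = L i" using root_labelling_zero_iff[OF r(3) pE] z0 by blast
  have "F (cscale (y (r k) i) (E, 0) + U (r k)) = 0" for k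
    using root_labelling_zero_iff[OF y pE] i by blast
  then show ?thesis using r i by blast
qed

end

section \<open>Garding's theorem: hyperbolicity in every direction of the cone\<close>

locale hyperbolic_cone = complexified_form p n F
  for p :: "'a::euclidean_space \<Rightarrow> real" and n :: nat and F :: "'a \<times> 'a \<Rightarrow> complex" +
  fixes d :: 'a
  assumes hyp: "hyperbolic p n d"
    and pos: "\<forall>x\<in>hcone p d. p x > 0"
    and reg: "regular_cone (hcone_closed p d)"
begin

lemma d_nonzero: "p d \<noteq> 0"
  using hyp by (simp add: hyperbolic_def)

lemma d_in_hcone: "d \<in> hcone p d"
  using d_nonzero by (simp add: hcone_def connected_component_refl)

lemma hcone_positive: "e \<in> hcone p d \<Longrightarrow> p e > 0"
  using pos by blast

lemma connected_subset_hcone: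
  assumes "connected S" "e \<in> S" "e \<in> hcone p d" "\<And>x. x \<in> S \<Longrightarrow> p x \<noteq> 0"
  shows "S \<subseteq> hcone p d"
proof -
  have "S \<subseteq> connected_component_set {x. p x \<noteq> 0} e"
    by (rule connected_component_maximal) (use assms in auto)
  moreover have "connected_component_set {x. p x \<noteq> 0} e = connected_component_set {x. p x \<noteq> 0} d"
    using assms(3) unfolding hcone_def by (simp add: connected_component_eq)
  ultimately show ?thesis by (simp add: hcone_def)
qed

lemma zeros_real_direction_d:
  assumes "F (cscale z (d, 0) + (x, 0)) = 0"
  shows "Im z = 0"
proof -
  have "z \<in> \<real>" using hyp assms unfolding hyperbolic_def F_line_poly by blast
  then show ?thesis by (simp add: complex_is_Real_iff)
qed

text \<open>The zeros are the eigenvalues of e in direction d. They are real, they equal 1 at e = d,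
  and they cannot pass through 0 while e moves inside the connected cone, where p does not
  vanish.\<close>

lemma hcone_positive_zeros:
  assumes e: "e \<in> hcone p d" and z: "F (cscale z (d, 0) + (- e, 0)) = 0"
  shows "Re z > 0"
proof -
  define P where "P e \<longleftrightarrow> (\<forall>z. F (cscale z (d, 0) + (- e, 0)) = 0 \<longrightarrow> Re z > 0)" for e
  have "P e"
  proof (rule connected_sequential_induct[of "hcone p d"])
    show "connected (hcone p d)" unfolding hcone_def by simp
    show "d \<in> hcone p d" by (rule d_in_hcone)
    show "P d" unfolding P_def
    proof (intro allI impI)
      fix z assume z: "F (cscale z (d, 0) + (- d, 0)) = 0"
      have "cscale z (d, 0) + (- d, 0) = cscale (z - 1) (d, 0)"
        by (simp add: cscale_def algebra_simps)
      then have "(z - 1) ^ n * of_real (p d) = 0" using z by (simp add: F_scale)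
      then have "z = 1" using d_nonzero by simp
      then show "Re z > 0" by simp
    qed
    show "e \<in> hcone p d" by (rule e)
  next
    fix X x assume X: "X \<longlonglongrightarrow> x" and x: "x \<in> hcone p d" and PX: "\<And>k. P (X k)"
    show "P x" unfolding P_def
    proof (intro allI impI)
      fix z assume z: "F (cscale z (d, 0) + (- x, 0)) = 0"
      have "(\<lambda>k. (- X k, 0::'a)) \<longlonglongrightarrow> (- x, 0)" by (intro tendsto_intros X)
      then obtain r w where r: "strict_mono (r :: nat \<Rightarrow> nat)" "w \<longlonglongrightarrow> z"
          "\<forall>k. F (cscale (w k) (d, 0) + (- X (r k), 0)) = 0"
        using zeros_approximation[OF d_nonzero _ z] by blast
      have "(\<lambda>k. Re (w k)) \<longlonglongrightarrow> Re z" by (intro tendsto_intros r)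
      moreover have "Re (w k) \<ge> 0" for k using PX r(3) unfolding P_def by (meson less_imp_le)
      ultimately have "Re z \<ge> 0" by (simp add: LIMSEQ_le_const)
      moreover have "z \<noteq> 0"
      proof
        assume "z = 0"
        then have "p (- x) = 0" using z by simp
        then have "p x = 0" using p_scale[of "-1" x] by simp
        then show False using hcone_positive[OF x] by simp
      qed
      ultimately show "Re z > 0" using zeros_real_direction_d[OF z] by (auto simp: complex_eq_iff)
    qed
  next
    fix X x assume X: "X \<longlonglongrightarrow> x" and PX: "\<And>k. \<not> P (X k)"
    then obtain w where w: "\<And>k. F (cscale (w k) (d, 0) + (- X k, 0)) = 0" "\<And>k. Re (w k) \<le> 0"
      unfolding P_def by (metis not_le)
    have "(\<lambda>k. (- X k, 0::'a)) \<longlonglongrightarrow> (- x, 0)" by (intro tendsto_intros X)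
    then obtain r z where r: "strict_mono (r :: nat \<Rightarrow> nat)" "(\<lambda>k. w (r k)) \<longlonglongrightarrow> z"
        "F (cscale z (d, 0) + (- x, 0)) = 0"
      using zeros_limit[OF d_nonzero, of "\<lambda>k. (- X k, 0)" "(- x, 0)" w] w(1) by blast
    have "(\<lambda>k. Re (w (r k))) \<longlonglongrightarrow> Re z" by (intro tendsto_intros r)
    then have "Re z \<le> 0" using w(2) by (simp add: LIMSEQ_le_const2)
    then show "\<not> P x" using r(3) unfolding P_def by force
  qed
  then show ?thesis using z unfolding P_def by blast
qed

text \<open>The zeros of \<open>z \<mapsto> p (s x + z e + i d)\<close> never cross the real axis as \<open>s\<close> varies, and they
  lie in the lower half plane for \<open>s = 0\<close>.\<close>

lemma zeros_lower_half_plane: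
  assumes e: "e \<in> hcone p d" and z: "F (cscale z (e, 0) + (s *\<^sub>R x, d)) = 0"
  shows "Im z < 0"
proof -
  have pe: "p e \<noteq> 0" using hcone_positive[OF e] by simp
  define P where "P s \<longleftrightarrow> (\<forall>z. F (cscale z (e, 0) + (s *\<^sub>R x, d)) = 0 \<longrightarrow> Im z < 0)" for s
  \<comment> \<open>A real z would make \<i> a zero in direction d over the real vector z e + s
    x.\<close>
  have nonreal: "Im z \<noteq> 0" if "F (cscale z (e, 0) + (s *\<^sub>R x, d)) = 0" for z s
  proof
    assume "Im z = 0"
    then have "cscale z (e, 0) + (s *\<^sub>R x, d) = cscale \<i> (d, 0) + (Re z *\<^sub>R e + s *\<^sub>R x, 0)"
      by (simp add: cscale_def)
    then show False using that zeros_real_direction_d by fastforce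
  qed
  have "P s"
  proof (rule connected_sequential_induct[of "UNIV :: real set"])
    show "P 0" unfolding P_def
    proof (intro allI impI)
      fix z assume z: "F (cscale z (e, 0) + (0 *\<^sub>R x, d)) = 0"
      have z0: "z \<noteq> 0"
      proof
        assume "z = 0"
        then have "F (cscale \<i> (d, 0)) = 0" using z by (simp add: cscale_def)
        then show False using d_nonzero by (simp add: F_scale)
      qed
      \<comment> \<open>At s = 0 the number - \<i> / z is an eigenvalue of e in direction d; its
        positivity places z on the negative imaginary axis.\<close>
      have "cscale z (e, 0) + (0 *\<^sub>R x, d) = cscale (- z) (cscale (- \<i> / z) (d, 0) + (- e, 0))"
        using z0 by (simp add: cscale_add cscale_cscale) (simp add: cscale_def)
      then have "F (cscale (- \<i> / z) (d, 0) + (- e, 0)) = 0" using z z0 by (simp add: F_scale)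
      then have "Re (- \<i> / z) > 0" by (rule hcone_positive_zeros[OF e])
      then have "0 < - Im z / (norm z)\<^sup>2"
        using z0 by (simp add: Re_divide cmod_power2)
      then show "Im z < 0" using z0 by (simp add: divide_less_0_iff)
    qed
  next
    fix X and s :: real assume X: "X \<longlonglongrightarrow> s" and PX: "\<And>k. P (X k)"
    show "P s" unfolding P_def
    proof (intro allI impI)
      fix z assume z: "F (cscale z (e, 0) + (s *\<^sub>R x, d)) = 0"
      have "(\<lambda>k. (X k *\<^sub>R x, d)) \<longlonglongrightarrow> (s *\<^sub>R x, d)" by (intro tendsto_intros X)
      then obtain r w where r: "strict_mono (r :: nat \<Rightarrow> nat)" "w \<longlonglongrightarrow> z"
          "\<forall>k. F (cscale (w k) (e, 0) + (X (r k) *\<^sub>R x, d)) = 0"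
        using zeros_approximation[OF pe _ z] by blast
      have "(\<lambda>k. Im (w k)) \<longlonglongrightarrow> Im z" by (intro tendsto_intros r)
      moreover have "Im (w k) \<le> 0" for k using PX r(3) unfolding P_def by (meson less_imp_le)
      ultimately have "Im z \<le> 0" by (simp add: LIMSEQ_le_const2)
      then show "Im z < 0" using nonreal[OF z] by simp
    qed
  next
    fix X and s :: real assume X: "X \<longlonglongrightarrow> s" and PX: "\<And>k. \<not> P (X k)"
    then obtain w where w: "\<And>k. F (cscale (w k) (e, 0) + (X k *\<^sub>R x, d)) = 0" "\<And>k. Im (w k) \<ge> 0"
      unfolding P_def by (metis not_le)
    have "(\<lambda>k. (X k *\<^sub>R x, d)) \<longlonglongrightarrow> (s *\<^sub>R x, d)" by (intro tendsto_intros X)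
    then obtain r z where r: "strict_mono (r :: nat \<Rightarrow> nat)" "(\<lambda>k. w (r k)) \<longlonglongrightarrow> z"
        "F (cscale z (e, 0) + (s *\<^sub>R x, d)) = 0"
      using zeros_limit[OF pe, of "\<lambda>k. (X k *\<^sub>R x, d)" "(s *\<^sub>R x, d)" w] w(1) by blast
    have "(\<lambda>k. Im (w (r k))) \<longlonglongrightarrow> Im z" by (intro tendsto_intros r)
    then have "Im z \<ge> 0" using w(2) by (simp add: LIMSEQ_le_const)
    then show "\<not> P s" using r(3) unfolding P_def by force
  qed auto
  then show ?thesis using z unfolding P_def by blast
qed

text \<open>Rescaling turns the previous lemma into one about the perturbation \<gamma> d. Letting
  \<gamma> tend to 0 leaves Im z <= 0, and the conjugate of z is a zero too because p has real
  coefficients.\<close>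

theorem zeros_real:
  assumes e: "e \<in> hcone p d" and z: "F (cscale z (e, 0) + (x, 0)) = 0"
  shows "Im z = 0"
proof -
  have pe: "p e \<noteq> 0" using hcone_positive[OF e] by simp
  have le: "Im z \<le> 0" if z: "F (cscale z (e, 0) + (x, 0)) = 0" for z
  proof -
    define \<gamma> where "\<gamma> k = inverse (real (Suc k))" for k
    have "(\<lambda>k. (x, \<gamma> k *\<^sub>R d)) \<longlonglongrightarrow> (x, 0 *\<^sub>R d)"
      unfolding \<gamma>_def by (intro tendsto_intros LIMSEQ_inverse_real_of_nat)
    then obtain r w where r: "strict_mono (r :: nat \<Rightarrow> nat)" "w \<longlonglongrightarrow> z"
        "\<forall>k. F (cscale (w k) (e, 0) + (x, \<gamma> (r k) *\<^sub>R d)) = 0"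
      using zeros_approximation[OF pe, of "\<lambda>k. (x, \<gamma> k *\<^sub>R d)" "(x, 0)" z] z by auto
    have "Im (w k) \<le> 0" for k
    proof -
      define g where "g = \<gamma> (r k)"
      have g: "g > 0" by (simp add: g_def \<gamma>_def)
      have eq: "cscale (w k) (e, 0) + (x, g *\<^sub>R d)
          = cscale (of_real g) (cscale (w k / of_real g) (e, 0) + (inverse g *\<^sub>R x, d))"
        using g by (simp add: cscale_add cscale_cscale)
      have "F (cscale (w k) (e, 0) + (x, g *\<^sub>R d)) = 0" using r(3) by (simp add: g_def)
      then have "F (cscale (w k / of_real g) (e, 0) + (inverse g *\<^sub>R x, d)) = 0"
        using g by (simp only: eq F_scale) simp
      then have "Im (w k / of_real g) < 0" by (rule zeros_lower_half_plane[OF e])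
      then show ?thesis using g by (simp add: Im_divide_of_real divide_less_0_iff)
    qed
    moreover have "(\<lambda>k. Im (w k)) \<longlonglongrightarrow> Im z" by (intro tendsto_intros r)
    ultimately show ?thesis by (simp add: LIMSEQ_le_const2)
  qed
  have "F (cscale (cnj z) (e, 0) + (x, 0)) = cnj (F (cscale z (e, 0) + (x, 0)))"
    using complexifies_cnj[OF cpx, of "Re z *\<^sub>R e + x" "Im z *\<^sub>R e"] by (simp add: cscale_def)
  then have "Im (cnj z) \<le> 0" using le[of "cnj z"] z by simp
  then show ?thesis using le[OF z] by simp
qed

text \<open>Hyperbolicity as a stability property: the vector is a real one plus \<i> or - \<i>
  times e, so a zero here would be a nonreal zero in direction e.\<close>

lemma F_nonzero_imaginary:
  assumes "e \<in> hcone p d"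
  shows "F (x, e) \<noteq> 0" "F (x, - e) \<noteq> 0"
proof -
  have "(x, e) = cscale \<i> (e, 0) + (x, 0)" "(x, - e) = cscale (- \<i>) (e, 0) + (x, 0)"
    by (auto simp: cscale_def)
  then show "F (x, e) \<noteq> 0" "F (x, - e) \<noteq> 0"
    using zeros_real[OF assms, of \<i> x] zeros_real[OF assms, of "- \<i>" x] by force+
qed

lemma hcone_scale:
  assumes e: "e \<in> hcone p d" and s: "s > 0"
  shows "s *\<^sub>R e \<in> hcone p d"
proof -
  have "(\<lambda>r. r *\<^sub>R e) ` {0<..} \<subseteq> hcone p d"
  proof (rule connected_subset_hcone[OF _ _ e])
    show "connected ((\<lambda>r. r *\<^sub>R e) ` {0<..})"
      by (intro connected_continuous_image continuous_intros) auto
    show "e \<in> (\<lambda>r. r *\<^sub>R e) ` {0<..}" by (rule image_eqI[of _ _ 1]) auto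
  qed (use hcone_positive[OF e] in \<open>auto simp: p_scale\<close>)
  then show ?thesis using s by blast
qed

lemma hcone_segment:
  assumes e: "e \<in> hcone p d" and s: "\<And>\<tau>. 0 \<le> \<tau> \<Longrightarrow> \<tau> \<le> 1 \<Longrightarrow> p (e + \<tau> *\<^sub>R v) \<noteq> 0"
  shows "e + v \<in> hcone p d"
proof -
  have "(\<lambda>\<tau>. e + \<tau> *\<^sub>R v) ` {0..1} \<subseteq> hcone p d"
  proof (rule connected_subset_hcone[OF _ _ e])
    show "connected ((\<lambda>\<tau>. e + \<tau> *\<^sub>R v) ` {0..1})"
      by (intro connected_continuous_image continuous_intros) auto
    show "e \<in> (\<lambda>\<tau>. e + \<tau> *\<^sub>R v) ` {0..1}" by (rule image_eqI[of _ _ 0]) auto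
  qed (use s in auto)
  moreover have "e + v \<in> (\<lambda>\<tau>. e + \<tau> *\<^sub>R v) ` {0..1}" by (rule image_eqI[of _ _ 1]) auto
  ultimately show ?thesis by blast
qed

lemma real_root_labelling:
  assumes e: "e \<in> hcone p d"
  shows "\<exists>l :: nat \<Rightarrow> real. root_labelling e (- x, 0) (\<lambda>i. of_real (l i))"
proof -
  have pe: "p e \<noteq> 0" using hcone_positive[OF e] by simp
  obtain y where y: "root_labelling e (- x, 0) y" using root_labelling_exists[OF pe] by blast
  have "y i = of_real (Re (y i))" if "i < n" for i
    using zeros_real[OF e, of "y i" "- x"] root_labelling_zero_iff[OF y pe, of "y i"] that
    by (auto simp: complex_eq_iff)
  then have "(\<Prod>i<n. z - y i) = (\<Prod>i<n. z - of_real (Re (y i)))" for z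
    by (intro prod.cong) auto
  then have "root_labelling e (- x, 0) (\<lambda>i. of_real (Re (y i)))"
    using y unfolding root_labelling_def by simp
  then show ?thesis by (intro exI[of _ "\<lambda>i. Re (y i)"])
qed

lemma real_root_labelling_factor:
  assumes l: "root_labelling e (- x, 0) (\<lambda>i. of_real (l i))"
  shows "p (a *\<^sub>R e + c *\<^sub>R x) = p e * (\<Prod>i<n. a + c * l i)"
proof (cases "c = 0")
  case True
  then show ?thesis by (simp add: p_scale)
next
  case False
  have minus: "p (z *\<^sub>R e - x) = p e * (\<Prod>i<n. z - l i)" for z
  proof -
    have "of_real (p (z *\<^sub>R e - x)) = F (cscale (of_real z) (e, 0) + (- x, 0))" by simp
    also have "\<dots> = of_real (p e * (\<Prod>i<n. z - l i))"
      using l[unfolded root_labelling_def, rule_format, of "of_real z"] by (simp del: cscale_of_real)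
    finally show ?thesis using of_real_eq_iff by blast
  qed
  have "a *\<^sub>R e + c *\<^sub>R x = (- c) *\<^sub>R ((- a / c) *\<^sub>R e - x)"
    using False by (simp add: algebra_simps)
  then have "p (a *\<^sub>R e + c *\<^sub>R x) = p e * ((- c) ^ n * (\<Prod>i<n. - a / c - l i))"
    by (simp only: p_scale minus mult.left_commute)
  also have "(- c) ^ n * (\<Prod>i<n. - a / c - l i) = (\<Prod>i<n. - c * (- a / c - l i))"
    by (simp only: prod.distrib prod_constant card_lessThan)
  also have "\<dots> = (\<Prod>i<n. a + c * l i)"
    using False by (intro prod.cong) (auto simp: field_simps)
  finally show ?thesis .
qed

lemma real_root_labelling_eigenvalues:
  assumes e: "e \<in> hcone p d" and l: "root_labelling e (- x, 0) (\<lambda>i. of_real (l i))"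
  shows "eigenvalues p e x = image_mset l (mset_set {..<n})"
proof -
  have pe: "p e \<noteq> 0" using hcone_positive[OF e] by simp
  have "line_poly p (- x) e = smult (p e) (\<Prod>i<n. [:- l i, 1:])"
  proof -
    have "poly (line_poly p (- x) e) t = poly (smult (p e) (\<Prod>i<n. [:- l i, 1:])) t" for t
      using real_root_labelling_factor[OF l, of t "-1"]
      by (simp add: poly_line_poly poly_prod algebra_simps)
    then show ?thesis by (metis poly_eq_poly_eq_iff ext)
  qed
  then have "eigenvalues p e x = proots (\<Prod>i<n. [:- l i, 1:])"
    using pe by (simp add: eigenvalues_def)
  also have "\<dots> = (\<Sum>i<n. {#l i#})" by (subst proots_prod) auto
  also have "\<dots> = image_mset l (mset_set {..<n})" by (induction n) (auto simp: lessThan_Suc)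
  finally show ?thesis .
qed

text \<open>In degree 0 the form is a nonzero constant and the cone is the whole space, which is not
  pointed.\<close>

lemma degree_positive: "n > 0"
proof (rule ccontr)
  assume "\<not> n > 0"
  then have "p x \<noteq> 0" for x using p_scale[of 0 x] p_scale[of 0 d] d_nonzero by simp
  then have "{x. p x \<noteq> 0} = UNIV" by blast
  then have "hcone p d = UNIV" unfolding hcone_def by simp
  then have "hcone_closed p d = UNIV" by (simp add: hcone_closed_def)
  then have "(UNIV :: 'a set) \<inter> uminus ` UNIV = {0}"
    using reg by (simp add: regular_cone_def)
  moreover obtain b :: 'a where "b \<in> Basis" using nonempty_Basis by blast
  moreover have "b \<in> UNIV \<inter> uminus ` UNIV" by (auto intro: image_eqI[of _ _ "- b"])
  ultimately show False using nonzero_Basis by blast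
qed

text \<open>If all eigenvalues of v vanish, p (a e + s v) = p e * a^n, so every a e + s v with a > 0
  lies in the cone. Letting a tend to 0 puts v and - v into its closure, against pointedness. This
  makes the local inner product definite.\<close>

lemma vanishing_roots_imp_zero:
  assumes e: "e \<in> hcone p d" and l: "root_labelling e (- v, 0) (\<lambda>i. of_real (l i))"
    and z: "\<And>i. i < n \<Longrightarrow> l i = 0"
  shows "v = 0"
proof -
  have mem: "inverse (real (Suc k)) *\<^sub>R e + c *\<^sub>R v \<in> hcone p d" for k c
  proof (rule hcone_segment)
    show "inverse (real (Suc k)) *\<^sub>R e \<in> hcone p d" using hcone_scale[OF e] by simp
    have "p (a *\<^sub>R e + s *\<^sub>R v) = p e * a ^ n" for a s
      using real_root_labelling_factor[OF l] z by simp
    then show "p (inverse (real (Suc k)) *\<^sub>R e + \<tau> *\<^sub>R c *\<^sub>R v) \<noteq> 0" for \<tau>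
      using hcone_positive[OF e] by simp
  qed
  have lim: "(\<lambda>k. inverse (real (Suc k)) *\<^sub>R e + c *\<^sub>R v) \<longlonglongrightarrow> 0 *\<^sub>R e + c *\<^sub>R v" for c
    by (intro tendsto_intros LIMSEQ_inverse_real_of_nat)
  have "c *\<^sub>R v \<in> hcone_closed p d" for c
    unfolding hcone_closed_def closure_sequential using mem lim[of c]
    by (intro exI[of _ "\<lambda>k. inverse (real (Suc k)) *\<^sub>R e + c *\<^sub>R v"]) simp
  from this[of 1] this[of "-1"] have "v \<in> hcone_closed p d \<inter> uminus ` hcone_closed p d"
    by (auto intro: image_eqI[of _ _ "- v"])
  then show ?thesis using reg by (auto simp: regular_cone_def)
qed

end

section \<open>The local inner product\<close>

text \<open>Gradient and Hessian are produced along the derivation of \<open>poly_fun\<close>, with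
  symmetry of the Hessian as part of the induction. In \<open>H x v h\<close> the vector v is paired
  with the gradient and h is the direction of differentiation.\<close>

lemma poly_fun_derivatives:
  "poly_fun p \<Longrightarrow> \<exists>g H. (\<forall>x. (p has_derivative (\<lambda>h. inner (g x) h)) (at x)) \<and>
     (\<forall>x v. ((\<lambda>x. inner (g x) v) has_derivative H x v) (at x)) \<and> (\<forall>x u v. H x u v = H x v u)"
proof (induction rule: poly_fun.induct)
  case (pf_const k)
  show ?case by (rule exI[of _ "\<lambda>x. 0"], rule exI[of _ "\<lambda>x u v. 0"]) auto
next
  case (pf_lin a)
  show ?case
    by (rule exI[of _ "\<lambda>x. a"], rule exI[of _ "\<lambda>x u v. 0"]) (auto intro!: derivative_eq_intros)
next
  case (pf_add f g)
  then obtain gf Hf gg Hg where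
    f: "\<forall>x. (f has_derivative (\<lambda>h. inner (gf x) h)) (at x)"
       "\<forall>x v. ((\<lambda>x. inner (gf x) v) has_derivative Hf x v) (at x)" "\<forall>x u v. Hf x u v = Hf x v u" and
    g: "\<forall>x. (g has_derivative (\<lambda>h. inner (gg x) h)) (at x)"
       "\<forall>x v. ((\<lambda>x. inner (gg x) v) has_derivative Hg x v) (at x)" "\<forall>x u v. Hg x u v = Hg x v u"
    by blast
  show ?case
  proof (rule exI[of _ "\<lambda>x. gf x + gg x"], rule exI[of _ "\<lambda>x u v. Hf x u v + Hg x u v"], intro conjI allI)
    fix x u v
    show "((\<lambda>x. f x + g x) has_derivative (\<lambda>h. inner (gf x + gg x) h)) (at x)"
      using has_derivative_add[OF f(1)[rule_format] g(1)[rule_format], of x] by (simp add: inner_add_left)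
    show "((\<lambda>x. inner (gf x + gg x) v) has_derivative (\<lambda>h. Hf x v h + Hg x v h)) (at x)"
      by (simp only: inner_add_left) (intro has_derivative_add f(2)[rule_format] g(2)[rule_format])
    show "Hf x u v + Hg x u v = Hf x v u + Hg x v u" using f(3) g(3) by simp
  qed
next
  case (pf_mult f g)
  then obtain gf Hf gg Hg where
    f: "\<forall>x. (f has_derivative (\<lambda>h. inner (gf x) h)) (at x)"
       "\<forall>x v. ((\<lambda>x. inner (gf x) v) has_derivative Hf x v) (at x)" "\<forall>x u v. Hf x u v = Hf x v u" and
    g: "\<forall>x. (g has_derivative (\<lambda>h. inner (gg x) h)) (at x)"
       "\<forall>x v. ((\<lambda>x. inner (gg x) v) has_derivative Hg x v) (at x)" "\<forall>x u v. Hg x u v = Hg x v u"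
    by blast
  let ?H = "\<lambda>x v h. f x * Hg x v h + inner (gf x) h * inner (gg x) v + (g x * Hf x v h + inner (gg x) h * inner (gf x) v)"
  show ?case
  proof (rule exI[of _ "\<lambda>x. f x *\<^sub>R gg x + g x *\<^sub>R gf x"], rule exI[of _ ?H], intro conjI allI)
    fix x u v
    show "((\<lambda>x. f x * g x) has_derivative (\<lambda>h. inner (f x *\<^sub>R gg x + g x *\<^sub>R gf x) h)) (at x)"
      using has_derivative_mult[OF f(1)[rule_format] g(1)[rule_format], of x]
      by (simp add: inner_add_left mult.commute)
    have "((\<lambda>x. f x * inner (gg x) v + g x * inner (gf x) v) has_derivative ?H x v) (at x)"
      by (intro has_derivative_add has_derivative_mult f(1,2)[rule_format] g(1,2)[rule_format])
    then show "((\<lambda>x. inner (f x *\<^sub>R gg x + g x *\<^sub>R gf x) v) has_derivative ?H x v) (at x)"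
      by (simp add: inner_add_left)
    show "?H x u v = ?H x v u" using f(3) g(3) by simp
  qed
qed

lemma has_derivative_along_line:
  fixes f :: "'a::real_normed_vector \<Rightarrow> real"
  assumes "(f has_derivative D) (at (x + s *\<^sub>R v))"
  shows "((\<lambda>t. f (x + t *\<^sub>R v)) has_real_derivative D v) (at s)"
proof -
  interpret D: bounded_linear D using assms by (rule has_derivative_bounded_linear)
  have "((\<lambda>t. x + t *\<^sub>R v) has_derivative (\<lambda>h. h *\<^sub>R v)) (at s)"
    by (auto intro!: derivative_eq_intros)
  then have "((\<lambda>t. f (x + t *\<^sub>R v)) has_derivative (\<lambda>h. D (h *\<^sub>R v))) (at s)"
    using assms by (rule has_derivative_compose)
  then show ?thesis
    by (simp add: has_field_derivative_def D.scaleR mult_commute_abs)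
qed

text \<open>The inner \<open>deriv\<close> has its closed form wherever p is positive, hence for all
  s near 0, and the outer \<open>deriv\<close> depends only on those s.\<close>

lemma local_inner_formula:
  fixes p :: "'a::real_inner \<Rightarrow> real"
  assumes g: "\<forall>x. (p has_derivative (\<lambda>h. inner (g x) h)) (at x)"
    and H: "\<forall>x v. ((\<lambda>x. inner (g x) v) has_derivative H x v) (at x)" and pe: "p e > 0"
  shows "local_inner p e u v = inner (g e) u * inner (g e) v / (p e)\<^sup>2 - H e v u / p e"
proof -
  have inner_deriv: "deriv (\<lambda>t. barrier p (e + s *\<^sub>R u + t *\<^sub>R v)) 0
      = - inner (g (e + s *\<^sub>R u)) v / p (e + s *\<^sub>R u)" if "p (e + s *\<^sub>R u) > 0" for s
  proof (rule DERIV_imp_deriv)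
    have "((\<lambda>t. p (e + s *\<^sub>R u + t *\<^sub>R v)) has_real_derivative inner (g (e + s *\<^sub>R u + 0 *\<^sub>R v)) v) (at 0)"
      by (rule has_derivative_along_line) (use g in auto)
    then show "((\<lambda>t. barrier p (e + s *\<^sub>R u + t *\<^sub>R v)) has_real_derivative
        - inner (g (e + s *\<^sub>R u)) v / p (e + s *\<^sub>R u)) (at 0)"
      unfolding barrier_def using that by (auto intro!: derivative_eq_intros)
  qed
  have dp: "((\<lambda>s. p (e + s *\<^sub>R u)) has_real_derivative inner (g (e + 0 *\<^sub>R u)) u) (at 0)"
    by (rule has_derivative_along_line) (use g in auto)
  have "((\<lambda>s. p (e + s *\<^sub>R u)) \<longlongrightarrow> p (e + 0 *\<^sub>R u)) (nhds 0)"
    using DERIV_isCont[OF dp] tendsto_at_iff_tendsto_nhds[of "\<lambda>s. p (e + s *\<^sub>R u)" 0]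
    unfolding isCont_def by blast
  then have "\<forall>\<^sub>F s in nhds 0. p (e + s *\<^sub>R u) > 0"
    by (rule order_tendstoD(1)) (use pe in simp)
  then have "\<forall>\<^sub>F s in nhds 0. deriv (\<lambda>t. barrier p (e + s *\<^sub>R u + t *\<^sub>R v)) 0
      = - inner (g (e + s *\<^sub>R u)) v / p (e + s *\<^sub>R u)"
    by eventually_elim (rule inner_deriv)
  then have "local_inner p e u v = deriv (\<lambda>s. - inner (g (e + s *\<^sub>R u)) v / p (e + s *\<^sub>R u)) 0"
    unfolding local_inner_def by (rule deriv_cong_ev) simp
  also have "\<dots> = inner (g e) u * inner (g e) v / (p e)\<^sup>2 - H e v u / p e"
  proof (rule DERIV_imp_deriv)
    have "((\<lambda>s. inner (g (e + s *\<^sub>R u)) v) has_real_derivative H (e + 0 *\<^sub>R u) v u) (at 0)"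
      by (rule has_derivative_along_line) (use H in auto)
    then show "((\<lambda>s. - inner (g (e + s *\<^sub>R u)) v / p (e + s *\<^sub>R u)) has_real_derivative
        inner (g e) u * inner (g e) v / (p e)\<^sup>2 - H e v u / p e) (at 0)"
      using dp pe by (auto intro!: derivative_eq_intros simp: field_simps power2_eq_square)
  qed
  finally show ?thesis .
qed

text \<open>Near 0 the barrier becomes a sum of logarithms of affine functions. Such a joint
  factorisation is available for the pairs (e, e), (e, v) and (v, v), where one set of eigenvalues
  describes both directions.\<close>

lemma local_inner_of_factorisation:
  fixes p :: "'a::real_normed_vector \<Rightarrow> real"
  assumes pe: "p e > 0"
    and fac: "\<And>s t. p (e + s *\<^sub>R u + t *\<^sub>R v) = p e * (\<Prod>i<n. 1 + s * m i + t * l i)"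
  shows "local_inner p e u v = (\<Sum>i<(n::nat). m i * l i)"
proof -
  have inner_deriv: "deriv (\<lambda>t. barrier p (e + s *\<^sub>R u + t *\<^sub>R v)) 0 = - (\<Sum>i<n. l i / (1 + s * m i))"
    if s: "\<forall>i<n. 1 + s * m i > 0" for s
  proof (rule DERIV_imp_deriv)
    have "\<forall>\<^sub>F t in nhds 0. \<forall>i\<in>{..<n}. 1 + s * m i + t * l i > 0"
    proof (intro eventually_ball_finite ballI)
      fix i assume "i \<in> {..<n}"
      have "((\<lambda>t. 1 + s * m i + t * l i) \<longlongrightarrow> 1 + s * m i + 0 * l i) (nhds 0)"
        by (intro tendsto_intros filterlim_ident)
      then show "\<forall>\<^sub>F t in nhds 0. 1 + s * m i + t * l i > 0"
        using s \<open>i \<in> {..<n}\<close> by (auto intro!: order_tendstoD(1))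
    qed simp
    then have ev: "\<forall>\<^sub>F t in nhds 0. barrier p (e + s *\<^sub>R u + t *\<^sub>R v)
        = - ln (p e) - (\<Sum>i<n. ln (1 + s * m i + t * l i))"
    proof eventually_elim
      case (elim t)
      have "1 + s * m i + t * l i \<noteq> 0" if "i < n" for i using elim that by force
      then have "ln (\<Prod>i<n. 1 + s * m i + t * l i) = (\<Sum>i<n. ln (1 + s * m i + t * l i))"
        by (intro ln_prod) (use elim in auto)
      moreover have "(\<Prod>i<n. 1 + s * m i + t * l i) > 0" using elim by (intro prod_pos) auto
      ultimately show ?case unfolding barrier_def fac using ln_mult_pos[OF pe] by simp
    qed
    have "((\<lambda>t. - ln (p e) - (\<Sum>i<n. ln (1 + s * m i + t * l i))) has_real_derivative
        - (\<Sum>i<n. l i / (1 + s * m i))) (at 0)"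
      using s by (auto intro!: derivative_eq_intros simp: divide_inverse mult.commute)
    then show "((\<lambda>t. barrier p (e + s *\<^sub>R u + t *\<^sub>R v)) has_real_derivative
        - (\<Sum>i<n. l i / (1 + s * m i))) (at 0)"
      using DERIV_cong_ev[OF refl ev refl] by blast
  qed
  have "\<forall>\<^sub>F s in nhds 0. \<forall>i\<in>{..<n}. 1 + s * m i > 0"
  proof (intro eventually_ball_finite ballI)
    fix i
    have "((\<lambda>s. 1 + s * m i) \<longlongrightarrow> 1 + 0 * m i) (nhds 0)"
      by (intro tendsto_intros filterlim_ident)
    then show "\<forall>\<^sub>F s in nhds 0. 1 + s * m i > 0" by (auto intro!: order_tendstoD(1))
  qed simp
  then have "\<forall>\<^sub>F s in nhds 0. deriv (\<lambda>t. barrier p (e + s *\<^sub>R u + t *\<^sub>R v)) 0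
      = - (\<Sum>i<n. l i / (1 + s * m i))"
    by eventually_elim (rule inner_deriv, auto)
  then have "local_inner p e u v = deriv (\<lambda>s. - (\<Sum>i<n. l i / (1 + s * m i))) 0"
    unfolding local_inner_def by (rule deriv_cong_ev) simp
  also have "\<dots> = (\<Sum>i<n. m i * l i)"
  proof (rule DERIV_imp_deriv)
    have "((\<lambda>s. l i / (1 + s * m i)) has_real_derivative - (m i * l i)) (at 0)" for i
      by (auto intro!: derivative_eq_intros)
    then have "((\<lambda>s. - (\<Sum>i<n. l i / (1 + s * m i))) has_real_derivative - (\<Sum>i<n. - (m i * l i))) (at 0)"
      by (intro DERIV_minus DERIV_sum)
    then show "((\<lambda>s. - (\<Sum>i<n. l i / (1 + s * m i))) has_real_derivative (\<Sum>i<n. m i * l i)) (at 0)"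
      by (simp add: sum_negf)
  qed
  finally show ?thesis .
qed

context hyperbolic_cone
begin

lemma obtain_derivatives:
  obtains g H where "\<forall>x. (p has_derivative (\<lambda>h. inner (g x) h)) (at x)"
    "\<forall>x v. ((\<lambda>x. inner (g x) v) has_derivative H x v) (at x)" "\<forall>x u v. H x u v = H x v u"
  using poly_fun_derivatives[of p] hyp unfolding hyperbolic_def by blast

lemma local_inner_sym:
  assumes "e \<in> hcone p d"
  shows "local_inner p e u v = local_inner p e v u"
proof -
  obtain g H where gH: "\<forall>x. (p has_derivative (\<lambda>h. inner (g x) h)) (at x)"
    "\<forall>x v. ((\<lambda>x. inner (g x) v) has_derivative H x v) (at x)" "\<forall>x u v. H x u v = H x v u"
    by (rule obtain_derivatives)
  show ?thesis
    unfolding local_inner_formula[OF gH(1,2) hcone_positive[OF assms]] using gH(3) by simp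
qed

lemma local_inner_linear_right:
  assumes e: "e \<in> hcone p d"
  shows "linear (local_inner p e u)"
proof -
  obtain g H where gH: "\<forall>x. (p has_derivative (\<lambda>h. inner (g x) h)) (at x)"
    "\<forall>x v. ((\<lambda>x. inner (g x) v) has_derivative H x v) (at x)" "\<forall>x u v. H x u v = H x v u"
    by (rule obtain_derivatives)
  have lin: "linear (H e u)"
    using gH(2)[rule_format, of u e] has_derivative_bounded_linear bounded_linear.linear by blast
  have eq: "local_inner p e u v = inner (g e) u * inner (g e) v / (p e)\<^sup>2 - H e u v / p e" for v
    using local_inner_formula[OF gH(1,2) hcone_positive[OF e]] gH(3) by simp
  show ?thesis
    by (rule linearI)
      (simp_all add: eq linear_add[OF lin] linear_scale[OF lin] inner_add_right algebra_simps
        add_divide_distrib)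
qed

lemma local_inner_eigenvalues:
  assumes e: "e \<in> hcone p d" and l: "root_labelling e (- v, 0) (\<lambda>i. of_real (l i))"
  shows "local_inner p e e v = (\<Sum>i<n. l i)" "local_inner p e v v = (\<Sum>i<n. (l i)\<^sup>2)"
proof -
  note pe = hcone_positive[OF e]
  have "p (e + s *\<^sub>R e + t *\<^sub>R v) = p e * (\<Prod>i<n. 1 + s * 1 + t * l i)" for s t
    using real_root_labelling_factor[OF l, of "1 + s" t] by (simp add: scaleR_add_left)
  from local_inner_of_factorisation[where n = n and m = "\<lambda>_. 1" and l = l, OF pe this]
  show "local_inner p e e v = (\<Sum>i<n. l i)" by simp
  have "p (e + s *\<^sub>R v + t *\<^sub>R v) = p e * (\<Prod>i<n. 1 + s * l i + t * l i)" for s t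
    using real_root_labelling_factor[OF l, of 1 "s + t"] by (simp add: algebra_simps)
  from local_inner_of_factorisation[where n = n and m = l and l = l, OF pe this]
  show "local_inner p e v v = (\<Sum>i<n. (l i)\<^sup>2)" by (simp add: power2_eq_square)
qed

lemma local_inner_self:
  assumes e: "e \<in> hcone p d"
  shows "local_inner p e e e = real n"
proof -
  have "p (e + s *\<^sub>R e + t *\<^sub>R e) = p e * (\<Prod>i<n. 1 + s * 1 + t * 1)" for s t
    using p_scale[of "1 + s + t" e] by (simp add: algebra_simps)
  from local_inner_of_factorisation[where n = n and m = "\<lambda>_. 1" and l = "\<lambda>_. 1", OF hcone_positive[OF e] this]
  show ?thesis by simp
qed

lemma local_inner_positive:
  assumes e: "e \<in> hcone p d" and v: "v \<noteq> 0"
  shows "local_inner p e v v > 0"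
proof -
  obtain l where l: "root_labelling e (- v, 0) (\<lambda>i. of_real (l i))"
    using real_root_labelling[OF e] by blast
  obtain i where "i < n" "l i \<noteq> 0" using vanishing_roots_imp_zero[OF e l] v by blast
  then have "0 < (\<Sum>i<n. (l i)\<^sup>2)" by (intro sum_pos2[of _ i]) auto
  then show ?thesis using local_inner_eigenvalues(2)[OF e l] by simp
qed

text \<open>The eigenvalues of v in direction s e are those in direction e divided by s.\<close>

lemma local_inner_scale:
  assumes e: "e \<in> hcone p d" and s: "s > 0"
  shows "local_inner p (s *\<^sub>R e) v v = local_inner p e v v / s\<^sup>2"
    and "local_inner p (s *\<^sub>R e) (s *\<^sub>R e) v = local_inner p e e v / s"
proof -
  obtain l where l: "root_labelling e (- v, 0) (\<lambda>i. of_real (l i))"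
    using real_root_labelling[OF e] by blast
  have se: "s *\<^sub>R e \<in> hcone p d" by (rule hcone_scale[OF e s])
  have "root_labelling (s *\<^sub>R e) (- v, 0) (\<lambda>i. of_real (l i / s))"
    unfolding root_labelling_def
  proof
    fix z
    have "F (cscale z (s *\<^sub>R e, 0) + (- v, 0)) = F (cscale (z * of_real s) (e, 0) + (- v, 0))"
      by (simp add: cscale_def mult.commute)
    also have "\<dots> = of_real (p e) * (\<Prod>i<n. z * of_real s - of_real (l i))"
      using l by (simp add: root_labelling_def)
    also have "(\<Prod>i<n. z * of_real s - of_real (l i)) = (\<Prod>i<n. of_real s * (z - of_real (l i / s)))"
      using s by (intro prod.cong) (auto simp: field_simps)
    finally show "F (cscale z (s *\<^sub>R e, 0) + (- v, 0)) = of_real (p (s *\<^sub>R e)) * (\<Prod>i<n. z - of_real (l i / s))"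
      by (simp add: prod.distrib p_scale)
  qed
  note this = local_inner_eigenvalues[OF se this] local_inner_eigenvalues[OF e l]
  then show "local_inner p (s *\<^sub>R e) v v = local_inner p e v v / s\<^sup>2"
    and "local_inner p (s *\<^sub>R e) (s *\<^sub>R e) v = local_inner p e e v / s"
    by (simp_all add: power_divide flip: sum_divide_distrib)
qed

end

section \<open>Quadratic cone programs\<close>

locale inner_form =
  fixes B :: "'a::euclidean_space \<Rightarrow> 'a \<Rightarrow> real"
  assumes lin: "\<And>u. linear (B u)" and sym: "\<And>u v. B u v = B v u" and pd: "\<And>v. v \<noteq> 0 \<Longrightarrow> B v v > 0"
begin

definition nrm :: "'a \<Rightarrow> real" where "nrm v = sqrt (B v v)"

lemma add_right: "B u (v + w) = B u v + B u w" and scale_right: "B u (r *\<^sub>R v) = r * B u v"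
  and diff_right: "B u (v - w) = B u v - B u w" and zero_right [simp]: "B u 0 = 0"
  and minus_right: "B u (- v) = - B u v"
  using linear_add[OF lin] linear_scale[OF lin] linear_diff[OF lin] linear_0[OF lin] linear_neg[OF lin]
  by auto

lemma add_left: "B (v + w) u = B v u + B w u" and scale_left: "B (r *\<^sub>R v) u = r * B v u"
  and diff_left: "B (v - w) u = B v u - B w u" and zero_left [simp]: "B 0 u = 0"
  and minus_left: "B (- v) u = - B v u"
  using add_right scale_right diff_right zero_right minus_right sym by metis+

lemmas bilin = add_right scale_right diff_right minus_right add_left scale_left diff_left minus_left

lemma nonneg: "B v v \<ge> 0"
  using pd[of v] by (cases "v = 0") auto

lemma eq_0_iff: "B v v = 0 \<longleftrightarrow> v = 0"
  by (metis less_irrefl pd zero_right)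

lemma nrm_nonneg [simp]: "nrm v \<ge> 0" and nrm_sq: "(nrm v)\<^sup>2 = B v v"
  by (auto simp: nrm_def nonneg)

lemma nrm_pos: "v \<noteq> 0 \<Longrightarrow> nrm v > 0"
  by (simp add: nrm_def pd)

lemma cauchy_schwarz_sq: "(B u v)\<^sup>2 \<le> B u u * B v v"
proof (cases "v = 0")
  case False
  have "0 \<le> B (B v v *\<^sub>R u - B u v *\<^sub>R v) (B v v *\<^sub>R u - B u v *\<^sub>R v)" by (rule nonneg)
  also have "\<dots> = B v v * (B u u * B v v - (B u v)\<^sup>2)"
    using sym[of v u] by (simp add: bilin algebra_simps power2_eq_square)
  finally show ?thesis using pd[OF False] by (simp add: zero_le_mult_iff)
qed simp

lemma cauchy_schwarz: "\<bar>B u v\<bar> \<le> nrm u * nrm v"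
  using cauchy_schwarz_sq[of u v]
  by (auto simp: nrm_def real_sqrt_mult[symmetric] intro!: real_le_rsqrt)

lemma parallel_if_cauchy_schwarz_eq:
  assumes "B u v = nrm u * nrm v"
  shows "nrm u *\<^sub>R v = nrm v *\<^sub>R u"
proof -
  have "B (nrm u *\<^sub>R v - nrm v *\<^sub>R u) (nrm u *\<^sub>R v - nrm v *\<^sub>R u)
      = (nrm u)\<^sup>2 * B v v + (nrm v)\<^sup>2 * B u u - 2 * (nrm u * nrm v) * B u v"
    using sym[of v u] by (simp add: bilin power2_eq_square algebra_simps)
  also have "\<dots> = 0" unfolding assms nrm_sq[symmetric] by (simp add: power2_eq_square)
  finally show ?thesis by (simp add: eq_0_iff)
qed

lemma continuous_form: "continuous_on S (\<lambda>v. B u v)" "continuous_on S (\<lambda>v. B v v)"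
proof -
  show 1: "continuous_on S (\<lambda>v. B u v)" for u using lin linear_continuous_on_compose
    by (metis continuous_on_id linear_continuous_on linear_conv_bounded_linear)
  have "B v v = (\<Sum>i\<in>Basis. (v \<bullet> i) * B i v)" for v
  proof -
    have "B v v = B v (\<Sum>i\<in>Basis. (v \<bullet> i) *\<^sub>R i)" by (simp add: euclidean_representation)
    also have "\<dots> = (\<Sum>i\<in>Basis. (v \<bullet> i) * B v i)"
      by (simp add: linear_sum[OF lin] scale_right)
    finally show ?thesis by (simp add: sym)
  qed
  then show "continuous_on S (\<lambda>v. B v v)" by (simp only:) (intro continuous_intros 1)
qed

lemma nrm_scale: "nrm (r *\<^sub>R v) = \<bar>r\<bar> * nrm v"
proof -
  have "nrm (r *\<^sub>R v) = sqrt (r\<^sup>2 * B v v)" by (simp add: nrm_def bilin power2_eq_square mult.assoc)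
  then show ?thesis by (simp only: real_sqrt_mult real_sqrt_abs nrm_def)
qed

lemma continuous_nrm: "continuous_on S nrm"
  unfolding nrm_def by (intro continuous_intros continuous_form)

lemma nrm_ge_norm: "\<exists>k>0. \<forall>v. nrm v \<ge> k * norm v"
proof -
  obtain b :: 'a where b: "b \<in> Basis" using nonempty_Basis by blast
  have "compact (sphere (0::'a) 1)" "sphere (0::'a) 1 \<noteq> {}"
    using b by (auto intro!: exI[of _ b])
  then obtain v0 where v0: "v0 \<in> sphere 0 1" "\<forall>v\<in>sphere 0 1. nrm v0 \<le> nrm v"
    using continuous_attains_inf[OF _ _ continuous_nrm] by blast
  have "nrm v \<ge> nrm v0 * norm v" for v
  proof (cases "v = 0")
    case False
    then have "nrm v0 \<le> nrm (inverse (norm v) *\<^sub>R v)" using v0(2) by simp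
    also have "\<dots> = nrm v / norm v" using False by (simp add: nrm_scale divide_inverse mult.commute)
    finally show ?thesis using False by (simp add: field_simps)
  qed simp
  moreover have "nrm v0 > 0" using v0(1) by (intro nrm_pos) auto
  ultimately show ?thesis by blast
qed

end

lemma orthogonal_kernel_imp_adjoint_range:
  fixes A :: "'a::euclidean_space \<Rightarrow> 'b::euclidean_space"
  assumes A: "linear A" and c: "\<And>u. A u = 0 \<Longrightarrow> inner c u = 0"
  shows "c \<in> range (adjoint A)"
proof -
  note adj = adjoint_linear[OF A]
  have sub: "subspace (range (adjoint A))" using adj by (simp add: linear_subspace_image)
  obtain y z where yz: "y \<in> span (range (adjoint A))" "\<And>w. w \<in> span (range (adjoint A)) \<Longrightarrow> orthogonal z w" "c = y + z"
    using orthogonal_subspace_decomp_exists by blast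
  have y: "y \<in> range (adjoint A)" using yz(1) sub by (simp add: span_eq_iff[THEN iffD2])
  have "A z = 0"
  proof -
    have "inner (A z) (A z) = inner z (adjoint A (A z))" by (simp add: adjoint_works[OF A])
    also have "\<dots> = 0" using yz(2) by (simp add: orthogonal_def span_base)
    finally show ?thesis by simp
  qed
  then have "inner c z = 0" by (rule c)
  moreover have "inner y z = 0" using yz(1,2) by (simp add: orthogonal_def inner_commute)
  ultimately have "z = 0" using yz(3) by (simp add: inner_add_left)
  then show ?thesis using y yz(3) by simp
qed

text \<open>The condition \<open>\<alpha>\<^sup>2 < B e e\<close> places e in the interior of its
  own cone, so e serves as a Slater point.\<close>

locale quadratic_cone_program = inner_form B
  for B :: "'a::euclidean_space \<Rightarrow> 'a \<Rightarrow> real" +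
  fixes A :: "'a \<Rightarrow> 'b::euclidean_space" and b :: 'b and c e :: 'a and \<alpha> :: real
  assumes linA: "linear A" and b_nz: "b \<noteq> 0" and c_notin: "c \<notin> range (adjoint A)"
    and alpha: "0 < \<alpha>" "\<alpha>\<^sup>2 < B e e" and Ae: "A e = b"
begin

definition cone :: "'a set" where "cone = {x. B e x \<ge> \<alpha> * nrm x}"

definition optimal :: "'a \<Rightarrow> bool" where
  "optimal x \<longleftrightarrow> A x = b \<and> x \<in> cone \<and> (\<forall>x'. A x' = b \<longrightarrow> x' \<in> cone \<longrightarrow> inner c x \<le> inner c x')"

lemma feasible_nonzero: "A x = b \<Longrightarrow> x \<noteq> 0"
  using b_nz linear_0[OF linA] by auto

lemma exists_kernel_vector: "\<exists>u. A u = 0 \<and> inner c u < 0"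
proof (rule ccontr)
  assume no: "\<not> ?thesis"
  have "inner c u = 0" if "A u = 0" for u
    using no that spec[of _ "- u"] linear_neg[OF linA, of u] by (metis inner_minus_right less_eq_real_def linorder_neqE_linordered_idom neg_less_0_iff_less neg_0_equal_iff_equal)
  then show False using orthogonal_kernel_imp_adjoint_range[OF linA] c_notin by blast
qed

text \<open>As c is not in the range of the adjoint, the kernel of A contains a direction of
  descent; from an interior point a short step along it would stay feasible.\<close>

lemma optimal_boundary:
  assumes x: "optimal x"
  shows "B e x = \<alpha> * nrm x"
proof (rule ccontr)
  assume "\<not> ?thesis"
  then have gt: "B e x > \<alpha> * nrm x" using x by (auto simp: optimal_def cone_def)
  obtain u where u: "A u = 0" "inner c u < 0" using exists_kernel_vector by blast
  have cont: "continuous_on UNIV (\<lambda>v. B e v - \<alpha> * nrm v)"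
    by (intro continuous_intros continuous_form continuous_nrm)
  have "((\<lambda>r. B e (x + r *\<^sub>R u) - \<alpha> * nrm (x + r *\<^sub>R u)) \<longlongrightarrow> B e (x + 0 *\<^sub>R u) - \<alpha> * nrm (x + 0 *\<^sub>R u)) (at_right 0)"
    by (rule continuous_on_tendsto_compose[OF cont]) (auto intro!: tendsto_eq_intros)
  then have "\<forall>\<^sub>F r in at_right 0. B e (x + r *\<^sub>R u) - \<alpha> * nrm (x + r *\<^sub>R u) > 0"
    by (rule order_tendstoD(1)) (use gt in simp)
  then have "\<forall>\<^sub>F r in at_right 0. B e (x + r *\<^sub>R u) - \<alpha> * nrm (x + r *\<^sub>R u) > 0 \<and> r > (0::real)"
    by (intro eventually_conj eventually_at_right_less)
  then obtain r where r: "r > 0" "B e (x + r *\<^sub>R u) - \<alpha> * nrm (x + r *\<^sub>R u) > 0"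
    using eventually_happens'[OF trivial_limit_at_right_real] by blast
  have "A (x + r *\<^sub>R u) = b" using x u linA by (simp add: optimal_def linear_add linear_scale)
  moreover have "x + r *\<^sub>R u \<in> cone" using r by (simp add: cone_def)
  ultimately have "inner c x \<le> inner c (x + r *\<^sub>R u)" using x unfolding optimal_def by blast
  then show False using r u by (simp add: inner_add_right mult_less_0_iff zero_le_mult_iff)
qed

lemma optimal_pos:
  assumes "optimal x"
  shows "nrm x > 0" "B e x > 0" "\<alpha>\<^sup>2 * B x x = (B e x)\<^sup>2"
proof -
  show "nrm x > 0" using assms feasible_nonzero by (intro nrm_pos) (auto simp: optimal_def)
  then show "B e x > 0" using optimal_boundary[OF assms] alpha by simp
  show "\<alpha>\<^sup>2 * B x x = (B e x)\<^sup>2"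
    by (simp add: optimal_boundary[OF assms] power_mult_distrib nrm_sq)
qed

text \<open>The midpoint of two optima is optimal and so lies on the boundary. This forces equality
  in the triangle inequality, hence parallel vectors, and A x = b with b nonzero excludes different
  lengths.\<close>

lemma optimal_unique:
  assumes x1: "optimal x1" and x2: "optimal x2"
  shows "x1 = x2"
proof -
  let ?m = "(1/2) *\<^sub>R (x1 + x2)"
  have Am: "A ?m = b" using x1 x2 linA
    by (simp add: optimal_def linear_add linear_scale flip: scaleR_add_left)
  note n1 = optimal_boundary[OF x1] optimal_pos[OF x1] and n2 = optimal_boundary[OF x2] optimal_pos[OF x2]
  have sq: "B (x1 + x2) (x1 + x2) = (nrm x1)\<^sup>2 + (nrm x2)\<^sup>2 + 2 * B x1 x2"
    using sym[of x2 x1] by (simp add: bilin nrm_sq)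
  have tri: "nrm (x1 + x2) \<le> nrm x1 + nrm x2"
    unfolding nrm_def[of "x1 + x2"] sq
    by (rule real_le_lsqrt) (use cauchy_schwarz[of x1 x2] in \<open>auto simp: power2_eq_square algebra_simps\<close>)
  have nm: "nrm ?m = nrm (x1 + x2) / 2" by (simp add: nrm_scale del: scaleR_add_right)
  have Bm: "B e ?m = \<alpha> * (nrm x1 + nrm x2) / 2" by (simp add: bilin n1(1) n2(1) algebra_simps)
  have "B e ?m \<ge> \<alpha> * nrm ?m"
    using mult_left_mono[OF tri, of \<alpha>] alpha unfolding nm Bm by simp
  then have "?m \<in> cone" by (simp add: cone_def)
  moreover have "inner c ?m = inner c x1"
    using x1 x2 unfolding optimal_def by (simp add: inner_add_right) (metis antisym)
  ultimately have "optimal ?m" using Am x1 by (simp add: optimal_def)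
  then have "B e ?m = \<alpha> * nrm ?m" by (rule optimal_boundary)
  then have "\<alpha> * (nrm x1 + nrm x2) = \<alpha> * nrm (x1 + x2)"
    unfolding nm Bm by simp
  then have "nrm (x1 + x2) = nrm x1 + nrm x2" using alpha by simp
  then have "(nrm x1 + nrm x2)\<^sup>2 = (nrm x1)\<^sup>2 + (nrm x2)\<^sup>2 + 2 * B x1 x2"
    using sq nrm_sq[of "x1 + x2"] by simp
  then have "B x1 x2 = nrm x1 * nrm x2" by (simp add: power2_eq_square algebra_simps)
  then have par: "nrm x1 *\<^sub>R x2 = nrm x2 *\<^sub>R x1" by (rule parallel_if_cauchy_schwarz_eq)
  then have "A (nrm x1 *\<^sub>R x2) = A (nrm x2 *\<^sub>R x1)" by simp
  then have "nrm x1 *\<^sub>R b = nrm x2 *\<^sub>R b"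
    using x1 x2 by (simp add: linear_scale[OF linA] optimal_def)
  then have eq: "nrm x2 = nrm x1" using b_nz by simp
  have "nrm x1 *\<^sub>R x2 = nrm x1 *\<^sub>R x1" using par unfolding eq .
  then show ?thesis using n1(2) by simp
qed

text \<open>The optimality condition for the smooth inequality (B e x)^2 >= \<alpha>^2 B x x, whose
  derivative at x in direction u is twice \<open>\<l> u\<close>. Feasible directions with
  \<open>\<l> u > 0\<close> do not decrease the objective, so on the kernel of A it is a multiple of
  \<open>\<l>\<close>.\<close>

lemma optimal_multiplier:
  assumes x: "optimal x"
  obtains \<theta> y where "\<theta> > 0"
    "\<And>u. inner (c - adjoint A y) u = \<theta> * (B e x * B e u - \<alpha>\<^sup>2 * B x u)"
proof -
  define \<sigma> where "\<sigma> = B e x"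
  define \<l> where "\<l> u = \<sigma> * B e u - \<alpha>\<^sup>2 * B x u" for u
  have \<l>_lin: "\<l> (u + r *\<^sub>R v) = \<l> u + r * \<l> v" for u v r by (simp add: \<l>_def bilin algebra_simps)
  have \<sigma>: "\<sigma> > 0" "\<alpha>\<^sup>2 * B x x = \<sigma>\<^sup>2" using optimal_pos[OF x] by (auto simp: \<sigma>_def)
  \<comment> \<open>The direction towards the Slater point, along which \<open>\<l>\<close> is
    strictly positive.\<close>
  define u0 where "u0 = e - x"
  have u0: "A u0 = 0" "\<l> u0 = (B e e - \<alpha>\<^sup>2) * \<sigma>"
    using x Ae linA \<sigma> sym[of x e]
    by (auto simp: u0_def optimal_def linear_diff \<l>_def bilin algebra_simps power2_eq_square \<sigma>_def)
  have \<l>u0: "\<l> u0 > 0" using u0(2) \<sigma> alpha by simp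
  have dir: "inner c u \<ge> 0" if u: "A u = 0" "\<l> u > 0" for u
  proof -
    \<comment> \<open>K dominates the linear change of B e x and the second-order term: r <=
      \<sigma> / K keeps B e (x + r u) nonnegative, and r <= \<open>\<l> u\<close> / K lets the
      first-order gain prevail.\<close>
    define K where "K = \<bar>(B e u)\<^sup>2 - \<alpha>\<^sup>2 * B u u\<bar> + \<bar>B e u\<bar> + 1"
    have K: "K > 0" by (simp add: K_def)
    define r where "r = min (\<sigma> / K) (\<l> u / K)"
    have r: "r > 0" "r * K \<le> \<sigma>" "r * K \<le> \<l> u"
      using K \<sigma> u(2) by (auto simp: r_def min_def field_simps)
    have "\<bar>r * B e u\<bar> \<le> r * K" using r(1) by (simp add: K_def abs_mult)
    then have p1: "B e (x + r *\<^sub>R u) \<ge> 0" using r(2) by (simp add: bilin flip: \<sigma>_def)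
    have "(B e (x + r *\<^sub>R u))\<^sup>2 - \<alpha>\<^sup>2 * B (x + r *\<^sub>R u) (x + r *\<^sub>R u)
        = 2 * r * \<l> u + r\<^sup>2 * ((B e u)\<^sup>2 - \<alpha>\<^sup>2 * B u u) + (\<sigma>\<^sup>2 - \<alpha>\<^sup>2 * B x x)"
      using sym[of u x] by (simp add: bilin \<l>_def power2_eq_square algebra_simps flip: \<sigma>_def)
    also have "\<dots> \<ge> 2 * r * \<l> u - r * (r * K)"
    proof -
      have "r\<^sup>2 * ((B e u)\<^sup>2 - \<alpha>\<^sup>2 * B u u) \<ge> r\<^sup>2 * (- K)"
        by (rule mult_left_mono) (auto simp: K_def)
      then show ?thesis using \<sigma>(2) by (simp add: power2_eq_square)
    qed
    finally have "(B e (x + r *\<^sub>R u))\<^sup>2 - \<alpha>\<^sup>2 * B (x + r *\<^sub>R u) (x + r *\<^sub>R u) \<ge> 2 * r * \<l> u - r * (r * K)" .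
    moreover have "r * (r * K) \<le> r * \<l> u" using r by (intro mult_left_mono) auto
    moreover have "r * \<l> u > 0" using r u by simp
    ultimately have "(\<alpha> * nrm (x + r *\<^sub>R u))\<^sup>2 \<le> (B e (x + r *\<^sub>R u))\<^sup>2"
      by (simp add: power_mult_distrib nrm_sq)
    then have "\<alpha> * nrm (x + r *\<^sub>R u) \<le> B e (x + r *\<^sub>R u)" using p1 by (rule power2_le_imp_le)
    moreover have "A (x + r *\<^sub>R u) = b" using x u linA by (simp add: optimal_def linear_add linear_scale)
    ultimately have "inner c x \<le> inner c (x + r *\<^sub>R u)"
      using x unfolding optimal_def cone_def by blast
    then show ?thesis using r by (simp add: inner_add_right zero_le_mult_iff)
  qed
  define \<theta> where "\<theta> = inner c u0 / \<l> u0"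
  \<comment> \<open>Directions with \<open>\<l> u = 0\<close> are limits of the directions u + r u0,
    to which \<open>dir\<close> applies.\<close>
  have zero: "inner c u \<ge> 0" if u: "A u = 0" "\<l> u = 0" for u
  proof (rule field_le_epsilon)
    fix \<epsilon> :: real assume \<epsilon>: "\<epsilon> > 0"
    define r where "r = \<epsilon> / (\<bar>inner c u0\<bar> + 1)"
    have r: "r > 0" using \<epsilon> by (simp add: r_def)
    have "inner c (u + r *\<^sub>R u0) \<ge> 0"
      by (rule dir) (use u u0(1) \<l>u0 r linA in \<open>auto simp: linear_add linear_scale \<l>_lin\<close>)
    moreover have "r * inner c u0 \<le> \<epsilon>"
    proof -
      have "r * inner c u0 \<le> r * (\<bar>inner c u0\<bar> + 1)" using r by (intro mult_left_mono) auto
      then show ?thesis by (simp add: r_def)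
    qed
    ultimately show "0 \<le> inner c u + \<epsilon>" by (simp add: inner_add_right)
  qed
  have prpl: "inner c u = \<theta> * \<l> u" if u: "A u = 0" for u
  proof -
    define w where "w = u + (- \<l> u / \<l> u0) *\<^sub>R u0"
    have w: "A w = 0" "\<l> w = 0"
      unfolding w_def \<l>_lin using u u0(1) \<l>u0 linA by (auto simp: linear_add linear_scale linear_diff)
    have w': "A (- w) = 0" "\<l> (- w) = 0"
      using w linA \<l>_lin[of 0 "-1" w] by (auto simp: linear_neg \<l>_def)
    have "inner c w = 0" using zero[OF w] zero[OF w'] by simp
    then have "inner c u + (- \<l> u / \<l> u0) * inner c u0 = 0"
      unfolding w_def inner_add_right inner_scaleR_right .
    then show ?thesis using \<l>u0 by (simp add: \<theta>_def field_simps)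
  qed
  define z where "z = (\<Sum>i\<in>Basis. \<l> i *\<^sub>R i)"
  have z: "inner z u = \<l> u" for u
  proof -
    have l: "linear \<l>" unfolding \<l>_def by (rule linearI) (auto simp: bilin algebra_simps)
    have "\<l> u = \<l> (\<Sum>i\<in>Basis. (u \<bullet> i) *\<^sub>R i)" by (simp add: euclidean_representation)
    also have "\<dots> = (\<Sum>i\<in>Basis. (u \<bullet> i) * \<l> i)"
      by (simp add: linear_sum[OF l] linear_scale[OF l])
    finally show ?thesis by (simp add: z_def inner_sum_left inner_commute[of u] mult.commute)
  qed
  have "c - \<theta> *\<^sub>R z \<in> range (adjoint A)"
    by (rule orthogonal_kernel_imp_adjoint_range[OF linA]) (simp add: inner_diff_left z prpl)
  then obtain y where y: "c - \<theta> *\<^sub>R z = adjoint A y" by blast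
  have "\<theta> \<noteq> 0" using y c_notin by auto
  moreover have "inner c u0 \<ge> 0" using dir u0 \<l>u0 by blast
  ultimately have "\<theta> > 0" using \<l>u0 by (auto simp: \<theta>_def less_le)
  moreover have "inner (c - adjoint A y) u = \<theta> * (B e x * B e u - \<alpha>\<^sup>2 * B x u)" for u
    using z[of u] by (simp add: y[symmetric] \<l>_def \<sigma>_def)
  ultimately show ?thesis by (rule that)
qed

text \<open>Up to the factor \<theta> this is the slack of the multiplier: Cauchy-Schwarz bounds the
  second term, and the boundary equation for x turns that bound into the inequality that defines the
  cone at w.\<close>

lemma multiplier_dual_feasible:
  assumes x: "optimal x" and w: "w \<in> cone"
  shows "B e x * B e w - \<alpha>\<^sup>2 * B x w \<ge> 0"
proof -
  note bd = optimal_boundary[OF x] optimal_pos[OF x]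
  have "\<alpha>\<^sup>2 * B x w \<le> \<alpha>\<^sup>2 * (nrm x * nrm w)"
    using cauchy_schwarz[of x w] by (intro mult_left_mono) auto
  also have "\<dots> = B e x * (\<alpha> * nrm w)" by (simp add: bd(1) power2_eq_square)
  also have "\<dots> \<le> B e x * B e w" using w bd(3) by (intro mult_left_mono) (auto simp: cone_def)
  finally show ?thesis by simp
qed

text \<open>A slack in the interior of the dual cone bounds the norm of every feasible point with
  objective at most that of e, so the minimum is taken over a compact set.\<close>

lemma optimal_exists:
  assumes \<rho>: "\<rho> > 0" and s: "\<And>x. x \<in> cone \<Longrightarrow> inner (c - adjoint A y) x \<ge> \<rho> * nrm x" and e: "e \<in> cone"
  shows "\<exists>x. optimal x"
proof -
  obtain k where k: "k > 0" "\<And>v. nrm v \<ge> k * norm v" using nrm_ge_norm by blast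
  have val: "inner c x = inner b y + inner (c - adjoint A y) x" if "A x = b" for x
    using that by (simp add: inner_diff_left adjoint_clauses(2)[OF linA] inner_commute[of y b])
  define S where "S = {x. A x = b \<and> x \<in> cone \<and> inner c x \<le> inner c e}"
  have "bounded S"
    unfolding bounded_iff
  proof (intro exI ballI)
    fix x assume x: "x \<in> S"
    have "\<rho> * (k * norm x) \<le> \<rho> * nrm x" using k \<rho> by (intro mult_left_mono) auto
    also have "\<dots> \<le> inner c e - inner b y" using x s[of x] val[of x] by (simp add: S_def)
    finally show "norm x \<le> (inner c e - inner b y) / (\<rho> * k)" using \<rho> k by (simp add: field_simps)
  qed
  moreover have "closed S"
  proof -
    have "closed {x. A x = b}"
      using linear_continuous_on[of A UNIV] linA
      by (intro closed_Collect_eq) (auto simp: linear_conv_bounded_linear)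
    moreover have "closed cone" unfolding cone_def
      by (intro closed_Collect_le continuous_intros continuous_nrm continuous_form)
    moreover have "closed {x. inner c x \<le> inner c e}" by (intro closed_Collect_le continuous_intros)
    moreover have "S = {x. A x = b} \<inter> cone \<inter> {x. inner c x \<le> inner c e}" by (auto simp: S_def)
    ultimately show ?thesis by (simp add: closed_Int)
  qed
  ultimately have "compact S" by (simp add: compact_eq_bounded_closed)
  moreover have "e \<in> S" using e Ae by (simp add: S_def)
  moreover have "continuous_on S (\<lambda>x. inner c x)" by (intro continuous_intros)
  ultimately obtain x where x: "x \<in> S" "\<forall>x'\<in>S. inner c x \<le> inner c x'"
    using continuous_attains_inf[of S "\<lambda>x. inner c x"] by blast
  have "optimal x" unfolding optimal_def
  proof (intro conjI allI impI)
    fix x' assume x': "A x' = b" "x' \<in> cone"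
    show "inner c x \<le> inner c x'"
    proof (cases "inner c x' \<le> inner c e")
      case True
      then show ?thesis using x(2) x' by (simp add: S_def)
    next
      case False
      then show ?thesis using x(1) by (simp add: S_def)
    qed
  qed (use x(1) in \<open>auto simp: S_def\<close>)
  then show ?thesis by blast
qed

end

section \<open>A maximum principle\<close>

text \<open>Local holomorphic support from below replaces subharmonicity. Where u is maximal, the
  modulus exp (Im S) of exp (- \<i> S) is maximal too, so that function is constant nearby and u
  stays at its maximum.\<close>

lemma minorant_maximum_principle:
  fixes u :: "complex \<Rightarrow> real"
  assumes D: "compact D" and W: "open W" "W \<subseteq> D" and cont: "continuous_on D u"
    and minorant: "\<And>\<epsilon>0. \<epsilon>0 \<in> W \<Longrightarrow> \<exists>r>0. \<exists>S. ball \<epsilon>0 r \<subseteq> W \<and> S holomorphic_on ball \<epsilon>0 r \<and>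
       (\<forall>\<epsilon>\<in>ball \<epsilon>0 r. Im (S \<epsilon>) \<le> u \<epsilon>) \<and> Im (S \<epsilon>0) = u \<epsilon>0"
    and bd: "\<And>\<epsilon>. \<epsilon> \<in> D \<Longrightarrow> \<epsilon> \<notin> W \<Longrightarrow> u \<epsilon> \<le> c" and \<epsilon>: "\<epsilon> \<in> D"
  shows "u \<epsilon> \<le> c"
proof (rule ccontr)
  assume gt: "\<not> u \<epsilon> \<le> c"
  have "D \<noteq> {}" using \<epsilon> by blast
  then obtain m where m: "m \<in> D" "\<forall>x\<in>D. u x \<le> u m"
    using continuous_attains_sup[OF D _ cont] by blast
  define s where "s = u m"
  have s: "s > c" "\<And>x. x \<in> D \<Longrightarrow> u x \<le> s" using m gt \<epsilon> by (force simp: s_def)+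
  define M where "M = {x \<in> D. u x = s}"
  have "closedin (top_of_set D) M"
    unfolding M_def using continuous_closedin_preimage_constant[OF cont] by (simp add: s_def)
  then have "compact M" using D closedin_compact by blast
  moreover have "M \<noteq> {}" using m by (auto simp: M_def s_def)
  \<comment> \<open>The rightmost maximum point: a shift by r / 2 to the right must leave M, which
    contradicts the constancy found below.\<close>
  ultimately obtain \<epsilon>0 where \<epsilon>0: "\<epsilon>0 \<in> M" "\<forall>x\<in>M. Re x \<le> Re \<epsilon>0"
    using continuous_attains_sup[of M Re] continuous_on_Re[OF continuous_on_id] by blast
  have u0: "u \<epsilon>0 = s" "\<epsilon>0 \<in> D" using \<epsilon>0 by (auto simp: M_def)
  then have "\<epsilon>0 \<in> W" using bd[of \<epsilon>0] s by force
  then obtain r S where r: "r > 0" "ball \<epsilon>0 r \<subseteq> W" "S holomorphic_on ball \<epsilon>0 r"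
      "\<forall>\<epsilon>\<in>ball \<epsilon>0 r. Im (S \<epsilon>) \<le> u \<epsilon>" "Im (S \<epsilon>0) = u \<epsilon>0"
    using minorant by blast
  have "(\<lambda>z. exp (- \<i> * S z)) constant_on ball \<epsilon>0 r"
  proof (rule maximum_modulus_principle[where U = "ball \<epsilon>0 r" and \<xi> = \<epsilon>0])
    show "(\<lambda>z. exp (- \<i> * S z)) holomorphic_on ball \<epsilon>0 r" by (intro holomorphic_intros r)
    fix z assume z: "z \<in> ball \<epsilon>0 r"
    have "Im (S z) \<le> Im (S \<epsilon>0)" using r(2,4,5) z u0 s(2) W by (metis order_trans subsetD)
    then show "cmod (exp (- \<i> * S z)) \<le> cmod (exp (- \<i> * S \<epsilon>0))" by (simp add: norm_exp_eq_Re)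
  qed (use r in auto)
  then obtain k where k: "\<And>z. z \<in> ball \<epsilon>0 r \<Longrightarrow> exp (- \<i> * S z) = k"
    unfolding constant_on_def by blast
  define z where "z = \<epsilon>0 + of_real (r / 2)"
  have z: "z \<in> ball \<epsilon>0 r" using r(1) by (simp add: z_def dist_norm)
  have "exp (- \<i> * S z) = exp (- \<i> * S \<epsilon>0)" using k z r(1) by simp
  then have "Im (S z) = Im (S \<epsilon>0)"
    by (metis exp_inj_iff norm_exp_eq_Re Re_i_times mult_minus_left minus_minus uminus_complex.sel(1))
  then have "u z \<ge> s" using r(4,5) z u0 by force
  moreover have "z \<in> D" using z r W by blast
  ultimately have "z \<in> M" using s by (force simp: M_def)
  then show False using \<epsilon>0 r(1) by (auto simp: z_def)
qed

section \<open>Bivariate polynomials\<close>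

lemma continuous_on_bivariate [continuous_intros]:
  fixes Q :: "complex poly poly"
  assumes "continuous_on S f" "continuous_on S g"
  shows "continuous_on S (\<lambda>x. poly (poly Q [:f x:]) (g x))"
  by (induction Q) (auto intro!: continuous_intros assms)

lemma bivariate_deriv_fst:
  fixes Q :: "complex poly poly"
  shows "((\<lambda>z. poly (poly Q [:z:]) \<epsilon>) has_field_derivative poly (poly (pderiv Q) [:z:]) \<epsilon>) (at z)"
proof (induction Q)
  case (pCons a Q)
  then show ?case by (auto intro!: derivative_eq_intros simp: pderiv_pCons)
qed simp

lemma bivariate_deriv_snd:
  fixes Q :: "complex poly poly"
  shows "((\<lambda>\<epsilon>. poly (poly Q [:z:]) \<epsilon>) has_field_derivative poly (poly (map_poly pderiv Q) [:z:]) \<epsilon>) (at \<epsilon>)"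
proof (induction Q)
  case (pCons a Q)
  have "((\<lambda>\<epsilon>. poly a \<epsilon> + z * poly (poly Q [:z:]) \<epsilon>) has_field_derivative
      poly (pderiv a) \<epsilon> + z * poly (poly (map_poly pderiv Q) [:z:]) \<epsilon>) (at \<epsilon>)"
    by (intro DERIV_add poly_DERIV DERIV_cmult pCons.IH)
  then show ?case by (simp add: map_poly_pCons)
qed simp

text \<open>The circle is fixed and avoids the zeros for every parameter, so differentiation under
  the integral sign applies. The weight has the shape 2 \<kappa> z - \<kappa>^2 \<epsilon> of the
  minorants of \<open>T\<close>.\<close>

lemma holomorphic_circle_integral_bivariate:
  fixes P Q :: "complex poly poly"
  assumes U: "open U" "convex U" and r: "r \<ge> 0"
    and nz: "\<And>\<epsilon> z. \<epsilon> \<in> U \<Longrightarrow> z \<in> sphere c r \<Longrightarrow> poly (poly P [:z:]) \<epsilon> \<noteq> 0"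
  shows "(\<lambda>\<epsilon>. contour_integral (circlepath c r)
      (\<lambda>z. (a * z - b * \<epsilon>) * (poly (poly Q [:z:]) \<epsilon> / poly (poly P [:z:]) \<epsilon>))) holomorphic_on U"
proof -
  define \<gamma> where "\<gamma> = circlepath c r"
  define w where "w t = 2 * of_real pi * \<i> * of_real r * exp (2 * of_real pi * \<i> * of_real t)" for t :: real
  have \<gamma>: "\<gamma> t \<in> sphere c r" if "t \<in> {0..1}" for t
  proof -
    have "\<gamma> t \<in> path_image \<gamma>" using that by (auto simp: path_image_def)
    then show ?thesis using r by (simp add: \<gamma>_def)
  qed
  have \<gamma>_cont: "continuous_on S \<gamma>" for S
    unfolding \<gamma>_def circlepath by (intro continuous_intros)
  have w_cont: "continuous_on S w" for S
    unfolding w_def by (intro continuous_intros)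
  let ?P = "\<lambda>Q z \<epsilon>. poly (poly Q [:z:]) \<epsilon>"
  define f where "f \<epsilon> t = (a * \<gamma> t - b * \<epsilon>) * (?P Q (\<gamma> t) \<epsilon> / ?P P (\<gamma> t) \<epsilon>) * w t" for \<epsilon> t
  define f' where "f' \<epsilon> t = (- b * (?P Q (\<gamma> t) \<epsilon> / ?P P (\<gamma> t) \<epsilon>) + (a * \<gamma> t - b * \<epsilon>) *
      ((?P (map_poly pderiv Q) (\<gamma> t) \<epsilon> * ?P P (\<gamma> t) \<epsilon> - ?P Q (\<gamma> t) \<epsilon> * ?P (map_poly pderiv P) (\<gamma> t) \<epsilon>)
       / (?P P (\<gamma> t) \<epsilon>)\<^sup>2)) * w t" for \<epsilon> t
  have "(\<lambda>\<epsilon>. integral (cbox 0 1) (f \<epsilon>)) holomorphic_on U"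
  proof (rule leibniz_rule_holomorphic[where fx = f'])
    fix \<epsilon> and t :: real assume \<epsilon>: "\<epsilon> \<in> U" and t: "t \<in> cbox 0 1"
    have n0: "?P P (\<gamma> t) \<epsilon> \<noteq> 0" using nz \<gamma> \<epsilon> t by simp
    have "((\<lambda>\<epsilon>. f \<epsilon> t) has_field_derivative f' \<epsilon> t) (at \<epsilon>)"
      unfolding f_def f'_def
      by (rule derivative_eq_intros bivariate_deriv_snd refl n0)+
        (use n0 in \<open>simp add: field_simps power2_eq_square\<close>)
    then show "((\<lambda>\<epsilon>. f \<epsilon> t) has_field_derivative f' \<epsilon> t) (at \<epsilon> within U)"
      by (rule has_field_derivative_at_within)
  next
    fix \<epsilon> assume \<epsilon>: "\<epsilon> \<in> U"
    show "f \<epsilon> integrable_on cbox 0 1"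
      unfolding f_def
      by (intro integrable_continuous continuous_intros \<gamma>_cont w_cont) (use nz \<gamma> \<epsilon> in auto)
  next
    have c1: "continuous_on (U \<times> cbox 0 1) (\<lambda>x. \<gamma> (snd x))" "continuous_on (U \<times> cbox 0 1) (\<lambda>x. w (snd x))"
      by (auto intro!: continuous_on_compose2[OF \<gamma>_cont[of UNIV]] continuous_on_compose2[OF w_cont[of UNIV]] continuous_intros)
    show "continuous_on (U \<times> cbox 0 1) (\<lambda>(\<epsilon>, t). f' \<epsilon> t)"
      unfolding f'_def split_beta
      by (intro continuous_intros c1) (use nz \<gamma> in auto)
  qed (rule U)
  moreover have "contour_integral \<gamma> (\<lambda>z. (a * z - b * \<epsilon>) * (?P Q z \<epsilon> / ?P P z \<epsilon>)) = integral (cbox 0 1) (f \<epsilon>)" for \<epsilon>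
    unfolding contour_integral_integral f_def \<gamma>_def w_def by (simp add: vector_derivative_circlepath)
  ultimately show ?thesis unfolding \<gamma>_def by simp
qed

lemma has_field_derivative_root_product:
  fixes y :: "nat \<Rightarrow> 'b::real_normed_field"
  assumes "\<And>i. i < m \<Longrightarrow> z \<noteq> y i"
  shows "((\<lambda>z. \<Prod>i<m. z - y i) has_field_derivative (\<Prod>i<m. z - y i) * (\<Sum>i<m. 1 / (z - y i))) (at z)"
  using assms
proof (induction m)
  case (Suc m)
  have "((\<lambda>z. (\<Prod>i<m. z - y i) * (z - y m)) has_field_derivative
      (\<Prod>i<m. z - y i) * (\<Sum>i<m. 1 / (z - y i)) * (z - y m) + 1 * (\<Prod>i<m. z - y i)) (at z)"
    using Suc.prems by (intro DERIV_mult Suc.IH) (auto intro!: derivative_eq_intros)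
  moreover have "(\<Prod>i<m. z - y i) * (\<Sum>i<m. 1 / (z - y i)) * (z - y m) + 1 * (\<Prod>i<m. z - y i)
      = (\<Prod>i<Suc m. z - y i) * (\<Sum>i<Suc m. 1 / (z - y i))"
    using Suc.prems[of m] by (simp add: distrib_left)
  ultimately show ?case by simp
qed simp

text \<open>The argument principle with a weight: each label inside the circle contributes by
  Cauchy's formula, each one outside contributes 0, and repeated labels account for
  multiplicity.\<close>

lemma circle_integral_root_sum:
  fixes y :: "nat \<Rightarrow> complex"
  assumes f: "f holomorphic_on UNIV" and r: "r > 0" and off: "\<And>i. i < m \<Longrightarrow> dist c (y i) \<noteq> r"
  shows "((\<lambda>z. f z * (\<Sum>i<m. 1 / (z - y i))) has_contour_integral
    (\<Sum>i<m. if dist c (y i) < r then 2 * of_real pi * \<i> * f (y i) else 0)) (circlepath c r)"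
proof -
  have "((\<lambda>z. f z / (z - y i)) has_contour_integral
      (if dist c (y i) < r then 2 * of_real pi * \<i> * f (y i) else 0)) (circlepath c r)" if i: "i < m" for i
  proof (cases "dist c (y i) < r")
    case True
    then have "norm (y i - c) < r" by (simp add: dist_norm norm_minus_commute)
    then show ?thesis
      using Cauchy_integral_circlepath_simple[OF holomorphic_on_subset[OF f]] True by simp
  next
    case False
    have "((\<lambda>z. f z / (z - y i)) has_contour_integral 0) (circlepath c r)"
    proof (rule Cauchy_theorem_convex_simple[where S = "cball c r"])
      show "(\<lambda>z. f z / (z - y i)) holomorphic_on cball c r"
        by (intro holomorphic_intros holomorphic_on_subset[OF f]) (use False off[OF i] in auto)
      show "path_image (circlepath c r) \<subseteq> cball c r"
        using r path_image_circlepath_nonneg[of r c] by auto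
    qed auto
    then show ?thesis using False by simp
  qed
  then have "((\<lambda>z. \<Sum>i<m. f z / (z - y i)) has_contour_integral
      (\<Sum>i<m. if dist c (y i) < r then 2 * of_real pi * \<i> * f (y i) else 0)) (circlepath c r)"
    by (intro has_contour_integral_sum) auto
  then show ?thesis by (simp add: sum_distrib_left)
qed

section \<open>Eigenvalues along a complex pencil\<close>

text \<open>\<open>y \<epsilon>\<close> lists the eigenvalues of e + \<epsilon> v in direction E,
  chosen separately for each \<epsilon> and without any continuity.\<close>

locale pencil = hyperbolic_cone p n F d
  for p :: "'a::euclidean_space \<Rightarrow> real" and n :: nat and F :: "'a \<times> 'a \<Rightarrow> complex" and d :: 'a +
  fixes E e v :: 'a and y :: "complex \<Rightarrow> nat \<Rightarrow> complex"
  assumes E: "E \<in> hcone p d"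
    and y: "\<And>\<epsilon>. root_labelling E ((- e, 0) - cscale \<epsilon> (v, 0)) (y \<epsilon>)"
begin

lemma pE: "p E > 0" "p E \<noteq> 0"
  using hcone_positive[OF E] by auto

definition T :: "complex \<Rightarrow> real" where
  "T \<epsilon> = (\<Sum>i<n. (Im (y \<epsilon> i))\<^sup>2) / Im \<epsilon>"

lemma y_zero: "i < n \<Longrightarrow> F (cscale (y \<epsilon> i) (E, 0) + ((- e, 0) - cscale \<epsilon> (v, 0))) = 0"
  using root_labelling_zero_iff[OF y pE(2)] by blast

text \<open>M is chosen so that E + s v stays in the cone for |s| <= 1 / M. A zero violating the
  bound would be a zero of F at a complex vector whose imaginary part lies in the cone or in its
  negative.\<close>

lemma Im_bound: "\<exists>M>0. \<forall>\<epsilon> i. Im \<epsilon> > 0 \<longrightarrow> i < n \<longrightarrow> \<bar>Im (y \<epsilon> i)\<bar> \<le> M * Im \<epsilon>"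
proof -
  obtain l where l: "root_labelling E (- v, 0) (\<lambda>i. of_real (l i))"
    using real_root_labelling[OF E] by blast
  define M where "M = 1 + (\<Sum>i<n. \<bar>l i\<bar>)"
  have M: "M > 0" "\<And>i. i < n \<Longrightarrow> \<bar>l i\<bar> < M"
  proof -
    show "M > 0" unfolding M_def by (intro add_pos_nonneg sum_nonneg) auto
    fix i assume "i < n"
    then have "\<bar>l i\<bar> \<le> (\<Sum>i<n. \<bar>l i\<bar>)" by (intro member_le_sum) auto
    then show "\<bar>l i\<bar> < M" by (simp add: M_def)
  qed
  have near: "E + s *\<^sub>R v \<in> hcone p d" if s: "\<bar>s\<bar> * M \<le> 1" for s
  proof (rule hcone_segment[OF E])
    fix \<tau> :: real assume \<tau>: "0 \<le> \<tau>" "\<tau> \<le> 1"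
    have "1 + \<tau> * s * l i \<noteq> 0" if "i < n" for i
    proof -
      have "\<bar>\<tau> * s * l i\<bar> < 1"
      proof (cases "s = 0")
        case False
        have "\<bar>\<tau> * s * l i\<bar> \<le> \<bar>s\<bar> * \<bar>l i\<bar>"
          using \<tau> by (simp add: abs_mult mult_left_le_one_le mult.assoc)
        also have "\<dots> < \<bar>s\<bar> * M" using M(2)[OF that] False by (intro mult_strict_left_mono) auto
        finally show ?thesis using s by simp
      qed simp
      then show ?thesis by linarith
    qed
    then show "p (E + \<tau> *\<^sub>R s *\<^sub>R v) \<noteq> 0"
      using real_root_labelling_factor[OF l, of 1 "\<tau> * s"] pE by simp
  qed
  have "\<bar>Im (y \<epsilon> i)\<bar> \<le> M * Im \<epsilon>" if \<epsilon>: "Im \<epsilon> > 0" and i: "i < n" for \<epsilon> i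
  proof (rule ccontr)
    assume gt: "\<not> ?thesis"
    define h where "h = Im (y \<epsilon> i)"
    define x where "x = Re (y \<epsilon> i) *\<^sub>R E - e - Re \<epsilon> *\<^sub>R v"
    have h: "\<bar>h\<bar> > M * Im \<epsilon>" "\<bar>h\<bar> > 0" using gt M(1) \<epsilon> by (auto simp: h_def intro: less_trans[OF mult_pos_pos])
    have z: "F (x, h *\<^sub>R E - Im \<epsilon> *\<^sub>R v) = 0"
      using y_zero[OF i, of \<epsilon>] by (simp add: cscale_def x_def h_def algebra_simps)
    have mem: "\<bar>h\<bar> *\<^sub>R (E + (- Im \<epsilon> / h) *\<^sub>R v) \<in> hcone p d"
    proof (rule hcone_scale[OF near h(2)])
      show "\<bar>- Im \<epsilon> / h\<bar> * M \<le> 1" using h \<epsilon> by (simp add: abs_divide field_simps)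
    qed
    show False
    proof (cases "h > 0")
      case True
      then have "\<bar>h\<bar> *\<^sub>R (E + (- Im \<epsilon> / h) *\<^sub>R v) = h *\<^sub>R E - Im \<epsilon> *\<^sub>R v" by (simp add: algebra_simps)
      then show ?thesis using F_nonzero_imaginary(1)[OF mem] z by simp
    next
      case False
      then have "- (\<bar>h\<bar> *\<^sub>R (E + (- Im \<epsilon> / h) *\<^sub>R v)) = h *\<^sub>R E - Im \<epsilon> *\<^sub>R v"
        using h(2) by (simp add: algebra_simps)
      then show ?thesis using F_nonzero_imaginary(2)[OF mem] z by metis
    qed
  qed
  then show ?thesis using M(1) by blast
qed

lemma pencil_tendsto:
  assumes "X \<longlonglongrightarrow> \<epsilon>0"
  shows "(\<lambda>k. (- e, 0) - cscale (X k) (v, 0)) \<longlonglongrightarrow> (- e, 0) - cscale \<epsilon>0 (v, 0)"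
  by (intro tendsto_intros assms)

text \<open>Single values of y may jump, but a limit labelling at \<epsilon>0 has the same symmetric
  sums as y \<epsilon>0.\<close>

lemma root_sum_tendsto:
  fixes f :: "complex \<Rightarrow> real"
  assumes f: "\<And>z. isCont f z" and X: "X \<longlonglongrightarrow> \<epsilon>0"
  shows "(\<lambda>k. \<Sum>i<n. f (y (X k) i)) \<longlonglongrightarrow> (\<Sum>i<n. f (y \<epsilon>0 i))"
proof (rule tendsto_if_subsubseq_tendsto)
  fix r :: "nat \<Rightarrow> nat" assume r: "strict_mono r"
  have "(\<lambda>k. (- e, 0) - cscale (X (r k)) (v, 0)) \<longlonglongrightarrow> (- e, 0) - cscale \<epsilon>0 (v, 0)"
    using pencil_tendsto[OF LIMSEQ_subseq_LIMSEQ[OF X r]] by (simp add: o_def)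
  then obtain r' L where r': "strict_mono (r' :: nat \<Rightarrow> nat)" "\<forall>i<n. (\<lambda>k. y (X (r (r' k))) i) \<longlonglongrightarrow> L i"
      "root_labelling E ((- e, 0) - cscale \<epsilon>0 (v, 0)) L"
    using root_labelling_subseq[OF pE(2), of "\<lambda>k. (- e, 0) - cscale (X (r k)) (v, 0)" _ "\<lambda>k. y (X (r k))"] y
    by blast
  have "(\<lambda>k. \<Sum>i<n. f (y (X (r (r' k))) i)) \<longlonglongrightarrow> (\<Sum>i<n. f (L i))"
    using r'(2) by (intro tendsto_sum isCont_tendsto_compose[OF f]) auto
  also have "(\<Sum>i<n. f (L i)) = (\<Sum>i<n. f (y \<epsilon>0 i))"
    by (rule root_labelling_sum_unique[OF pE(2) r'(3) y])
  finally show "\<exists>r'. strict_mono (r' :: nat \<Rightarrow> nat) \<and> (\<lambda>k. \<Sum>i<n. f (y (X (r (r' k))) i)) \<longlonglongrightarrow> (\<Sum>i<n. f (y \<epsilon>0 i))"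
    using r'(1) by blast
qed

lemma continuous_T: "continuous_on {\<epsilon>. Im \<epsilon> > 0} T"
  unfolding continuous_on_sequentially
proof (intro allI ballI impI)
  fix X \<epsilon>0 assume "\<epsilon>0 \<in> {\<epsilon>. 0 < Im \<epsilon>}" and X: "(\<forall>k. X k \<in> {\<epsilon>. 0 < Im \<epsilon>}) \<and> X \<longlonglongrightarrow> \<epsilon>0"
  then show "(T \<circ> X) \<longlonglongrightarrow> T \<epsilon>0"
    unfolding T_def o_def
    by (intro tendsto_divide tendsto_intros root_sum_tendsto[of "\<lambda>z. (Im z)\<^sup>2"]) (auto intro!: continuous_intros)
qed

lemma roots_near:
  assumes \<rho>: "\<rho> > 0"
  shows "\<exists>r>0. \<forall>\<epsilon>\<in>ball \<epsilon>0 r. \<forall>i<n. \<exists>c\<in>y \<epsilon>0 ` {..<n}. dist c (y \<epsilon> i) < \<rho>"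
proof (rule ccontr)
  assume no: "\<not> ?thesis"
  have "\<exists>\<epsilon>. \<epsilon> \<in> ball \<epsilon>0 (inverse (real (Suc k))) \<and> (\<exists>i<n. \<forall>c\<in>y \<epsilon>0 ` {..<n}. \<not> dist c (y \<epsilon> i) < \<rho>)" for k
  proof -
    have "inverse (real (Suc k)) > 0" by simp
    with no show ?thesis by blast
  qed
  then obtain X where X: "\<And>k. X k \<in> ball \<epsilon>0 (inverse (real (Suc k)))"
      "\<And>k. \<exists>i<n. \<forall>c\<in>y \<epsilon>0 ` {..<n}. \<not> dist c (y (X k) i) < \<rho>"
    by metis
  have "X \<longlonglongrightarrow> \<epsilon>0"
  proof (rule metric_LIMSEQ_I)
    fix r :: real assume "r > 0"
    then have "\<forall>\<^sub>F k in sequentially. inverse (real (Suc k)) < r"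
      by (intro order_tendstoD(2)[OF LIMSEQ_inverse_real_of_nat])
    then obtain N where "\<forall>k\<ge>N. inverse (real (Suc k)) < r" by (auto simp: eventually_sequentially)
    moreover have "dist (X k) \<epsilon>0 < inverse (real (Suc k))" for k
      using X(1)[of k] by (simp only: mem_ball dist_commute[of \<epsilon>0])
    ultimately show "\<exists>N. \<forall>k\<ge>N. dist (X k) \<epsilon>0 < r" by (meson less_trans)
  qed
  then obtain r L where r: "strict_mono (r :: nat \<Rightarrow> nat)" "\<forall>i<n. (\<lambda>k. y (X (r k)) i) \<longlonglongrightarrow> L i"
      "root_labelling E ((- e, 0) - cscale \<epsilon>0 (v, 0)) L"
    using root_labelling_subseq[OF pE(2) pencil_tendsto, of X \<epsilon>0 "\<lambda>k. y (X k)"] y by blast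
  have L: "L i \<in> y \<epsilon>0 ` {..<n}" if "i < n" for i
    using root_labelling_zero_iff[OF r(3) pE(2), of "L i"] root_labelling_zero_iff[OF y pE(2), of "L i" \<epsilon>0] that
    by auto
  have "\<forall>\<^sub>F k in sequentially. \<forall>i\<in>{..<n}. dist (y (X (r k)) i) (L i) < \<rho>"
    using r(2) \<rho> by (intro eventually_ball_finite ballI tendstoD) auto
  then obtain k where k: "\<forall>i\<in>{..<n}. dist (y (X (r k)) i) (L i) < \<rho>"
    using eventually_happens'[OF sequentially_bot] by blast
  obtain i where i: "i < n" "\<forall>c\<in>y \<epsilon>0 ` {..<n}. \<not> dist c (y (X (r k)) i) < \<rho>"
    using X(2) by blast
  have "\<not> dist (L i) (y (X (r k)) i) < \<rho>" using i(2) L[OF i(1)] by blast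
  moreover have "dist (y (X (r k)) i) (L i) < \<rho>" using k i(1) by blast
  ultimately show False by (simp add: dist_commute)
qed

text \<open>Near \<open>\<epsilon>0\<close> the eigenvalues stay close to the distinct eigenvalues \<open>c\<close> at \<open>\<epsilon>0\<close>. As
  \<open>h\<^sup>2 / b \<ge> 2 \<kappa> h - \<kappa>\<^sup>2 b\<close> with equality for \<open>\<kappa> = h / b\<close>, the function \<open>T\<close> is minorised by the
  imaginary part of a sum of the terms \<open>2 \<kappa> z - \<kappa>\<^sup>2 \<epsilon>\<close>, with \<open>\<kappa>\<close> depending only on \<open>c\<close>; this sum
  is holomorphic because it is a contour integral.\<close>

lemma T_minorant:
  assumes b0: "Im \<epsilon>0 > 0"
  shows "\<exists>r>0. \<exists>S. ball \<epsilon>0 r \<subseteq> {\<epsilon>. Im \<epsilon> > 0} \<and> S holomorphic_on ball \<epsilon>0 r \<and>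
     (\<forall>\<epsilon>\<in>ball \<epsilon>0 r. Im (S \<epsilon>) \<le> T \<epsilon>) \<and> Im (S \<epsilon>0) = T \<epsilon>0"
proof -
  obtain Q where "\<forall>z \<epsilon>. F ((- e, 0) + cscale z (E, 0) + cscale \<epsilon> (- v, 0)) = poly (poly Q [:z:]) \<epsilon>"
    using complexifies_bivariate[OF cpx] by blast
  moreover have "(- e, 0) + cscale z (E, 0) + cscale \<epsilon> (- v, 0) = cscale z (E, 0) + ((- e, 0) - cscale \<epsilon> (v, 0))" for z \<epsilon>
    by (simp add: cscale_def)
  ultimately have Q: "poly (poly Q [:z:]) \<epsilon> = of_real (p E) * (\<Prod>i<n. z - y \<epsilon> i)" for z \<epsilon>
    using y unfolding root_labelling_def by metis
  define Z where "Z = y \<epsilon>0 ` {..<n}"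
  have Z: "finite Z" by (simp add: Z_def)
  \<comment> \<open>Half the least distance between distinct zeros, so that the open discs are
    disjoint; the inserted 1 covers the case without distinct pairs.\<close>
  obtain \<rho> where \<rho>: "\<rho> > 0" "\<And>c c'. c \<in> Z \<Longrightarrow> c' \<in> Z \<Longrightarrow> c \<noteq> c' \<Longrightarrow> 2 * \<rho> \<le> dist c c'"
  proof
    let ?D = "(\<lambda>(c, c'). dist c c' / 2) ` ((Z \<times> Z) - Id)"
    have fin: "finite (insert 1 ?D)" using Z by simp
    show "Min (insert 1 ?D) > 0" using fin by (subst Min_gr_iff) auto
    fix c c' assume "c \<in> Z" "c' \<in> Z" "c \<noteq> c'"
    then have "dist c c' / 2 \<in> ?D" by (intro image_eqI[of _ _ "(c, c')"]) auto
    then have "Min (insert 1 ?D) \<le> dist c c' / 2" using fin by (intro Min_le) auto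
    then show "2 * Min (insert 1 ?D) \<le> dist c c'" by simp
  qed
  obtain r1 where r1: "r1 > 0" "\<And>\<epsilon> i. \<epsilon> \<in> ball \<epsilon>0 r1 \<Longrightarrow> i < n \<Longrightarrow> \<exists>c\<in>Z. dist c (y \<epsilon> i) < \<rho>"
    using roots_near[OF \<rho>(1)] unfolding Z_def by blast
  define r where "r = min r1 (Im \<epsilon>0)"
  have r: "r > 0" "ball \<epsilon>0 r \<subseteq> ball \<epsilon>0 r1" using r1 b0 by (auto simp: r_def)
  have upper: "Im \<epsilon> > 0" if "\<epsilon> \<in> ball \<epsilon>0 r" for \<epsilon>
  proof -
    have "\<bar>Im (\<epsilon>0 - \<epsilon>)\<bar> \<le> norm (\<epsilon>0 - \<epsilon>)" by (rule abs_Im_le_cmod)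
    also have "\<dots> < Im \<epsilon>0" using that by (simp add: r_def dist_norm)
    finally show ?thesis by simp
  qed
  have far: "dist c (y \<epsilon> i) > \<rho>" if "\<epsilon> \<in> ball \<epsilon>0 r" "i < n" "c \<in> Z" "c' \<in> Z" "c \<noteq> c'" "dist c' (y \<epsilon> i) < \<rho>" for \<epsilon> i c c'
    using \<rho>(2)[of c c'] that dist_triangle[of c c' "y \<epsilon> i"] by (simp add: dist_commute)
  have off: "dist c (y \<epsilon> i) \<noteq> \<rho>" if "\<epsilon> \<in> ball \<epsilon>0 r" "i < n" "c \<in> Z" for \<epsilon> i c
    using r1(2)[of \<epsilon> i] far[OF that] r(2) that by (metis less_irrefl subsetD)
  have Pnz: "poly (poly Q [:z:]) \<epsilon> \<noteq> 0" if "\<epsilon> \<in> ball \<epsilon>0 r" "z \<in> sphere c \<rho>" "c \<in> Z" for \<epsilon> z c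
    using off[OF that(1) _ that(3)] that(2) pE by (auto simp: Q)
  define \<kappa> where "\<kappa> c = Im c / Im \<epsilon>0" for c
  define G where "G c \<epsilon> z = (of_real (2 * \<kappa> c) * z - of_real ((\<kappa> c)\<^sup>2) * \<epsilon>)" for c \<epsilon> z :: complex
  \<comment> \<open>Weighting the logarithmic derivative by G sums G over the zeros in each disc
    without ordering them.\<close>
  define S where "S \<epsilon> = (\<Sum>c\<in>Z. contour_integral (circlepath c \<rho>)
      (\<lambda>z. G c \<epsilon> z * (poly (poly (pderiv Q) [:z:]) \<epsilon> / poly (poly Q [:z:]) \<epsilon>)) / (2 * of_real pi * \<i>))" for \<epsilon>
  have "S holomorphic_on ball \<epsilon>0 r"
    unfolding S_def G_def
    by (intro holomorphic_on_sum holomorphic_on_divide holomorphic_on_const holomorphic_circle_integral_bivariate)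
      (use Pnz \<rho>(1) in auto)
  moreover
  have Seq: "S \<epsilon> = (\<Sum>i<n. \<Sum>c\<in>Z. if dist c (y \<epsilon> i) < \<rho> then G c \<epsilon> (y \<epsilon> i) else 0)" if \<epsilon>: "\<epsilon> \<in> ball \<epsilon>0 r" for \<epsilon>
  proof -
    have "contour_integral (circlepath c \<rho>) (\<lambda>z. G c \<epsilon> z * (poly (poly (pderiv Q) [:z:]) \<epsilon> / poly (poly Q [:z:]) \<epsilon>))
        / (2 * of_real pi * \<i>) = (\<Sum>i<n. if dist c (y \<epsilon> i) < \<rho> then G c \<epsilon> (y \<epsilon> i) else 0)" if c: "c \<in> Z" for c
    proof -
      have ld: "(\<Sum>i<n. 1 / (z - y \<epsilon> i)) = poly (poly (pderiv Q) [:z:]) \<epsilon> / poly (poly Q [:z:]) \<epsilon>" if z: "z \<in> sphere c \<rho>" for z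
      proof -
        have zn: "z \<noteq> y \<epsilon> i" if "i < n" for i using off[OF \<epsilon> that c] z by auto
        have "((\<lambda>z. of_real (p E) * (\<Prod>i<n. z - y \<epsilon> i)) has_field_derivative
            of_real (p E) * ((\<Prod>i<n. z - y \<epsilon> i) * (\<Sum>i<n. 1 / (z - y \<epsilon> i)))) (at z)"
          by (intro DERIV_cmult has_field_derivative_root_product zn)
        then have "((\<lambda>z. poly (poly Q [:z:]) \<epsilon>) has_field_derivative
            poly (poly Q [:z:]) \<epsilon> * (\<Sum>i<n. 1 / (z - y \<epsilon> i))) (at z)"
          by (simp add: Q mult.assoc)
        from DERIV_unique[OF this bivariate_deriv_fst] show ?thesis
          using Pnz[OF \<epsilon> z c] by (simp add: field_simps)
      qed
      have "((\<lambda>z. G c \<epsilon> z * (\<Sum>i<n. 1 / (z - y \<epsilon> i))) has_contour_integral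
          (\<Sum>i<n. if dist c (y \<epsilon> i) < \<rho> then 2 * of_real pi * \<i> * G c \<epsilon> (y \<epsilon> i) else 0)) (circlepath c \<rho>)"
        by (rule circle_integral_root_sum) (use \<rho>(1) off[OF \<epsilon> _ c] in \<open>auto simp: G_def intro!: holomorphic_intros\<close>)
      then have "((\<lambda>z. G c \<epsilon> z * (poly (poly (pderiv Q) [:z:]) \<epsilon> / poly (poly Q [:z:]) \<epsilon>)) has_contour_integral
          (\<Sum>i<n. if dist c (y \<epsilon> i) < \<rho> then 2 * of_real pi * \<i> * G c \<epsilon> (y \<epsilon> i) else 0)) (circlepath c \<rho>)"
        by (rule has_contour_integral_eq) (use \<rho>(1) ld in simp)
      then have "contour_integral (circlepath c \<rho>) (\<lambda>z. G c \<epsilon> z * (poly (poly (pderiv Q) [:z:]) \<epsilon> / poly (poly Q [:z:]) \<epsilon>))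
          = (\<Sum>i<n. if dist c (y \<epsilon> i) < \<rho> then 2 * of_real pi * \<i> * G c \<epsilon> (y \<epsilon> i) else 0)"
        by (rule contour_integral_unique)
      also have "\<dots> = (\<Sum>i<n. 2 * of_real pi * \<i> * (if dist c (y \<epsilon> i) < \<rho> then G c \<epsilon> (y \<epsilon> i) else 0))"
        by (intro sum.cong) auto
      also have "\<dots> = 2 * of_real pi * \<i> * (\<Sum>i<n. if dist c (y \<epsilon> i) < \<rho> then G c \<epsilon> (y \<epsilon> i) else 0)"
        by (simp only: sum_distrib_left)
      finally show ?thesis by simp
    qed
    then have "S \<epsilon> = (\<Sum>c\<in>Z. \<Sum>i<n. if dist c (y \<epsilon> i) < \<rho> then G c \<epsilon> (y \<epsilon> i) else 0)"
      unfolding S_def by (intro sum.cong) auto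
    then show ?thesis by (subst sum.swap)
  qed
  have single: "(\<Sum>c\<in>Z. if dist c (y \<epsilon> i) < \<rho> then G c \<epsilon> (y \<epsilon> i) else 0) = G c0 \<epsilon> (y \<epsilon> i)"
    if \<epsilon>: "\<epsilon> \<in> ball \<epsilon>0 r" and i: "i < n" and c0: "c0 \<in> Z" "dist c0 (y \<epsilon> i) < \<rho>" for \<epsilon> i c0
  proof -
    have "(\<Sum>c\<in>Z. if dist c (y \<epsilon> i) < \<rho> then G c \<epsilon> (y \<epsilon> i) else 0) = (\<Sum>c\<in>Z. if c = c0 then G c0 \<epsilon> (y \<epsilon> i) else 0)"
      using far[OF \<epsilon> i _ c0(1) _ c0(2)] c0(2) by (intro sum.cong) (auto dest: less_asym)
    then show ?thesis using Z c0(1) by simp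
  qed
  have "Im (S \<epsilon>) \<le> T \<epsilon>" if \<epsilon>: "\<epsilon> \<in> ball \<epsilon>0 r" for \<epsilon>
  proof -
    have "Im (\<Sum>c\<in>Z. if dist c (y \<epsilon> i) < \<rho> then G c \<epsilon> (y \<epsilon> i) else 0) \<le> (Im (y \<epsilon> i))\<^sup>2 / Im \<epsilon>" if i: "i < n" for i
    proof -
      obtain c0 where c0: "c0 \<in> Z" "dist c0 (y \<epsilon> i) < \<rho>" using r1(2)[of \<epsilon> i] r(2) \<epsilon> i by blast
      have "(Im (y \<epsilon> i))\<^sup>2 / Im \<epsilon> - (2 * \<kappa> c0 * Im (y \<epsilon> i) - (\<kappa> c0)\<^sup>2 * Im \<epsilon>) = (Im (y \<epsilon> i) - \<kappa> c0 * Im \<epsilon>)\<^sup>2 / Im \<epsilon>"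
        using upper[OF \<epsilon>] by (simp add: field_simps power2_eq_square)
      also have "\<dots> \<ge> 0" using upper[OF \<epsilon>] by simp
      finally show ?thesis unfolding single[OF \<epsilon> i c0] by (simp add: G_def)
    qed
    then show ?thesis
      unfolding Seq[OF \<epsilon>] T_def Im_sum sum_divide_distrib by (intro sum_mono) auto
  qed
  moreover have "Im (S \<epsilon>0) = T \<epsilon>0"
  proof -
    have \<epsilon>: "\<epsilon>0 \<in> ball \<epsilon>0 r" using r by simp
    have "Im (\<Sum>c\<in>Z. if dist c (y \<epsilon>0 i) < \<rho> then G c \<epsilon>0 (y \<epsilon>0 i) else 0) = (Im (y \<epsilon>0 i))\<^sup>2 / Im \<epsilon>0" if i: "i < n" for i
    proof -
      have "y \<epsilon>0 i \<in> Z" using i by (simp add: Z_def)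
      then have eq: "(\<Sum>c\<in>Z. if dist c (y \<epsilon>0 i) < \<rho> then G c \<epsilon>0 (y \<epsilon>0 i) else 0) = G (y \<epsilon>0 i) \<epsilon>0 (y \<epsilon>0 i)"
        by (rule single[OF \<epsilon> i]) (use \<rho> in simp)
      have "Im (G (y \<epsilon>0 i) \<epsilon>0 (y \<epsilon>0 i)) = 2 * \<kappa> (y \<epsilon>0 i) * Im (y \<epsilon>0 i) - (\<kappa> (y \<epsilon>0 i))\<^sup>2 * Im \<epsilon>0"
        by (simp add: G_def)
      then show ?thesis unfolding eq using b0 by (simp add: \<kappa>_def field_simps power2_eq_square)
    qed
    then show ?thesis unfolding Seq[OF \<epsilon>] T_def Im_sum sum_divide_distrib by simp
  qed
  moreover have "ball \<epsilon>0 r \<subseteq> {\<epsilon>. Im \<epsilon> > 0}" using upper by blast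
  ultimately show ?thesis using r(1) by blast
qed

text \<open>The quotients \<theta> = y / \<epsilon> are zeros of z E - e / \<epsilon> - v and tend
  to the real eigenvalues of v. In Im y / Im \<epsilon> = Re \<theta> + (Re \<epsilon> / Im
  \<epsilon>) Im \<theta> the second term vanishes in the limit because |Re \<epsilon> / Im
  \<epsilon>| <= 1 / \<eta> in the sector.\<close>

lemma T_asymptotic:
  assumes \<delta>: "\<delta> > 0" and \<eta>: "\<eta> > 0"
  shows "\<exists>R0. \<forall>\<epsilon>. norm \<epsilon> \<ge> R0 \<longrightarrow> Im \<epsilon> > 0 \<longrightarrow> Im \<epsilon> \<ge> \<eta> * norm \<epsilon> \<longrightarrow> T \<epsilon> \<le> (local_inner p E v v + \<delta>) * Im \<epsilon>"
proof (rule ccontr)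
  assume no: "\<not> ?thesis"
  define C where "C = local_inner p E v v"
  have "\<exists>\<epsilon>. norm \<epsilon> \<ge> real k \<and> Im \<epsilon> > 0 \<and> Im \<epsilon> \<ge> \<eta> * norm \<epsilon> \<and> T \<epsilon> > (C + \<delta>) * Im \<epsilon>" for k
    using no unfolding C_def not_le[symmetric] by blast
  then obtain X where X: "\<And>k. norm (X k) \<ge> real k" "\<And>k. Im (X k) > 0" "\<And>k. Im (X k) \<ge> \<eta> * norm (X k)"
      "\<And>k. T (X k) > (C + \<delta>) * Im (X k)"
    by metis
  have X0: "X k \<noteq> 0" for k using X(2)[of k] by auto
  define U where "U k = - cscale (inverse (X k)) (e, 0) + (- v, 0)" for k
  define \<theta> where "\<theta> k i = y (X k) i / X k" for k i
  have lab: "root_labelling E (U k) (\<theta> k)" for k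
    unfolding root_labelling_def
  proof
    fix z
    have "cscale (z * X k) (E, 0) + ((- e, 0) - cscale (X k) (v, 0)) = cscale (X k) (cscale z (E, 0) + U k)"
      using X0[of k] by (simp add: U_def cscale_add cscale_diff cscale_minus cscale_cscale mult.commute)
        (simp add: cscale_def)
    then have "X k ^ n * F (cscale z (E, 0) + U k) = of_real (p E) * (\<Prod>i<n. z * X k - y (X k) i)"
      using y[of "X k"] unfolding root_labelling_def by (metis F_scale)
    also have "(\<Prod>i<n. z * X k - y (X k) i) = (\<Prod>i<n. X k * (z - \<theta> k i))"
      using X0 by (intro prod.cong) (auto simp: \<theta>_def field_simps)
    also have "\<dots> = X k ^ n * (\<Prod>i<n. z - \<theta> k i)" by (simp add: prod.distrib)
    finally show "F (cscale z (E, 0) + U k) = of_real (p E) * (\<Prod>i<n. z - \<theta> k i)"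
      using X0[of k] by simp
  qed
  have "filterlim (\<lambda>k. norm (X k)) at_top sequentially"
    by (rule filterlim_at_top_mono[OF filterlim_real_sequentially]) (simp add: X(1))
  then have "(\<lambda>k. inverse (X k)) \<longlonglongrightarrow> 0"
    by (intro filterlim_compose[OF tendsto_inverse_0] filterlim_norm_at_top_imp_at_infinity)
  then have "U \<longlonglongrightarrow> - cscale 0 (e, 0) + (- v, 0)" unfolding U_def by (intro tendsto_intros)
  then obtain r L where r: "strict_mono (r :: nat \<Rightarrow> nat)" "\<forall>i<n. (\<lambda>k. \<theta> (r k) i) \<longlonglongrightarrow> L i"
      "root_labelling E (- v, 0) L"
    using root_labelling_subseq[OF pE(2), of U "(- v, 0)" \<theta>] lab by auto
  have Lreal: "Im (L i) = 0" if "i < n" for i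
    using zeros_real[OF E, of "L i" "- v"] root_labelling_zero_iff[OF r(3) pE(2), of "L i"] that by blast
  obtain l where l: "root_labelling E (- v, 0) (\<lambda>i. of_real (l i))"
    using real_root_labelling[OF E] by blast
  have "C = (\<Sum>i<n. (l i)\<^sup>2)" unfolding C_def by (rule local_inner_eigenvalues(2)[OF E l])
  also have "\<dots> = (\<Sum>i<n. (Re (L i))\<^sup>2)"
    using root_labelling_sum_unique[OF pE(2) l r(3), of "\<lambda>z. (Re z)\<^sup>2"] by simp
  finally have C: "C = (\<Sum>i<n. (Re (L i))\<^sup>2)" .
  define B where "B k = (\<Sum>i<n. (\<bar>Re (\<theta> (r k) i)\<bar> + \<bar>Im (\<theta> (r k) i)\<bar> / \<eta>)\<^sup>2)" for k
  have "B \<longlonglongrightarrow> (\<Sum>i<n. (\<bar>Re (L i)\<bar> + \<bar>Im (L i)\<bar> / \<eta>)\<^sup>2)"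
    unfolding B_def using r(2) \<eta> by (intro tendsto_intros) auto
  also have "(\<Sum>i<n. (\<bar>Re (L i)\<bar> + \<bar>Im (L i)\<bar> / \<eta>)\<^sup>2) = C"
    unfolding C using Lreal by (intro sum.cong) auto
  finally have Blim: "B \<longlonglongrightarrow> C" .
  have "B k \<ge> C + \<delta>" for k
  proof -
    define \<epsilon> where "\<epsilon> = X (r k)"
    have b: "Im \<epsilon> > 0" "Im \<epsilon> \<ge> \<eta> * norm \<epsilon>" "T \<epsilon> > (C + \<delta>) * Im \<epsilon>" using X by (auto simp: \<epsilon>_def)
    have "(Im (y \<epsilon> i))\<^sup>2 / (Im \<epsilon>)\<^sup>2 \<le> (\<bar>Re (\<theta> (r k) i)\<bar> + \<bar>Im (\<theta> (r k) i)\<bar> / \<eta>)\<^sup>2" for i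
    proof -
      define t where "t = \<theta> (r k) i"
      have "y \<epsilon> i = \<epsilon> * t" using X0[of "r k"] by (simp add: t_def \<theta>_def \<epsilon>_def)
      then have "Im (y \<epsilon> i) / Im \<epsilon> = Re t + (Re \<epsilon> / Im \<epsilon>) * Im t"
        using b by (simp add: field_simps)
      then have "\<bar>Im (y \<epsilon> i) / Im \<epsilon>\<bar> \<le> \<bar>Re t\<bar> + \<bar>Re \<epsilon> / Im \<epsilon>\<bar> * \<bar>Im t\<bar>"
        by (metis abs_mult abs_triangle_ineq)
      also have "\<bar>Re \<epsilon> / Im \<epsilon>\<bar> \<le> 1 / \<eta>"
      proof -
        have "\<eta> * \<bar>Re \<epsilon>\<bar> \<le> \<eta> * norm \<epsilon>" using \<eta> abs_Re_le_cmod by (intro mult_left_mono) auto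
        then have "\<eta> * \<bar>Re \<epsilon>\<bar> \<le> Im \<epsilon>" using b(2) by linarith
        then show ?thesis using b(1) \<eta> by (simp add: abs_divide field_simps)
      qed
      then have "\<bar>Re \<epsilon> / Im \<epsilon>\<bar> * \<bar>Im t\<bar> \<le> 1 / \<eta> * \<bar>Im t\<bar>" by (intro mult_right_mono) auto
      finally have "\<bar>Im (y \<epsilon> i) / Im \<epsilon>\<bar> \<le> \<bar>Re t\<bar> + \<bar>Im t\<bar> / \<eta>" by simp
      then have "\<bar>Im (y \<epsilon> i) / Im \<epsilon>\<bar>\<^sup>2 \<le> (\<bar>Re t\<bar> + \<bar>Im t\<bar> / \<eta>)\<^sup>2" by (intro power_mono) auto
      then show ?thesis by (simp add: power_divide t_def)
    qed
    then have "(\<Sum>i<n. (Im (y \<epsilon> i))\<^sup>2 / (Im \<epsilon>)\<^sup>2) \<le> B k" unfolding B_def by (intro sum_mono)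
    moreover have "(\<Sum>i<n. (Im (y \<epsilon> i))\<^sup>2 / (Im \<epsilon>)\<^sup>2) = T \<epsilon> / Im \<epsilon>"
      by (simp add: T_def sum_divide_distrib power2_eq_square)
    moreover have "C + \<delta> < T \<epsilon> / Im \<epsilon>" using b(3) by (simp only: pos_less_divide_eq[OF b(1)])
    ultimately show ?thesis by linarith
  qed
  then have "C + \<delta> \<le> C" using Blim by (intro LIMSEQ_le_const) auto
  then show False using \<delta> by simp
qed

text \<open>The asymptotic bound holds only in a sector and fails where a large half circle meets
  the real axis; there just T <= K Im \<epsilon> is known. A correction with poles slightly outside
  these corners absorbs that bound and is negligible at a fixed point as \<eta> tends to 0.\<close>

theorem T_le:
  assumes b: "Im \<epsilon> > 0"
  shows "T \<epsilon> \<le> local_inner p E v v * Im \<epsilon>"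
proof -
  define C where "C = local_inner p E v v"
  obtain M where M: "M > 0" "\<And>\<epsilon> i. Im \<epsilon> > 0 \<Longrightarrow> i < n \<Longrightarrow> \<bar>Im (y \<epsilon> i)\<bar> \<le> M * Im \<epsilon>"
    using Im_bound by blast
  define K where "K = real n * M\<^sup>2"
  have K: "K \<ge> 0" by (simp add: K_def)
  have T_bound: "T \<epsilon> \<le> K * Im \<epsilon>" if "Im \<epsilon> > 0" for \<epsilon>
  proof -
    have "(\<Sum>i<n. (Im (y \<epsilon> i))\<^sup>2) \<le> (\<Sum>i<n. (M * Im \<epsilon>)\<^sup>2)"
      using M(2)[OF that] by (intro sum_mono) (metis abs_ge_zero lessThan_iff power2_abs power_mono)
    then show ?thesis using that by (simp add: T_def K_def divide_simps power2_eq_square algebra_simps)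
  qed
  have main: "T \<epsilon> \<le> (C + \<delta>) * Im \<epsilon> + 40 * K * \<eta>\<^sup>2 * Im \<epsilon> + K * b1"
    if \<delta>: "\<delta> > 0" and \<eta>: "0 < \<eta>" "\<eta> \<le> 1" and b1: "0 < b1" "b1 \<le> Im \<epsilon>" for \<delta> \<eta> b1
  proof -
    obtain R0 where R0: "\<And>\<epsilon>. norm \<epsilon> \<ge> R0 \<Longrightarrow> Im \<epsilon> > 0 \<Longrightarrow> Im \<epsilon> \<ge> \<eta> * norm \<epsilon> \<Longrightarrow> T \<epsilon> \<le> (C + \<delta>) * Im \<epsilon>"
      using T_asymptotic[OF \<delta> \<eta>(1)] unfolding C_def by blast
    define R where "R = max R0 (2 * norm \<epsilon> + 1)"
    have R: "R \<ge> R0" "R \<ge> 2 * norm \<epsilon>" "R > 0" 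
      using norm_ge_zero[of \<epsilon>] unfolding R_def by linarith+
    \<comment> \<open>On the arc below height \<eta> R the squared distance to the nearer of the
      poles \<rho> and - \<rho> is at most (2 \<eta> R)^2 + (\<eta> R)^2 = 5 \<eta>^2 R^2. With N as
      chosen, the term of that pole is at least K Im \<epsilon>.\<close>
    define \<rho> where "\<rho> = (1 + \<eta>) * R"
    define N where "N = 5 * K * \<eta>\<^sup>2 * R\<^sup>2"
    have N: "N \<ge> 0" using K by (simp add: N_def)
    have \<rho>R: "\<rho> > R" using R \<eta> by (simp add: \<rho>_def)
    define h where "h \<epsilon> = of_real (C + \<delta>) * \<epsilon> - of_real N * (1 / (\<epsilon> - of_real \<rho>) + 1 / (\<epsilon> + of_real \<rho>))" for \<epsilon> :: complex
    have Imh: "Im (h \<epsilon>) = (C + \<delta>) * Im \<epsilon> + N * (Im \<epsilon> / ((Re \<epsilon> - \<rho>)\<^sup>2 + (Im \<epsilon>)\<^sup>2) + Im \<epsilon> / ((Re \<epsilon> + \<rho>)\<^sup>2 + (Im \<epsilon>)\<^sup>2))" for \<epsilon>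
      by (simp add: h_def Im_divide algebra_simps)
    have ne: "\<epsilon> - of_real \<rho> \<noteq> 0" "\<epsilon> + of_real \<rho> \<noteq> 0" if "Im \<epsilon> > 0" for \<epsilon>
      using that by (auto simp: complex_eq_iff)
    \<comment> \<open>The half disc is cut off at height b1, since \<open>T\<close> is controlled
      only above the real axis; on the cut \<open>T\<close> is at most K b1.\<close>
    define D where "D = {\<epsilon>. norm \<epsilon> \<le> R \<and> Im \<epsilon> \<ge> b1}"
    define W where "W = {\<epsilon>. norm \<epsilon> < R \<and> Im \<epsilon> > b1}"
    have Dpos: "Im \<epsilon> > 0" if "\<epsilon> \<in> D" for \<epsilon> using that b1 by (simp add: D_def)
    have "T \<epsilon> - Im (h \<epsilon>) \<le> K * b1"
    proof (rule minorant_maximum_principle[where D = D and W = W and u = "\<lambda>\<epsilon>. T \<epsilon> - Im (h \<epsilon>)" and \<epsilon> = \<epsilon>])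
      have "closed {\<epsilon>. Im \<epsilon> \<ge> b1}" by (intro closed_Collect_le continuous_intros)
      moreover have "D = cball 0 R \<inter> {\<epsilon>. Im \<epsilon> \<ge> b1}" by (auto simp: D_def)
      ultimately show "compact D" by (simp add: compact_Int_closed)
      have "open {\<epsilon>. Im \<epsilon> > b1}" by (intro open_Collect_less continuous_intros)
      moreover have "W = ball 0 R \<inter> {\<epsilon>. Im \<epsilon> > b1}" by (auto simp: W_def)
      ultimately show "open W" by (simp add: open_Int)
      show WD: "W \<subseteq> D" by (auto simp: W_def D_def)
      show "continuous_on D (\<lambda>\<epsilon>. T \<epsilon> - Im (h \<epsilon>))"
        unfolding h_def using ne Dpos
        by (intro continuous_intros continuous_on_subset[OF continuous_T]) auto
      show "\<epsilon> \<in> D" using R b1 by (auto simp: D_def intro: order_trans[OF _ R(2)])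
    next
      fix \<epsilon>0 assume \<epsilon>0: "\<epsilon>0 \<in> W"
      then have b0: "Im \<epsilon>0 > 0" using b1 by (simp add: W_def)
      obtain r S where r: "r > 0" "ball \<epsilon>0 r \<subseteq> {\<epsilon>. Im \<epsilon> > 0}" "S holomorphic_on ball \<epsilon>0 r"
          "\<forall>\<epsilon>\<in>ball \<epsilon>0 r. Im (S \<epsilon>) \<le> T \<epsilon>" "Im (S \<epsilon>0) = T \<epsilon>0"
        using T_minorant[OF b0] by blast
      have "open {\<epsilon>. Im \<epsilon> > b1}" by (intro open_Collect_less continuous_intros)
      moreover have "W = ball 0 R \<inter> {\<epsilon>. Im \<epsilon> > b1}" by (auto simp: W_def)
      ultimately have "open W" by (simp add: open_Int)
      then obtain r' where r': "r' > 0" "ball \<epsilon>0 r' \<subseteq> W" using \<epsilon>0 openE by blast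
      define s where "s = min r r'"
      have s: "s > 0" "ball \<epsilon>0 s \<subseteq> ball \<epsilon>0 r" "ball \<epsilon>0 s \<subseteq> W" using r r' by (auto simp: s_def)
      have "\<epsilon> - of_real \<rho> \<noteq> 0" "\<epsilon> + of_real \<rho> \<noteq> 0" if "\<epsilon> \<in> ball \<epsilon>0 s" for \<epsilon>
      proof -
        have "Im \<epsilon> > 0" using s(2) r(2) that by blast
        then show "\<epsilon> - of_real \<rho> \<noteq> 0" "\<epsilon> + of_real \<rho> \<noteq> 0" by (rule ne)+
      qed
      then have "(\<lambda>\<epsilon>. S \<epsilon> - h \<epsilon>) holomorphic_on ball \<epsilon>0 s"
        unfolding h_def by (intro holomorphic_intros holomorphic_on_subset[OF r(3)] s(2))
      then show "\<exists>r>0. \<exists>S. ball \<epsilon>0 r \<subseteq> W \<and> S holomorphic_on ball \<epsilon>0 r \<and>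
          (\<forall>\<epsilon>\<in>ball \<epsilon>0 r. Im (S \<epsilon>) \<le> T \<epsilon> - Im (h \<epsilon>)) \<and> Im (S \<epsilon>0) = T \<epsilon>0 - Im (h \<epsilon>0)"
        using s r(4,5) by (intro exI[of _ s] conjI exI[of _ "\<lambda>\<epsilon>. S \<epsilon> - h \<epsilon>"]) auto
    next
      fix \<epsilon> assume \<epsilon>: "\<epsilon> \<in> D" "\<epsilon> \<notin> W"
      have bp: "Im \<epsilon> > 0" by (rule Dpos[OF \<epsilon>(1)])
      define P where "P = N * (Im \<epsilon> / ((Re \<epsilon> - \<rho>)\<^sup>2 + (Im \<epsilon>)\<^sup>2) + Im \<epsilon> / ((Re \<epsilon> + \<rho>)\<^sup>2 + (Im \<epsilon>)\<^sup>2))"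
      have P0: "P \<ge> 0" unfolding P_def using N bp by (intro mult_nonneg_nonneg add_nonneg_nonneg divide_nonneg_nonneg) auto
      have C0: "C \<ge> 0"
      proof -
        obtain l where "root_labelling E (- v, 0) (\<lambda>i. of_real (l i))"
          using real_root_labelling[OF E] by blast
        then show ?thesis unfolding C_def by (simp add: local_inner_eigenvalues(2)[OF E] sum_nonneg)
      qed
      have Kb: "K * b1 \<ge> 0" using K b1 by simp
      consider "Im \<epsilon> = b1" | "norm \<epsilon> = R" using \<epsilon> by (force simp: D_def W_def)
      then show "T \<epsilon> - Im (h \<epsilon>) \<le> K * b1"
      proof cases
        case 1
        have "(C + \<delta>) * Im \<epsilon> \<ge> 0" using C0 \<delta> bp by simp
        moreover have "T \<epsilon> \<le> K * b1" using T_bound[OF bp] 1 by simp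
        ultimately show ?thesis using P0 unfolding Imh P_def[symmetric] by linarith
      next
        case 2
        show ?thesis
        proof (cases "Im \<epsilon> \<ge> \<eta> * R")
          case True
          then have "T \<epsilon> \<le> (C + \<delta>) * Im \<epsilon>" using R0[of \<epsilon>] R bp 2 by simp
          then show ?thesis using P0 Kb unfolding Imh P_def[symmetric] by linarith
        next
          case False
          define a where "a = \<bar>Re \<epsilon>\<bar>"
          have sq: "a\<^sup>2 + (Im \<epsilon>)\<^sup>2 = R\<^sup>2" using 2 by (simp add: a_def cmod_power2[symmetric])
          have a: "0 \<le> a" "a \<le> R" using abs_Re_le_cmod[of \<epsilon>] 2 by (auto simp: a_def)
          have b\<eta>: "(Im \<epsilon>)\<^sup>2 \<le> \<eta>\<^sup>2 * R\<^sup>2"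
            using False bp power_mono[of "Im \<epsilon>" "\<eta> * R" 2] by (simp add: power_mult_distrib)
          have "R - a \<le> \<eta> * R"
          proof -
            have "(R - a) * R \<le> (R - a) * (R + a)" using a by (intro mult_left_mono) auto
            also have "\<dots> = (Im \<epsilon>)\<^sup>2" using sq by (simp add: algebra_simps power2_eq_square)
            also have "\<dots> \<le> \<eta>\<^sup>2 * R\<^sup>2" by (rule b\<eta>)
            also have "\<dots> \<le> \<eta> * R * R"
              using \<eta> R(3) by (simp add: power2_eq_square mult_left_le_one_le)
            finally show ?thesis using R(3) by simp
          qed
          then have "0 \<le> \<rho> - a" "\<rho> - a \<le> 2 * (\<eta> * R)" using a \<rho>R by (auto simp: \<rho>_def algebra_simps)
          then have "(\<rho> - a)\<^sup>2 \<le> (2 * (\<eta> * R))\<^sup>2" by (intro power_mono)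
          then have den: "(\<rho> - a)\<^sup>2 + (Im \<epsilon>)\<^sup>2 \<le> 5 * \<eta>\<^sup>2 * R\<^sup>2"
            using b\<eta> by (simp add: power_mult_distrib)
          have denp: "(\<rho> - a)\<^sup>2 + (Im \<epsilon>)\<^sup>2 > 0" using bp by (intro add_nonneg_pos) auto
          have "K * Im \<epsilon> \<le> N * (Im \<epsilon> / ((\<rho> - a)\<^sup>2 + (Im \<epsilon>)\<^sup>2))"
          proof -
            have "K * Im \<epsilon> * ((\<rho> - a)\<^sup>2 + (Im \<epsilon>)\<^sup>2) \<le> K * Im \<epsilon> * (5 * \<eta>\<^sup>2 * R\<^sup>2)"
              using K bp den by (intro mult_left_mono) auto
            also have "\<dots> = N * Im \<epsilon>" by (simp add: N_def)
            finally show ?thesis using denp by (simp add: pos_le_divide_eq)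
          qed
          also have "\<dots> \<le> P"
          proof -
            have n1: "0 \<le> Im \<epsilon> / ((Re \<epsilon> - \<rho>)\<^sup>2 + (Im \<epsilon>)\<^sup>2)" "0 \<le> Im \<epsilon> / ((Re \<epsilon> + \<rho>)\<^sup>2 + (Im \<epsilon>)\<^sup>2)"
              using bp by auto
            have "Im \<epsilon> / ((\<rho> - a)\<^sup>2 + (Im \<epsilon>)\<^sup>2)
                \<le> Im \<epsilon> / ((Re \<epsilon> - \<rho>)\<^sup>2 + (Im \<epsilon>)\<^sup>2) + Im \<epsilon> / ((Re \<epsilon> + \<rho>)\<^sup>2 + (Im \<epsilon>)\<^sup>2)"
            proof (cases "Re \<epsilon> \<ge> 0")
              case True
              then have "(\<rho> - a)\<^sup>2 = (Re \<epsilon> - \<rho>)\<^sup>2" by (simp add: a_def power2_commute)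
              then show ?thesis using n1 by simp
            next
              case False
              then have "(\<rho> - a)\<^sup>2 = (Re \<epsilon> + \<rho>)\<^sup>2" by (simp add: a_def add.commute)
              then show ?thesis using n1 by simp
            qed
            then show ?thesis unfolding P_def using N by (intro mult_left_mono)
          qed
          finally have "K * Im \<epsilon> \<le> P" .
          moreover have "(C + \<delta>) * Im \<epsilon> \<ge> 0" using C0 \<delta> bp by simp
          ultimately show ?thesis using T_bound[OF bp] Kb unfolding Imh P_def[symmetric] by linarith
        qed
      qed
    qed
    moreover have "Im (h \<epsilon>) \<le> (C + \<delta>) * Im \<epsilon> + 40 * K * \<eta>\<^sup>2 * Im \<epsilon>"
    proof -
      \<comment> \<open>At the given point both poles are at distance at least R / 2, so R cancels
        against the R^2 in N and only a multiple of \<eta>^2 Im \<epsilon> remains.\<close>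
      have half: "N * (Im \<epsilon> / ((Re \<epsilon> + x)\<^sup>2 + (Im \<epsilon>)\<^sup>2)) \<le> 20 * K * \<eta>\<^sup>2 * Im \<epsilon>" if x: "\<bar>x\<bar> = \<rho>" for x
      proof -
        have "\<bar>Re \<epsilon> + x\<bar> \<ge> R / 2"
          using x \<rho>R R(2) abs_Re_le_cmod[of \<epsilon>] by linarith
        then have "(R / 2)\<^sup>2 \<le> \<bar>Re \<epsilon> + x\<bar>\<^sup>2" using R(3) by (intro power_mono) auto
        then have den: "R\<^sup>2 \<le> 4 * ((Re \<epsilon> + x)\<^sup>2 + (Im \<epsilon>)\<^sup>2)"
          by (simp add: power_divide) (smt (verit) zero_le_power2)
        have denp: "(Re \<epsilon> + x)\<^sup>2 + (Im \<epsilon>)\<^sup>2 > 0" using b by (intro add_nonneg_pos) auto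
        have "N * Im \<epsilon> = 5 * K * \<eta>\<^sup>2 * Im \<epsilon> * R\<^sup>2" by (simp add: N_def)
        also have "\<dots> \<le> 5 * K * \<eta>\<^sup>2 * Im \<epsilon> * (4 * ((Re \<epsilon> + x)\<^sup>2 + (Im \<epsilon>)\<^sup>2))"
          using K b den by (intro mult_left_mono) auto
        also have "\<dots> = 20 * K * \<eta>\<^sup>2 * Im \<epsilon> * ((Re \<epsilon> + x)\<^sup>2 + (Im \<epsilon>)\<^sup>2)"
          by (simp add: algebra_simps)
        finally show ?thesis using denp by (simp add: pos_divide_le_eq)
      qed
      have "\<bar>- \<rho>\<bar> = \<rho>" "\<bar>\<rho>\<bar> = \<rho>" using \<rho>R R(3) by auto
      from half[OF this(1)] half[OF this(2)] show ?thesis unfolding Imh by (simp add: distrib_left)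
    qed
    ultimately show ?thesis by linarith
  qed
  have "T \<epsilon> \<le> C * Im \<epsilon> + s" if s: "s > 0" for s
  proof -
    define b where "b = Im \<epsilon>"
    have b: "b > 0" using assms by (simp add: b_def)
    \<comment> \<open>Each of the errors \<delta> b, K b1 and 40 K \<eta>^2 b is made at most s / 3;
      K + 1 is a safely positive denominator, and \<eta> <= 1 gives \<eta>^2 <= \<eta>.\<close>
    define \<delta> where "\<delta> = s / (3 * b)"
    define b1 where "b1 = min b (s / (3 * (K + 1)))"
    define \<eta> where "\<eta> = min 1 (s / (120 * (K + 1) * b))"
    have pos: "\<delta> > 0" "b1 > 0" "b1 \<le> b" "\<eta> > 0" "\<eta> \<le> 1"
      using s b K by (auto simp: \<delta>_def b1_def \<eta>_def)
    have "\<delta> * b = s / 3" using b by (simp add: \<delta>_def)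
    moreover have "K * b1 \<le> s / 3"
    proof -
      have "K * b1 \<le> (K + 1) * (s / (3 * (K + 1)))" using K pos s by (intro mult_mono) (auto simp: b1_def)
      also have "\<dots> = s / 3" using K by (simp add: field_simps)
      finally show ?thesis .
    qed
    moreover have "40 * K * \<eta>\<^sup>2 * b \<le> s / 3"
    proof -
      have "\<eta>\<^sup>2 \<le> \<eta>" using pos by (simp add: power2_eq_square mult_left_le_one_le)
      also have "\<dots> \<le> s / (120 * (K + 1) * b)" by (simp add: \<eta>_def)
      finally have "(40 * K * b) * \<eta>\<^sup>2 \<le> (40 * (K + 1) * b) * (s / (120 * (K + 1) * b))"
        using K b s by (intro mult_mono) auto
      also have "\<dots> = s / 3"
      proof -
        define X where "X = (K + 1) * b"
        have "X > 0" using K b by (simp add: X_def)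
        then have "(40 * X) * (s / (120 * X)) = s / 3" by simp
        then show ?thesis by (simp only: X_def mult.assoc)
      qed
      finally show ?thesis by (simp add: mult_ac)
    qed
    moreover have "T \<epsilon> \<le> (C + \<delta>) * b + 40 * K * \<eta>\<^sup>2 * b + K * b1"
      using main[OF pos(1,4,5,2)] pos(3) by (simp add: b_def)
    ultimately show ?thesis unfolding b_def[symmetric] by (simp add: distrib_right)
  qed
  then show ?thesis unfolding C_def by (rule field_le_epsilon)
qed

end

text \<open>A complex derivative does not depend on the direction of approach: along the real axis
  it is D', and along the imaginary axis its real part is the limit of Im h(\<i> b) / b, because h 0
  is real.\<close>

lemma imaginary_difference_quotient:
  assumes h: "(h has_field_derivative D) (at (0::complex))"
    and f: "\<And>t::real. h (of_real t) = of_real (f t)" "(f has_real_derivative D') (at 0)"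
    and b: "b \<longlonglongrightarrow> 0" "\<And>k::nat. b k \<noteq> (0::real)"
  shows "(\<lambda>k. Im (h (\<i> * of_real (b k))) / b k) \<longlonglongrightarrow> D'"
proof -
  have quot: "(\<lambda>k. (h (w k) - h 0) / w k) \<longlonglongrightarrow> D" if "w \<longlonglongrightarrow> 0" "\<And>k::nat. w k \<noteq> 0" for w
  proof -
    have w: "filterlim w (at 0) sequentially" using that by (simp add: filterlim_at)
    have "((\<lambda>w. (h (0 + w) - h 0) / w) \<longlongrightarrow> D) (at 0)" using h by (simp add: DERIV_def)
    from filterlim_compose[OF this w] show ?thesis by simp
  qed
  have "(\<lambda>k. (h (of_real (b k)) - h 0) / of_real (b k)) \<longlonglongrightarrow> D"
    by (rule quot) (use b tendsto_of_real[OF b(1)] in auto)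
  moreover have "(\<lambda>k. complex_of_real ((f (0 + b k) - f 0) / b k)) \<longlonglongrightarrow> of_real D'"
  proof (rule tendsto_of_real)
    have "filterlim b (at 0) sequentially" using b by (simp add: filterlim_at)
    then show "(\<lambda>k. (f (0 + b k) - f 0) / b k) \<longlonglongrightarrow> D'"
      using f(2) unfolding DERIV_def by (rule filterlim_compose[rotated])
  qed
  moreover have "(h (of_real (b k)) - h 0) / of_real (b k) = of_real ((f (0 + b k) - f 0) / b k)" for k
    using f(1)[of "b k"] f(1)[of 0] by simp
  ultimately have D: "D = of_real D'" using LIMSEQ_unique by simp
  have "(\<lambda>k. (h (\<i> * of_real (b k)) - h 0) / (\<i> * of_real (b k))) \<longlonglongrightarrow> D"
  proof (rule quot)
    have "(\<lambda>k. \<i> * of_real (b k)) \<longlonglongrightarrow> \<i> * of_real 0" by (intro tendsto_intros b)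
    then show "(\<lambda>k. \<i> * of_real (b k)) \<longlonglongrightarrow> 0" by simp
  qed (use b in auto)
  then have "(\<lambda>k. Re ((h (\<i> * of_real (b k)) - h 0) / (\<i> * of_real (b k)))) \<longlonglongrightarrow> Re D"
    by (rule tendsto_Re)
  moreover have "Re ((h (\<i> * of_real (b k)) - h 0) / (\<i> * of_real (b k))) = Im (h (\<i> * of_real (b k))) / b k" for k
    using b(2)[of k] f(1)[of 0] by (simp add: Re_divide power2_eq_square)
  ultimately show ?thesis by (simp add: D)
qed

text \<open>A product rule for first-order imaginary parts. It asks only for limits of quotients
  along a sequence, since the single zeros are not known to be differentiable.\<close>

lemma imaginary_part_product_limit:
  fixes z :: "nat \<Rightarrow> nat \<Rightarrow> complex"
  assumes z: "\<And>i. i < m \<Longrightarrow> (\<lambda>k. z k i) \<longlonglongrightarrow> of_real (L i)"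
    and \<xi>: "\<And>i. i < m \<Longrightarrow> (\<lambda>k. Im (z k i) / b k) \<longlonglongrightarrow> \<xi> i" and L: "\<And>i. i < m \<Longrightarrow> L i \<noteq> 0"
  shows "(\<lambda>k. Im (\<Prod>i<m. z k i) / b k) \<longlonglongrightarrow> (\<Prod>i<m. L i) * (\<Sum>i<m. \<xi> i / L i)"
  using assms
proof (induction m)
  case (Suc m)
  have IH: "(\<lambda>k. Im (\<Prod>i<m. z k i) / b k) \<longlonglongrightarrow> (\<Prod>i<m. L i) * (\<Sum>i<m. \<xi> i / L i)"
    by (rule Suc.IH) (use Suc.prems in auto)
  have "(\<lambda>k. \<Prod>i<m. z k i) \<longlonglongrightarrow> (\<Prod>i<m. of_real (L i))"
    by (intro tendsto_prod Suc.prems) auto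
  then have "(\<lambda>k. \<Prod>i<m. z k i) \<longlonglongrightarrow> of_real (\<Prod>i<m. L i)" by simp
  then have Re_lim: "(\<lambda>k. Re (\<Prod>i<m. z k i)) \<longlonglongrightarrow> (\<Prod>i<m. L i)"
    by (auto dest: tendsto_Re simp del: of_real_prod)
  have Re_m: "(\<lambda>k. Re (z k m)) \<longlonglongrightarrow> L m" using tendsto_Re[OF Suc.prems(1)[of m]] by simp
  have "(\<lambda>k. Re (\<Prod>i<m. z k i) * (Im (z k m) / b k) + Im (\<Prod>i<m. z k i) / b k * Re (z k m))
      \<longlonglongrightarrow> (\<Prod>i<m. L i) * \<xi> m + (\<Prod>i<m. L i) * (\<Sum>i<m. \<xi> i / L i) * L m"
    by (intro tendsto_intros Re_lim Re_m IH Suc.prems) auto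
  moreover have "(\<Prod>i<m. L i) * \<xi> m + (\<Prod>i<m. L i) * (\<Sum>i<m. \<xi> i / L i) * L m
      = (\<Prod>i<Suc m. L i) * (\<Sum>i<Suc m. \<xi> i / L i)"
    using Suc.prems(3)[of m] by (simp add: distrib_left)
  moreover have "Re (\<Prod>i<m. z k i) * (Im (z k m) / b k) + Im (\<Prod>i<m. z k i) / b k * Re (z k m)
      = Im (\<Prod>i<Suc m. z k i) / b k" for k
    by (simp add: add_divide_distrib)
  ultimately show ?case by simp
qed simp

section \<open>The Cauchy-Schwarz inequality in spectral form\<close>

context hyperbolic_cone
begin

text \<open>Both sides are the sum of the eigenvalues of v in direction e.\<close>

lemma gradient_local_inner:
  assumes e: "e \<in> hcone p d" and g: "(p has_derivative (\<lambda>h. inner g h)) (at e)"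
  shows "local_inner p e e v = inner g v / p e"
proof -
  obtain l where l: "root_labelling e (- v, 0) (\<lambda>i. of_real (l i))"
    using real_root_labelling[OF e] by blast
  have "((\<lambda>t. p (e + t *\<^sub>R v)) has_real_derivative inner g v) (at 0)"
    by (rule has_derivative_along_line) (use g in simp)
  moreover have "p (e + t *\<^sub>R v) = p e * (\<Prod>i<n. 1 + t * l i)" for t
    using real_root_labelling_factor[OF l, of 1 t] by simp
  moreover have "((\<lambda>t. \<Prod>i<m. 1 + t * l i) has_real_derivative (\<Sum>i<m. l i)) (at 0)" for m
  proof (induction m)
    case (Suc m)
    have "((\<lambda>t. (\<Prod>i<m. 1 + t * l i) * (1 + t * l m)) has_real_derivative
        (\<Sum>i<m. l i) * (1 + 0 * l m) + l m * (\<Prod>i<m. 1 + 0 * l i)) (at 0)"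
      by (intro DERIV_mult Suc.IH) (auto intro!: derivative_eq_intros)
    then show ?case by simp
  qed simp
  then have "((\<lambda>t. p e * (\<Prod>i<n. 1 + t * l i)) has_real_derivative p e * (\<Sum>i<n. l i)) (at 0)"
    by (intro DERIV_cmult)
  ultimately have "inner g v = p e * (\<Sum>i<n. l i)" using DERIV_unique by simp
  then show ?thesis using local_inner_eigenvalues(1)[OF e l] hcone_positive[OF e] by simp
qed

text \<open>If \<open>p\<close> is a determinant and \<open>E\<close> the identity, this is the Cauchy-Schwarz inequality
  \<open>(tr (\<phi> V))\<^sup>2 \<le> tr (\<phi>\<^sup>2) tr (V\<^sup>2)\<close> for \<open>\<phi> = a e\<inverse> + c e\<^sup>-\<^sup>2\<close>.\<close>

theorem local_inner_spectral_bound: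
  assumes E: "E \<in> hcone p d" and e: "e \<in> hcone p d"
    and l: "root_labelling E (- e, 0) (\<lambda>i. of_real (l i))" and lpos: "\<And>i. i < n \<Longrightarrow> l i > 0"
  shows "(a * local_inner p e e v + c * local_inner p e E v)\<^sup>2
    \<le> (\<Sum>i<n. (a / l i + c / (l i)\<^sup>2)\<^sup>2) * local_inner p E v v"
proof -
  have pE: "p E > 0" "p E \<noteq> 0" using hcone_positive[OF E] by auto
  have pe: "p e > 0" by (rule hcone_positive[OF e])
  obtain y where y: "\<And>\<epsilon>. root_labelling E ((- e, 0) - cscale \<epsilon> (v, 0)) (y \<epsilon>)"
    using root_labelling_choice[OF pE(2), of "\<lambda>\<epsilon>. (- e, 0) - cscale \<epsilon> (v, 0)"] by blast
  interpret pencil p n F d E e v y by unfold_locales (use E y in auto)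
  define C where "C = local_inner p E v v"
  obtain M where M: "M > 0" "\<And>\<epsilon> i. Im \<epsilon> > 0 \<Longrightarrow> i < n \<Longrightarrow> \<bar>Im (y \<epsilon> i)\<bar> \<le> M * Im \<epsilon>"
    using Im_bound by blast
  define b0 where "b0 k = inverse (real (Suc k))" for k
  have b0: "b0 \<longlonglongrightarrow> 0" "\<And>k. b0 k > 0"
    unfolding b0_def by (rule LIMSEQ_inverse_real_of_nat) simp
  have "(\<lambda>k. \<i> * of_real (b0 k)) \<longlonglongrightarrow> \<i> * of_real 0" by (intro tendsto_intros b0)
  then have "(\<lambda>k. (- e, 0) - cscale (\<i> * of_real (b0 k)) (v, 0)) \<longlonglongrightarrow> (- e, 0)"
    using pencil_tendsto[of "\<lambda>k. \<i> * of_real (b0 k)" 0] by simp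
  \<comment> \<open>One subsequence makes the zeros at \<i> b converge; a second one, available by
    \<open>Im_bound\<close>, does so for their imaginary parts divided by b. The limits \<xi> thus
    exist without differentiating any zero.\<close>
  then obtain r1 L0 where r1: "strict_mono (r1 :: nat \<Rightarrow> nat)"
      "\<forall>i<n. (\<lambda>k. y (\<i> * of_real (b0 (r1 k))) i) \<longlonglongrightarrow> L0 i" "root_labelling E (- e, 0) L0"
    using root_labelling_subseq[OF pE(2), of "\<lambda>k. (- e, 0) - cscale (\<i> * of_real (b0 k)) (v, 0)" "(- e, 0)"
        "\<lambda>k. y (\<i> * of_real (b0 k))"] y by blast
  have "bounded (range (\<lambda>k. Im (y (\<i> * of_real (b0 (r1 k))) i) / b0 (r1 k)))" if "i < n" for i
  proof -
    have "\<bar>Im (y (\<i> * of_real (b0 k)) i) / b0 k\<bar> \<le> M" for k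
      using M(2)[of "\<i> * of_real (b0 k)" i] that b0(2)[of k] by (simp add: abs_divide field_simps)
    then show ?thesis by (auto simp: bounded_iff intro!: exI[of _ M])
  qed
  then obtain r2 \<xi> where r2: "strict_mono (r2 :: nat \<Rightarrow> nat)"
      "\<forall>i<n. (\<lambda>k. Im (y (\<i> * of_real (b0 (r1 (r2 k)))) i) / b0 (r1 (r2 k))) \<longlonglongrightarrow> \<xi> i"
    using finite_family_convergent_subseq[of n "\<lambda>k i. Im (y (\<i> * of_real (b0 (r1 k))) i) / b0 (r1 k)"] by blast
  define b where "b k = b0 (r1 (r2 k))" for k
  define z where "z k i = y (\<i> * of_real (b k)) i" for k i
  define L where "L i = Re (L0 i)" for i
  have b: "b \<longlonglongrightarrow> 0" "\<And>k. b k > 0"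
    using LIMSEQ_subseq_LIMSEQ[OF LIMSEQ_subseq_LIMSEQ[OF b0(1) r1(1)] r2(1)] b0(2)
    unfolding b_def o_def by auto
  have L0: "L0 i = of_real (L i)" "L i > 0" if i: "i < n" for i
  proof -
    obtain j where "j < n" "L0 i = of_real (l j)"
      using root_labelling_zero_iff[OF r1(3) pE(2), of "L0 i"] root_labelling_zero_iff[OF l pE(2), of "L0 i"] i
      by blast
    then show "L0 i = of_real (L i)" "L i > 0" using lpos by (auto simp: L_def)
  qed
  have z: "(\<lambda>k. z k i) \<longlonglongrightarrow> of_real (L i)" if "i < n" for i
  proof -
    have "((\<lambda>k. y (\<i> * of_real (b0 (r1 k))) i) \<circ> r2) \<longlonglongrightarrow> L0 i"
      by (rule LIMSEQ_subseq_LIMSEQ) (use r1(2) r2(1) that in auto)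
    then show ?thesis using L0(1)[OF that] by (simp add: z_def b_def o_def)
  qed
  have \<xi>: "(\<lambda>k. Im (z k i) / b k) \<longlonglongrightarrow> \<xi> i" if "i < n" for i
    using r2(2) that by (simp add: z_def b_def)
  have \<xi>C: "(\<Sum>i<n. (\<xi> i)\<^sup>2) \<le> C"
  proof (rule LIMSEQ_le_const2)
    show "(\<lambda>k. \<Sum>i<n. (Im (z k i) / b k)\<^sup>2) \<longlonglongrightarrow> (\<Sum>i<n. (\<xi> i)\<^sup>2)"
      by (intro tendsto_intros \<xi>) auto
    have "(\<Sum>i<n. (Im (z k i) / b k)\<^sup>2) \<le> C" for k
    proof -
      have "T (\<i> * of_real (b k)) \<le> C * b k" using T_le[of "\<i> * of_real (b k)"] b(2)[of k] by (simp add: C_def)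
      moreover have "T (\<i> * of_real (b k)) = (\<Sum>i<n. (Im (z k i) / b k)\<^sup>2) * b k"
        using b(2)[of k] by (simp add: T_def z_def sum_distrib_right power2_eq_square sum_divide_distrib)
      ultimately show ?thesis using b(2)[of k] by simp
    qed
    then show "\<exists>N. \<forall>k\<ge>N. (\<Sum>i<n. (Im (z k i) / b k)\<^sup>2) \<le> C" by blast
  qed
  obtain Q where Q: "\<forall>w \<epsilon>. F ((e, 0) + cscale w (E, 0) + cscale \<epsilon> (v, 0)) = poly (poly Q [:w:]) \<epsilon>"
    using complexifies_bivariate[OF cpx] by blast
  have Qfac: "poly (poly Q [:w:]) \<epsilon> = of_real (p E) * (\<Prod>i<n. w - (- y \<epsilon> i))" for w \<epsilon>
  proof -
    have "(e, 0) + cscale w (E, 0) + cscale \<epsilon> (v, 0) = cscale (- 1) (cscale (- w) (E, 0) + ((- e, 0) - cscale \<epsilon> (v, 0)))"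
      by (simp add: cscale_def)
    then have "poly (poly Q [:w:]) \<epsilon> = (- 1) ^ n * (of_real (p E) * (\<Prod>i<n. - w - y \<epsilon> i))"
      using Q y unfolding root_labelling_def by (metis F_scale)
    also have "\<dots> = of_real (p E) * (\<Prod>i<n. (- 1) * (- w - y \<epsilon> i))"
      by (simp only: prod.distrib prod_constant card_lessThan mult.left_commute)
    finally show ?thesis by (simp add: add.commute)
  qed
  obtain g H where g: "\<forall>x. (p has_derivative (\<lambda>h. inner (g x) h)) (at x)"
    and H: "\<forall>x v. ((\<lambda>x. inner (g x) v) has_derivative H x v) (at x)"
    and Hsym: "\<forall>x u v. H x u v = H x v u"
    by (rule obtain_derivatives)
  have p_line: "((\<lambda>t. p (e + t *\<^sub>R v)) has_real_derivative inner (g e) v) (at 0)"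
    using has_derivative_along_line[of p _ e 0 v] g by fastforce
  have Qreal0: "poly (poly Q [:0:]) (of_real t) = of_real (p (e + t *\<^sub>R v))" for t
    using Q[rule_format, of 0 "of_real t", symmetric] by simp
  have Qreal1: "poly (poly (pderiv Q) [:0:]) (of_real t) = of_real (inner (g (e + t *\<^sub>R v)) E)" for t
  proof -
    have c: "((\<lambda>w. poly (poly Q [:w:]) (of_real t)) has_field_derivative poly (poly (pderiv Q) [:0:]) (of_real t)) (at (of_real 0))"
      using bivariate_deriv_fst[of Q "of_real t" 0] by simp
    have "((\<lambda>s. poly (poly Q [:of_real s:]) (of_real t)) has_vector_derivative poly (poly (pderiv Q) [:0:]) (of_real t)) (at 0)"
      using has_vector_derivative_real_field[OF c] by simp
    moreover have "poly (poly Q [:of_real s:]) (of_real t) = of_real (p (e + t *\<^sub>R v + s *\<^sub>R E))" for s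
      using Q[rule_format, of "of_real s" "of_real t", symmetric] by (simp add: algebra_simps)
    moreover have "((\<lambda>s. p (e + t *\<^sub>R v + s *\<^sub>R E)) has_real_derivative inner (g (e + t *\<^sub>R v)) E) (at 0)"
      using has_derivative_along_line[of p _ "e + t *\<^sub>R v" 0 E] g by fastforce
    then have "((\<lambda>s. complex_of_real (p (e + t *\<^sub>R v + s *\<^sub>R E))) has_vector_derivative of_real (inner (g (e + t *\<^sub>R v)) E)) (at 0)"
      by (simp add: has_vector_derivative_of_real has_real_derivative_iff_has_vector_derivative)
    ultimately show ?thesis using vector_derivative_unique_at by simp
  qed
  have b': "b k \<noteq> 0" for k using b(2)[of k] by simp
  \<comment> \<open>This limit is evaluated twice: here as the derivative of p along v, below from
    the product over the zeros. Equating the two values gives <e, v>_e as the sum of \<xi> /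
    L.\<close>
  have lim0: "(\<lambda>k. Im (poly (poly Q [:0:]) (\<i> * of_real (b k))) / b k) \<longlonglongrightarrow> inner (g e) v"
    by (rule imaginary_difference_quotient[OF bivariate_deriv_snd Qreal0 p_line b(1) b'])
  have fac0: "poly (poly Q [:0:]) (\<i> * of_real (b k)) = of_real (p E) * (\<Prod>i<n. z k i)" for k
    unfolding Qfac by (simp add: z_def)
  have prodL: "p E * (\<Prod>i<n. L i) = p e"
  proof -
    have "(\<lambda>k. poly (poly Q [:0:]) (\<i> * of_real (b k))) \<longlonglongrightarrow> of_real (p E) * (\<Prod>i<n. of_real (L i))"
      unfolding fac0 by (intro tendsto_intros z) auto
    moreover have "(\<lambda>k. poly (poly Q [:0:]) (\<i> * of_real (b k))) \<longlonglongrightarrow> poly (poly Q [:0:]) (\<i> * of_real 0)"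
      by (intro tendsto_intros b)
    ultimately have "of_real (p E) * (\<Prod>i<n. of_real (L i)) = poly (poly Q [:0:]) (of_real 0)"
      using LIMSEQ_unique by fastforce
    then have "complex_of_real (p E * (\<Prod>i<n. L i)) = of_real (p e)" unfolding Qreal0 by simp
    then show ?thesis using of_real_eq_iff by blast
  qed
  have "(\<lambda>k. p E * (Im (\<Prod>i<n. z k i) / b k)) \<longlonglongrightarrow> p E * ((\<Prod>i<n. L i) * (\<Sum>i<n. \<xi> i / L i))"
    by (intro tendsto_mult tendsto_const imaginary_part_product_limit z \<xi>) (use L0 in force)+
  then have "(\<lambda>k. Im (poly (poly Q [:0:]) (\<i> * of_real (b k))) / b k) \<longlonglongrightarrow> p e * (\<Sum>i<n. \<xi> i / L i)"
    unfolding fac0 prodL[symmetric] by (simp add: mult.assoc)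
  then have "inner (g e) v = p e * (\<Sum>i<n. \<xi> i / L i)" using lim0 LIMSEQ_unique by blast
  then have first: "local_inner p e e v = (\<Sum>i<n. \<xi> i / L i)"
    using gradient_local_inner[OF e, of "g e" v] g pe by simp
  \<comment> \<open>h is the derivative of ln p in direction E at e + \<epsilon> v. Its derivative
    at 0 is - <E, v>_e, while over the zeros it is the sum of 1 / z, whose first-order imaginary
    part is the sum of - \<xi> / L^2.\<close>
  define h where "h \<epsilon> = poly (poly (pderiv Q) [:0:]) \<epsilon> / poly (poly Q [:0:]) \<epsilon>" for \<epsilon>
  have Qn: "poly (poly Q [:0:]) 0 \<noteq> 0" using Qreal0[of 0] pe by simp
  obtain D where hder: "(h has_field_derivative D) (at 0)"
    using DERIV_divide[OF bivariate_deriv_snd[of "pderiv Q"] bivariate_deriv_snd Qn] unfolding h_def by blast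
  have hreal: "h (of_real t) = of_real (inner (g (e + t *\<^sub>R v)) E / p (e + t *\<^sub>R v))" for t
    unfolding h_def Qreal0 Qreal1 by simp
  have "((\<lambda>t. inner (g (e + t *\<^sub>R v)) E) has_real_derivative H e E v) (at 0)"
    using has_derivative_along_line[of "\<lambda>x. inner (g x) E" _ e 0 v] H by fastforce
  then have "((\<lambda>t. inner (g (e + t *\<^sub>R v)) E / p (e + t *\<^sub>R v)) has_real_derivative - local_inner p e E v) (at 0)"
    unfolding local_inner_formula[OF g H pe, of E v] using Hsym[rule_format, of e v E] p_line pe
    by (auto intro!: derivative_eq_intros simp: field_simps power2_eq_square)
  then have lim1: "(\<lambda>k. Im (h (\<i> * of_real (b k))) / b k) \<longlonglongrightarrow> - local_inner p e E v"
    using hreal b(1) b' by (intro imaginary_difference_quotient[OF hder])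
  have znz: "\<forall>\<^sub>F k in sequentially. \<forall>i\<in>{..<n}. z k i \<noteq> 0"
  proof (intro eventually_ball_finite ballI)
    fix i assume "i \<in> {..<n}"
    then show "\<forall>\<^sub>F k in sequentially. z k i \<noteq> 0"
      using tendsto_imp_eventually_ne[OF z[of i], of 0] L0(2)[of i] by auto
  qed simp
  have hsum: "h (\<i> * of_real (b k)) = (\<Sum>i<n. 1 / z k i)" if nz: "\<forall>i\<in>{..<n}. z k i \<noteq> 0" for k
  proof -
    let ?\<epsilon> = "\<i> * of_real (b k)"
    have "((\<lambda>w. of_real (p E) * (\<Prod>i<n. w - (- y ?\<epsilon> i))) has_field_derivative
        of_real (p E) * ((\<Prod>i<n. 0 - (- y ?\<epsilon> i)) * (\<Sum>i<n. 1 / (0 - (- y ?\<epsilon> i))))) (at 0)"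
      by (intro DERIV_cmult has_field_derivative_root_product) (use nz in \<open>auto simp: z_def\<close>)
    then have "((\<lambda>w. poly (poly Q [:w:]) ?\<epsilon>) has_field_derivative poly (poly Q [:0:]) ?\<epsilon> * (\<Sum>i<n. 1 / z k i)) (at 0)"
      unfolding Qfac by (simp add: z_def mult.assoc)
    from DERIV_unique[OF bivariate_deriv_fst this]
    have "poly (poly (pderiv Q) [:0:]) ?\<epsilon> = poly (poly Q [:0:]) ?\<epsilon> * (\<Sum>i<n. 1 / z k i)" .
    moreover have "poly (poly Q [:0:]) ?\<epsilon> \<noteq> 0" unfolding fac0 using nz pE by auto
    ultimately show ?thesis by (simp add: h_def)
  qed
  have "(\<lambda>k. \<Sum>i<n. - (Im (z k i) / b k) / (norm (z k i))\<^sup>2) \<longlonglongrightarrow> (\<Sum>i<n. - \<xi> i / (norm (complex_of_real (L i)))\<^sup>2)"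
    using L0(2) by (intro tendsto_intros \<xi> z) force+
  moreover have "\<forall>\<^sub>F k in sequentially. (\<Sum>i<n. - (Im (z k i) / b k) / (norm (z k i))\<^sup>2) = Im (h (\<i> * of_real (b k))) / b k"
    using znz
  proof eventually_elim
    case (elim k)
    show ?case unfolding hsum[OF elim] Im_sum sum_divide_distrib
      by (intro sum.cong) (auto simp: Im_divide cmod_power2 mult.commute)
  qed
  ultimately have "(\<lambda>k. Im (h (\<i> * of_real (b k))) / b k) \<longlonglongrightarrow> (\<Sum>i<n. - \<xi> i / (norm (complex_of_real (L i)))\<^sup>2)"
    by (rule Lim_transform_eventually)
  then have "- local_inner p e E v = (\<Sum>i<n. - \<xi> i / (L i)\<^sup>2)"
    using lim1 LIMSEQ_unique by (simp add: norm_of_real) blast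
  then have second: "local_inner p e E v = (\<Sum>i<n. \<xi> i / (L i)\<^sup>2)" by (simp add: sum_negf)
  have "a * local_inner p e e v + c * local_inner p e E v = (\<Sum>i<n. (a / L i + c / (L i)\<^sup>2) * \<xi> i)"
    unfolding first second by (simp add: sum_distrib_left sum.distrib[symmetric] algebra_simps)
  then have "(a * local_inner p e e v + c * local_inner p e E v)\<^sup>2
      \<le> (\<Sum>i<n. (a / L i + c / (L i)\<^sup>2)\<^sup>2) * (\<Sum>i<n. (\<xi> i)\<^sup>2)"
    by (simp add: Cauchy_Schwarz_ineq_sum)
  also have "\<dots> \<le> (\<Sum>i<n. (a / L i + c / (L i)\<^sup>2)\<^sup>2) * C"
    by (intro mult_left_mono \<xi>C sum_nonneg) auto
  also have "(\<Sum>i<n. (a / L i + c / (L i)\<^sup>2)\<^sup>2) = (\<Sum>i<n. (a / l i + c / (l i)\<^sup>2)\<^sup>2)"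
    using root_labelling_sum_unique[OF pE(2) r1(3) l, of "\<lambda>z. (a / Re z + c / (Re z)\<^sup>2)\<^sup>2"] by (simp add: L_def)
  finally show ?thesis by (simp add: C_def)
qed

end

section \<open>The step-length quadratic\<close>

text \<open>The l i stand for the eigenvalues of the optimal solution x; \<open>boundary\<close> is
  the squared equation <e, x>_e = \<alpha> |x|_e.\<close>

locale boundary_spectrum =
  fixes l :: "nat \<Rightarrow> real" and n :: nat and \<alpha> :: real
  assumes alpha: "0 < \<alpha>" "\<alpha> < 1" and n: "n > 0" and sum_pos: "(\<Sum>i<n. l i) > 0"
    and boundary: "\<alpha>\<^sup>2 * (\<Sum>i<n. (l i)\<^sup>2) = (\<Sum>i<n. l i)\<^sup>2"
begin

definition \<sigma> where "\<sigma> = (\<Sum>i<n. l i)"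
definition s3 where "s3 = (\<Sum>i<n. l i ^ 3)"
definition s4 where "s4 = (\<Sum>i<n. l i ^ 4)"
definition a2 where "a2 = \<sigma>\<^sup>2 * (\<Sum>i<n. (l i)\<^sup>2) - 2 * \<alpha>\<^sup>2 * \<sigma> * s3 + \<alpha> ^ 4 * s4"
definition a1 where "a1 = 2 * \<alpha> ^ 4 * s3 - 2 * \<sigma> ^ 3"
definition a0 where "a0 = (real n - \<alpha>\<^sup>2) * \<sigma>\<^sup>2"
definition q where "q t = a2 * t\<^sup>2 + a1 * t + a0"
definition t0 where "t0 = - a1 / (2 * a2)"

lemma sigma_pos: "\<sigma> > 0" and s2: "\<alpha>\<^sup>2 * (\<Sum>i<n. (l i)\<^sup>2) = \<sigma>\<^sup>2"
  using sum_pos boundary by (auto simp: \<sigma>_def)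

text \<open>One square is at most the whole sum in \<open>boundary\<close>. Pulling out factors with
  this bound estimates the third and fourth power sums.\<close>

lemma eigenvalue_bound: "i < n \<Longrightarrow> \<alpha> * \<bar>l i\<bar> \<le> \<sigma>"
proof -
  assume "i < n"
  then have "(l i)\<^sup>2 \<le> (\<Sum>i<n. (l i)\<^sup>2)" by (intro member_le_sum) auto
  then have "\<alpha>\<^sup>2 * (l i)\<^sup>2 \<le> \<alpha>\<^sup>2 * (\<Sum>i<n. (l i)\<^sup>2)" by (intro mult_left_mono) auto
  then have "\<alpha>\<^sup>2 * (l i)\<^sup>2 \<le> \<sigma>\<^sup>2" by (simp only: s2)
  then have "(\<alpha> * \<bar>l i\<bar>)\<^sup>2 \<le> \<sigma>\<^sup>2" by (simp add: power_mult_distrib)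
  then show ?thesis using sigma_pos by (auto intro: power2_le_imp_le)
qed

lemma slack_pos: "i < n \<Longrightarrow> \<sigma> - \<alpha>\<^sup>2 * l i > 0"
proof -
  assume i: "i < n"
  have "\<alpha>\<^sup>2 * l i \<le> \<alpha> * (\<alpha> * \<bar>l i\<bar>)"
    using alpha by (simp add: power2_eq_square mult.assoc)
  also have "\<dots> \<le> \<alpha> * \<sigma>" using eigenvalue_bound[OF i] alpha by (intro mult_left_mono) auto
  also have "\<dots> < \<sigma>" using alpha sigma_pos by simp
  finally show ?thesis by simp
qed

lemma s3_bound: "\<alpha> ^ 4 * s3 \<le> \<alpha> * \<sigma> ^ 3"
proof -
  have "\<alpha> ^ 3 * s3 = (\<Sum>i<n. (\<alpha> * l i) * (\<alpha>\<^sup>2 * (l i)\<^sup>2))"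
    by (simp add: s3_def sum_distrib_left power2_eq_square power3_eq_cube mult_ac)
  also have "\<dots> \<le> (\<Sum>i<n. \<sigma> * (\<alpha>\<^sup>2 * (l i)\<^sup>2))"
  proof (intro sum_mono mult_right_mono)
    fix i assume "i \<in> {..<n}"
    then have "\<alpha> * \<bar>l i\<bar> \<le> \<sigma>" using eigenvalue_bound by simp
    moreover have "\<alpha> * l i \<le> \<alpha> * \<bar>l i\<bar>" using alpha by (intro mult_left_mono) auto
    ultimately show "\<alpha> * l i \<le> \<sigma>" by linarith
  qed auto
  also have "\<dots> = \<sigma> ^ 3"
    using s2 by (simp add: power2_eq_square power3_eq_cube flip: sum_distrib_left)
  finally have "\<alpha> * (\<alpha> ^ 3 * s3) \<le> \<alpha> * \<sigma> ^ 3" using alpha by (intro mult_left_mono) auto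
  then show ?thesis by (simp add: power3_eq_cube power4_eq_xxxx mult.assoc)
qed

lemma s4_bound: "\<alpha> ^ 4 * s4 \<le> \<sigma> ^ 4"
proof -
  have "\<alpha> ^ 4 * s4 = (\<Sum>i<n. (\<alpha> * \<bar>l i\<bar>)\<^sup>2 * (\<alpha>\<^sup>2 * (l i)\<^sup>2))"
    by (simp add: s4_def sum_distrib_left power2_eq_square power4_eq_xxxx mult_ac)
  also have "\<dots> \<le> (\<Sum>i<n. \<sigma>\<^sup>2 * (\<alpha>\<^sup>2 * (l i)\<^sup>2))"
    using eigenvalue_bound alpha by (intro sum_mono mult_right_mono power_mono) auto
  also have "\<dots> = \<sigma> ^ 4"
    using s2 by (simp add: power2_eq_square power4_eq_xxxx mult.assoc flip: sum_distrib_left)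
  finally show ?thesis .
qed

lemma a2_eq: "a2 = (\<Sum>i<n. (l i)\<^sup>2 * (\<sigma> - \<alpha>\<^sup>2 * l i)\<^sup>2)"
proof -
  have "(l i)\<^sup>2 * (\<sigma> - \<alpha>\<^sup>2 * l i)\<^sup>2 = \<sigma>\<^sup>2 * (l i)\<^sup>2 - 2 * \<alpha>\<^sup>2 * \<sigma> * l i ^ 3 + \<alpha> ^ 4 * l i ^ 4" for i
    by (simp add: power2_eq_square power3_eq_cube power4_eq_xxxx algebra_simps)
  then show ?thesis
    by (simp add: a2_def s3_def s4_def sum.distrib sum_subtractf sum_distrib_left)
qed

lemma a2_pos: "a2 > 0"
proof -
  have "\<exists>i<n. l i \<noteq> 0"
  proof (rule ccontr)
    assume "\<not> ?thesis"
    then have "(\<Sum>i<n. l i) = 0" by (intro sum.neutral) auto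
    then show False using sum_pos by simp
  qed
  then obtain i where i: "i < n" "l i \<noteq> 0" by blast
  have "0 < (l i)\<^sup>2 * (\<sigma> - \<alpha>\<^sup>2 * l i)\<^sup>2" using i slack_pos[OF i(1)] by simp
  then show ?thesis unfolding a2_eq using i by (intro sum_pos2[of _ i]) auto
qed

text \<open>Expanding the squares leaves sums of l^2 in the constant and linear terms;
  \<open>boundary\<close> converts them into powers of \<sigma>, which explains the form of a0 and
  a1.\<close>

lemma q_eq: "q t = (\<Sum>i<n. ((1 + t * l i) * (\<sigma> - \<alpha>\<^sup>2 * l i))\<^sup>2)"
proof -
  have "((1 + t * l i) * (\<sigma> - \<alpha>\<^sup>2 * l i))\<^sup>2
      = (\<sigma>\<^sup>2 - 2 * \<alpha>\<^sup>2 * \<sigma> * l i + \<alpha> ^ 4 * (l i)\<^sup>2)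
        + t * (2 * \<sigma>\<^sup>2 * l i - 4 * \<alpha>\<^sup>2 * \<sigma> * (l i)\<^sup>2 + 2 * \<alpha> ^ 4 * l i ^ 3)
        + t\<^sup>2 * ((l i)\<^sup>2 * (\<sigma> - \<alpha>\<^sup>2 * l i)\<^sup>2)" for i
    by (simp add: power2_eq_square power3_eq_cube power4_eq_xxxx algebra_simps)
  then have "(\<Sum>i<n. ((1 + t * l i) * (\<sigma> - \<alpha>\<^sup>2 * l i))\<^sup>2)
      = (real n * \<sigma>\<^sup>2 - 2 * \<alpha>\<^sup>2 * \<sigma> * \<sigma> + \<alpha> ^ 4 * (\<Sum>i<n. (l i)\<^sup>2))
        + t * (2 * \<sigma>\<^sup>2 * \<sigma> - 4 * \<alpha>\<^sup>2 * \<sigma> * (\<Sum>i<n. (l i)\<^sup>2) + 2 * \<alpha> ^ 4 * s3) + t\<^sup>2 * a2"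
    by (simp add: sum.distrib sum_subtractf sum_distrib_left[symmetric] a2_eq s3_def \<sigma>_def[symmetric])
  also have "\<alpha> ^ 4 * (\<Sum>i<n. (l i)\<^sup>2) = \<alpha>\<^sup>2 * \<sigma>\<^sup>2"
    using s2 by (simp add: power2_eq_square power4_eq_xxxx mult.assoc)
  also have "4 * \<alpha>\<^sup>2 * \<sigma> * (\<Sum>i<n. (l i)\<^sup>2) = 4 * \<sigma> * \<sigma>\<^sup>2"
    unfolding s2[symmetric] by simp
  finally show ?thesis
    by (simp add: q_def a1_def a0_def power2_eq_square power3_eq_cube algebra_simps)
qed

text \<open>After multiplication by \<alpha>^2 the first term of a2 becomes \<sigma>^4, and the
  bound on s4 then gives \<alpha>^2 a2 <= - a1 \<sigma>.\<close>

lemma t0_lower: "\<alpha>\<^sup>2 / (2 * \<sigma>) \<le> t0"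
proof -
  have "\<alpha> ^ 6 * s4 = \<alpha>\<^sup>2 * (\<alpha> ^ 4 * s4)" by (simp add: power_add[symmetric])
  also have "\<dots> \<le> 1 * \<sigma> ^ 4"
    using s4_bound alpha sigma_pos by (intro mult_mono) (auto simp: power_le_one s4_def sum_nonneg)
  finally have s4': "\<alpha> ^ 6 * s4 \<le> \<sigma> ^ 4" by simp
  have "\<alpha>\<^sup>2 * a2 = \<sigma>\<^sup>2 * (\<alpha>\<^sup>2 * (\<Sum>i<n. (l i)\<^sup>2)) - 2 * \<alpha> ^ 4 * \<sigma> * s3 + \<alpha> ^ 6 * s4"
    by (simp add: a2_def algebra_simps power_add[symmetric])
  also have "\<dots> = \<sigma> ^ 4 - 2 * \<alpha> ^ 4 * \<sigma> * s3 + \<alpha> ^ 6 * s4" by (simp add: s2 power_add[symmetric])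
  also have "\<dots> \<le> - a1 * \<sigma>" using s4' by (simp add: a1_def algebra_simps power4_eq_xxxx power3_eq_cube)
  finally show ?thesis using a2_pos sigma_pos by (simp add: t0_def field_simps)
qed

lemma t0_pos: "t0 > 0"
  using t0_lower alpha sigma_pos by (intro order_less_le_trans[OF _ t0_lower]) simp

lemma q_complete_square: "q t = q t0 + a2 * (t - t0)\<^sup>2"
  using a2_pos by (simp add: q_def t0_def field_simps power2_eq_square)

text \<open>The minimum is a0 + a1 t0 / 2. The drop - a1 t0 / 2 is at least (1 - \<alpha>)
  \<sigma>^3, from \<open>s3_bound\<close>, times the lower bound on t0.\<close>

lemma q_minimum: "q t0 \<le> \<sigma>\<^sup>2 * ((real n - \<alpha>\<^sup>2) - \<alpha>\<^sup>2 * (1 - \<alpha>) / 2)"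
proof -
  have "q t0 = a0 + a1 / 2 * t0" using a2_pos by (simp add: q_def t0_def field_simps power2_eq_square)
  moreover have "- a1 / 2 * t0 \<ge> ((1 - \<alpha>) * \<sigma> ^ 3) * (\<alpha>\<^sup>2 / (2 * \<sigma>))"
  proof (rule mult_mono[OF _ t0_lower])
    show a: "(1 - \<alpha>) * \<sigma> ^ 3 \<le> - a1 / 2" using s3_bound by (simp add: a1_def algebra_simps)
    have "0 \<le> (1 - \<alpha>) * \<sigma> ^ 3" using alpha sigma_pos by simp
    then show "0 \<le> - a1 / 2" using a by linarith
  qed (use alpha sigma_pos in auto)
  moreover have "((1 - \<alpha>) * \<sigma> ^ 3) * (\<alpha>\<^sup>2 / (2 * \<sigma>)) = \<sigma>\<^sup>2 * (\<alpha>\<^sup>2 * (1 - \<alpha>) / 2)"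
    using sigma_pos by (simp add: power3_eq_cube power2_eq_square)
  moreover have "\<sigma>\<^sup>2 * ((real n - \<alpha>\<^sup>2) - \<alpha>\<^sup>2 * (1 - \<alpha>) / 2) = a0 - \<sigma>\<^sup>2 * (\<alpha>\<^sup>2 * (1 - \<alpha>) / 2)"
    by (simp add: a0_def algebra_simps)
  ultimately show ?thesis by linarith
qed

lemma q_le_start:
  assumes "0 \<le> t" "t \<le> t0"
  shows "q t \<le> (real n - \<alpha>\<^sup>2) * \<sigma>\<^sup>2"
proof -
  have "(t - t0)\<^sup>2 \<le> (0 - t0)\<^sup>2" using assms by (simp add: abs_le_square_iff[symmetric])
  then have "q t \<le> q 0" unfolding q_complete_square[of t] q_complete_square[of 0] using a2_pos by simp
  then show ?thesis by (simp add: q_def a0_def)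
qed

text \<open>The terms t \<sigma>^2 and t \<alpha>^2 (sum of l^2) cancel by \<open>boundary\<close>,
  so the sum does not depend on t.\<close>

lemma linear_sum: "(\<Sum>i<n. (1 + t * l i) * (\<sigma> - \<alpha>\<^sup>2 * l i)) = (real n - \<alpha>\<^sup>2) * \<sigma>"
proof -
  have "(1 + t * l i) * (\<sigma> - \<alpha>\<^sup>2 * l i) = \<sigma> + (t * \<sigma> - \<alpha>\<^sup>2) * l i - t * (\<alpha>\<^sup>2 * (l i)\<^sup>2)" for i
    by (simp add: algebra_simps power2_eq_square)
  then have "(\<Sum>i<n. (1 + t * l i) * (\<sigma> - \<alpha>\<^sup>2 * l i)) = real n * \<sigma> + (t * \<sigma> - \<alpha>\<^sup>2) * \<sigma> - t * (\<alpha>\<^sup>2 * (\<Sum>i<n. (l i)\<^sup>2))"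
    by (simp add: sum.distrib sum_subtractf sum_distrib_left[symmetric] \<sigma>_def[symmetric])
  also have "\<dots> = real n * \<sigma> + (t * \<sigma> - \<alpha>\<^sup>2) * \<sigma> - t * \<sigma>\<^sup>2" by (simp only: s2)
  finally show ?thesis by (simp add: algebra_simps power2_eq_square)
qed

text \<open>The numbers \<open>(1 + t l\<^sub>i) (\<sigma> - \<alpha>\<^sup>2 l\<^sub>i)\<close> have sum \<open>(n - \<alpha>\<^sup>2) \<sigma>\<close> and square sum at most
  \<open>(n - \<alpha>\<^sup>2) \<sigma>\<^sup>2\<close>. If one of them were not positive, the Cauchy-Schwarz inequality for the other
  \<open>n - 1\<close> would give \<open>n - \<alpha>\<^sup>2 \<le> n - 1\<close>.\<close>

lemma factor_pos:
  assumes t: "0 \<le> t" "t \<le> t0" and j: "j < n"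
  shows "1 + t * l j > 0"
proof (rule ccontr)
  assume neg: "\<not> 1 + t * l j > 0"
  define w where "w i = (1 + t * l i) * (\<sigma> - \<alpha>\<^sup>2 * l i)" for i
  define N where "N = real n - \<alpha>\<^sup>2"
  have a21: "\<alpha>\<^sup>2 < 1" using alpha by (simp add: power_less_one_iff abs_less_iff)
  have n1: "real n \<ge> 1" using n by linarith
  have N: "N > 0" "N > real n - 1" using a21 n1 by (auto simp: N_def)
  have "w j \<le> 0" using neg slack_pos[OF j] by (simp add: w_def mult_nonpos_nonneg)
  moreover have "(\<Sum>i<n. w i) = N * \<sigma>" using linear_sum[of t] by (simp add: w_def N_def)
  moreover have "(\<Sum>i<n. w i) = w j + (\<Sum>i\<in>{..<n} - {j}. w i)" using j by (intro sum.remove) auto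
  ultimately have ge: "(\<Sum>i\<in>{..<n} - {j}. w i) \<ge> N * \<sigma>" by linarith
  have "(N * \<sigma>)\<^sup>2 \<le> (\<Sum>i\<in>{..<n} - {j}. w i)\<^sup>2" using ge N sigma_pos by (intro power_mono) auto
  also have "\<dots> = (\<Sum>i\<in>{..<n} - {j}. 1 * w i)\<^sup>2" by simp
  also have "\<dots> \<le> (\<Sum>i\<in>{..<n} - {j}. 1\<^sup>2) * (\<Sum>i\<in>{..<n} - {j}. (w i)\<^sup>2)" by (rule Cauchy_Schwarz_ineq_sum)
  also have "(\<Sum>i\<in>{..<n} - {j}. 1\<^sup>2) = real n - 1" using j n by (simp add: of_nat_diff)
  also have "(real n - 1) * (\<Sum>i\<in>{..<n} - {j}. (w i)\<^sup>2) \<le> (real n - 1) * (\<Sum>i<n. (w i)\<^sup>2)"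
    using n1 by (intro mult_left_mono sum_mono2) auto
  also have "(\<Sum>i<n. (w i)\<^sup>2) = q t" by (simp add: q_eq w_def)
  also have "(real n - 1) * q t \<le> (real n - 1) * (N * \<sigma>\<^sup>2)"
    using q_le_start[OF t] n1 by (intro mult_left_mono) (auto simp: N_def)
  finally have "N * (N * \<sigma>\<^sup>2) \<le> (real n - 1) * (N * \<sigma>\<^sup>2)" by (simp add: power2_eq_square mult_ac)
  moreover have "N * \<sigma>\<^sup>2 > 0" using N sigma_pos by simp
  ultimately have "N \<le> real n - 1" by (simp only: mult_le_cancel_right_pos)
  then show False using N by simp
qed

end

section \<open>The affine-scaling step\<close>

locale hyperbolic_program = hyperbolic_cone p n F d
  for p :: "'a::euclidean_space \<Rightarrow> real" and n :: nat and F :: "'a \<times> 'a \<Rightarrow> complex" and d :: 'a +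
  fixes A :: "'a \<Rightarrow> 'b::euclidean_space" and b :: 'b and c :: 'a and \<alpha> :: real
  assumes linA: "linear A" and b_nz: "b \<noteq> 0" and c_notin: "c \<notin> range (adjoint A)"
    and alpha: "0 < \<alpha>" "\<alpha> < 1"
begin

abbreviation "xo e \<equiv> x_opt p A b c e \<alpha>"

lemma alpha_sq_less: "\<alpha>\<^sup>2 < real n"
proof -
  have "\<alpha>\<^sup>2 < 1" using alpha by (simp add: power_less_one_iff abs_less_iff)
  then show ?thesis using degree_positive by linarith
qed

lemma inner_form_at:
  assumes e: "e \<in> hcone p d"
  shows "inner_form (local_inner p e)"
  by (rule inner_form.intro)
    (rule local_inner_linear_right[OF e] local_inner_sym[OF e] local_inner_positive[OF e], assumption?)+

lemma quadratic_cone_program_at: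
  assumes e: "e \<in> hcone p d" and Ae: "A e = b"
  shows "quadratic_cone_program (local_inner p e) A b c e \<alpha>"
proof -
  note inner_form_at[OF e]
  moreover have "\<alpha>\<^sup>2 < local_inner p e e e" by (simp add: local_inner_self[OF e] alpha_sq_less)
  ultimately show ?thesis
    unfolding quadratic_cone_program_def quadratic_cone_program_axioms_def
    using linA b_nz c_notin alpha Ae by blast
qed

lemma cone_eq_Kcone:
  assumes "quadratic_cone_program (local_inner p e) A b c e \<alpha>"
  shows "quadratic_cone_program.cone (local_inner p e) e \<alpha> = Kcone p e \<alpha>"
    and "quadratic_cone_program.optimal (local_inner p e) A b c e \<alpha> x \<longleftrightarrow> qp_optimal p A b c e \<alpha> x"
    and "inner_form.nrm (local_inner p e) v = local_norm p e v"
proof -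
  interpret Q: quadratic_cone_program "local_inner p e" A b c e \<alpha> by fact
  show nrm: "Q.nrm v = local_norm p e v" for v by (simp add: Q.nrm_def local_norm_def)
  show cone: "Q.cone = Kcone p e \<alpha>" by (simp add: Q.cone_def Kcone_def nrm)
  show "Q.optimal x \<longleftrightarrow> qp_optimal p A b c e \<alpha> x"
    by (auto simp: Q.optimal_def cone qp_optimal_def qp_feasible_def)
qed

lemma swath_optimal:
  assumes "e \<in> swath p d A b c \<alpha>"
  shows "e \<in> hcone p d" "A e = b" "qp_optimal p A b c e \<alpha> (xo e)"
proof -
  show e: "e \<in> hcone p d" "A e = b" using assms by (auto simp: swath_def)
  interpret Q: quadratic_cone_program "local_inner p e" A b c e \<alpha> by (rule quadratic_cone_program_at[OF e])
  note eq = cone_eq_Kcone[OF Q.quadratic_cone_program_axioms]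
  obtain x where x: "qp_optimal p A b c e \<alpha> x" using assms by (auto simp: swath_def)
  have "xo e = x" unfolding x_opt_def
    using x Q.optimal_unique[unfolded eq(2)] by (intro the_equality) auto
  then show "qp_optimal p A b c e \<alpha> (xo e)" using x by simp
qed

text \<open>\<open>y_opt\<close> is an arbitrary choice among dual optima, so only its value is
  determined. The multiplier is dual feasible and its slack vanishes at x, hence there is no duality
  gap.\<close>

lemma dual_optimal_value:
  assumes "e \<in> swath p d A b c \<alpha>"
  shows "inner b (y_opt p A b c e \<alpha>) = inner c (xo e)"
proof -
  note sw = swath_optimal[OF assms]
  interpret Q: quadratic_cone_program "local_inner p e" A b c e \<alpha> by (rule quadratic_cone_program_at[OF sw(1,2)])
  note eq = cone_eq_Kcone[OF Q.quadratic_cone_program_axioms]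
  have x: "Q.optimal (xo e)" using sw(3) eq(2) by simp
  then have Ax: "A (xo e) = b" "xo e \<in> Q.cone" by (auto simp: Q.optimal_def)
  obtain \<theta> y where \<theta>: "\<theta> > 0" and
    y: "\<And>u. inner (c - adjoint A y) u = \<theta> * (local_inner p e e (xo e) * local_inner p e e u - \<alpha>\<^sup>2 * local_inner p e (xo e) u)"
    using Q.optimal_multiplier[OF x] by blast
  have val: "inner c (xo e) = inner b y' + inner s' (xo e)" if "adjoint A y' + s' = c" for y' s'
    using Ax(1) that[symmetric] by (simp add: inner_add_left adjoint_clauses(2)[OF linA] inner_commute[of y' b])
  have weak: "inner b y' \<le> inner c (xo e)" if "dual_feasible p A c e \<alpha> y' s'" for y' s'
  proof -
    have "inner (xo e) s' \<ge> 0" using that Ax(2) eq(1) by (auto simp: dual_feasible_def dual_cone_def)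
    then show ?thesis using val[of y' s'] that by (simp add: dual_feasible_def inner_commute)
  qed
  have feas: "dual_feasible p A c e \<alpha> y (c - adjoint A y)"
    unfolding dual_feasible_def dual_cone_def
  proof (intro conjI CollectI ballI)
    fix u assume "u \<in> Kcone p e \<alpha>"
    then show "inner u (c - adjoint A y) \<ge> 0"
      using Q.multiplier_dual_feasible[OF x, of u] \<theta> eq(1) y[of u] by (simp add: inner_commute)
  qed simp
  have "inner (c - adjoint A y) (xo e) = 0"
    unfolding y using Q.optimal_pos(3)[OF x] by (simp add: power2_eq_square)
  then have by_val: "inner b y = inner c (xo e)" using val[of y "c - adjoint A y"] by simp
  then have "dual_optimal p A b c e \<alpha> y (c - adjoint A y)"
    unfolding dual_optimal_def using feas weak by auto
  then have "case ys_opt p A b c e \<alpha> of (y, s) \<Rightarrow> dual_optimal p A b c e \<alpha> y s"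
    unfolding ys_opt_def by (intro someI[of "\<lambda>(y, s). dual_optimal p A b c e \<alpha> y s" "(y, c - adjoint A y)"]) simp
  then obtain s where "dual_optimal p A b c e \<alpha> (y_opt p A b c e \<alpha>) s"
    unfolding y_opt_def by (cases "ys_opt p A b c e \<alpha>") auto
  then have "inner b y \<le> inner b (y_opt p A b c e \<alpha>)" "inner b (y_opt p A b c e \<alpha>) \<le> inner c (xo e)"
    using feas weak unfolding dual_optimal_def by blast+
  then show ?thesis using by_val by simp
qed

lemma root_labelling_of_real_factorisation:
  assumes fac: "\<And>z. p (z *\<^sub>R E - x) = p E * (\<Prod>i<n. z - m i)"
  shows "root_labelling E (- x, 0) (\<lambda>i. of_real (m i))"
proof -
  obtain q where q: "\<forall>z. F ((- x, 0) + cscale z (E, 0)) = poly q z"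
    using complexifies_univariate[OF cpx] by blast
  have "q = smult (of_real (p E)) (\<Prod>i<n. [:- of_real (m i), 1:])"
  proof (rule poly_eqI_of_real)
    fix t :: real
    have "poly q (of_real t) = of_real (p (t *\<^sub>R E - x))"
      by (simp add: q[rule_format, symmetric])
    then show "poly q (of_real t) = poly (smult (of_real (p E)) (\<Prod>i<n. [:- of_real (m i), 1:])) (of_real t)"
      by (simp add: fac poly_prod)
  qed
  then have "poly q z = of_real (p E) * (\<Prod>i<n. z - of_real (m i))" for z by (simp add: poly_prod)
  then show ?thesis unfolding root_labelling_def using q by (simp add: add.commute)
qed

lemma boundary_spectrum_at:
  assumes sw: "e \<in> swath p d A b c \<alpha>"
    and l: "root_labelling e (- xo e, 0) (\<lambda>i. of_real (l i))"
  shows "boundary_spectrum l n \<alpha>" "boundary_spectrum.\<sigma> l n = local_inner p e e (xo e)"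
proof -
  note sw = swath_optimal[OF sw]
  interpret Q: quadratic_cone_program "local_inner p e" A b c e \<alpha> by (rule quadratic_cone_program_at[OF sw(1,2)])
  note eq = cone_eq_Kcone[OF Q.quadratic_cone_program_axioms]
  have x: "Q.optimal (xo e)" using sw(3) eq(2) by simp
  note eig = local_inner_eigenvalues[OF sw(1) l]
  show bs: "boundary_spectrum l n \<alpha>"
    by unfold_locales (use alpha degree_positive Q.optimal_pos[OF x] eig in auto)
  show "boundary_spectrum.\<sigma> l n = local_inner p e e (xo e)"
    by (simp add: boundary_spectrum.\<sigma>_def[OF bs] eig)
qed

lemma t_step_quadratic:
  assumes sw: "e \<in> swath p d A b c \<alpha>"
    and l: "root_labelling e (- xo e, 0) (\<lambda>i. of_real (l i))"
  shows "qtilde p n A b c e \<alpha> = boundary_spectrum.q l n \<alpha>"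
    and "t_step p n A b c e \<alpha> = boundary_spectrum.t0 l n \<alpha>"
proof -
  interpret S: boundary_spectrum l n \<alpha> by (rule boundary_spectrum_at[OF sw l])
  have m: "\<Sum>\<^sub># (image_mset f (image_mset l (mset_set {..<n}))) = (\<Sum>i<n. f (l i))" for f :: "real \<Rightarrow> real"
    by (simp add: image_mset.compositionality o_def sum_unfold_sum_mset)
  show q: "qtilde p n A b c e \<alpha> = S.q"
    unfolding qtilde_def qcoeffs_def real_root_labelling_eigenvalues[OF swath_optimal(1)[OF sw] l] m Let_def
    by (rule ext) (simp add: S.q_def S.a2_def S.a1_def S.a0_def S.s3_def S.s4_def S.\<sigma>_def)
  show "t_step p n A b c e \<alpha> = S.t0"
    unfolding t_step_def q
  proof (rule the_equality)
    show "\<forall>s. S.q S.t0 \<le> S.q s"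
    proof
      fix s show "S.q S.t0 \<le> S.q s" using S.q_complete_square[of s] S.a2_pos by simp
    qed
    fix t assume "\<forall>s. S.q t \<le> S.q s"
    then have "S.q t \<le> S.q S.t0" by blast
    then have "S.a2 * (t - S.t0)\<^sup>2 \<le> 0" unfolding S.q_complete_square[of t] by simp
    then have "(t - S.t0)\<^sup>2 \<le> 0" using S.a2_pos by (simp add: mult_le_0_iff)
    then show "t = S.t0" by simp
  qed
qed

lemma qtilde_strictly_convex:
  assumes sw: "e \<in> swath p d A b c \<alpha>"
  shows "strictly_convex_on UNIV (qtilde p n A b c e \<alpha>)"
proof -
  obtain l where l: "root_labelling e (- xo e, 0) (\<lambda>i. of_real (l i))"
    using real_root_labelling[OF swath_optimal(1)[OF sw]] by blast
  interpret S: boundary_spectrum l n \<alpha> by (rule boundary_spectrum_at[OF sw l])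
  show ?thesis
    unfolding strictly_convex_on_def t_step_quadratic(1)[OF sw l]
  proof (intro ballI allI impI)
    fix x y u :: real assume xy: "x \<noteq> y" and u: "0 < u \<and> u < 1"
    have "(1 - u) * S.q x + u * S.q y - S.q ((1 - u) * x + u * y) = S.a2 * (u * (1 - u) * (x - y)\<^sup>2)"
      by (simp add: S.q_def power2_eq_square algebra_simps)
    moreover have "S.a2 * (u * (1 - u) * (x - y)\<^sup>2) > 0" using S.a2_pos u xy by simp
    ultimately show "S.q ((1 - u) * x + u * y) < (1 - u) * S.q x + u * S.q y" by linarith
  qed
qed

end

section \<open>The slack bound, one step and two consecutive steps\<close>

context hyperbolic_program
begin

text \<open>With \<open>\<sigma> = \<langle>e, x\<rangle>\<^sub>e\<close> and \<open>x = x\<^sub>e(\<alpha>)\<close>, the functional bounded below is the multiple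
  \<open>s\<^sub>e / \<theta>\<close> of the optimal dual slack. At a point \<open>u\<close> of the cone, subtract the
  multiple of \<open>e + t x\<close> that is tangent to the dual cone.\<close>

lemma slack_lower_bound:
  assumes sw: "e \<in> swath p d A b c \<alpha>"
  defines "t \<equiv> t_step p n A b c e \<alpha>" and "x \<equiv> xo e" and "\<sigma> \<equiv> local_inner p e e (xo e)"
  shows "t \<ge> \<alpha>\<^sup>2 / (2 * \<sigma>)" "\<sigma> > 0" "e + t *\<^sub>R x \<in> hcone p d"
    "\<And>u. u \<in> Kcone p (e + t *\<^sub>R x) \<alpha> \<Longrightarrow>
       \<sigma> * local_inner p e e u - \<alpha>\<^sup>2 * local_inner p e x u
         \<ge> \<sigma> * (\<alpha> * (1 - \<alpha>) / 4) * local_norm p (e + t *\<^sub>R x) u"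
proof -
  have e: "e \<in> hcone p d" by (rule swath_optimal(1)[OF sw])
  obtain l where l: "root_labelling e (- x, 0) (\<lambda>i. of_real (l i))"
    unfolding x_def using real_root_labelling[OF e] by blast
  note l' = l[unfolded x_def]
  interpret S: boundary_spectrum l n \<alpha> by (rule boundary_spectrum_at(1)[OF sw l'])
  have \<sigma>: "S.\<sigma> = \<sigma>" unfolding \<sigma>_def by (rule boundary_spectrum_at(2)[OF sw l'])
  have t: "t = S.t0" unfolding t_def by (rule t_step_quadratic(2)[OF sw l'])
  show "t \<ge> \<alpha>\<^sup>2 / (2 * \<sigma>)" "\<sigma> > 0" using S.t0_lower S.sigma_pos by (simp_all add: t \<sigma>)
  note \<sigma>_pos = \<open>\<sigma> > 0\<close>
  have t_pos: "t > 0" using S.t0_pos by (simp add: t)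
  define E where "E = e + t *\<^sub>R x"
  note fac = real_root_labelling_factor[OF l]
  have pe: "p e > 0" by (rule hcone_positive[OF e])
  have fpos: "1 + s * l i > 0" if "0 \<le> s" "s \<le> t" "i < n" for s i using S.factor_pos that by (simp add: t)
  have E: "E \<in> hcone p d"
    unfolding E_def
  proof (rule hcone_segment[OF e])
    fix \<tau> :: real assume \<tau>: "0 \<le> \<tau>" "\<tau> \<le> 1"
    have st: "0 \<le> \<tau> * t" "\<tau> * t \<le> t" using \<tau> t_pos by (auto simp: mult_left_le_one_le)
    have "0 < (\<Prod>i<n. 1 + (\<tau> * t) * l i)" by (intro prod_pos) (use fpos[OF st] in auto)
    from mult_pos_pos[OF pe this] have "0 < p (1 *\<^sub>R e + (\<tau> * t) *\<^sub>R x)" by (simp only: fac)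
    then show "p (e + \<tau> *\<^sub>R t *\<^sub>R x) \<noteq> 0" by simp
  qed
  then show "e + t *\<^sub>R x \<in> hcone p d" by (simp add: E_def)
  have f: "1 + t * l i > 0" if "i < n" for i using fpos that t_pos by simp
  \<comment> \<open>The eigenvalues of e in the direction E = e + t x.\<close>
  define m where "m i = 1 / (1 + t * l i)" for i
  have pE: "p E = p e * (\<Prod>i<n. 1 + t * l i)" using fac[of 1 t] by (simp add: E_def)
  have lab: "root_labelling E (- e, 0) (\<lambda>i. of_real (m i))"
  proof (rule root_labelling_of_real_factorisation)
    fix z
    have "z *\<^sub>R E - e = (z - 1) *\<^sub>R e + (z * t) *\<^sub>R x" by (simp add: E_def algebra_simps)
    then have "p (z *\<^sub>R E - e) = p e * (\<Prod>i<n. z - 1 + z * t * l i)" by (simp add: fac)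
    also have "(\<Prod>i<n. z - 1 + z * t * l i) = (\<Prod>i<n. (1 + t * l i) * (z - m i))"
    proof (intro prod.cong refl)
      fix i assume "i \<in> {..<n}"
      then have "1 + t * l i \<noteq> 0" using f[of i] by simp
      then show "z - 1 + z * t * l i = (1 + t * l i) * (z - m i)"
        by (simp add: m_def right_diff_distrib) (simp add: algebra_simps)
    qed
    finally show "p (z *\<^sub>R E - e) = p E * (\<Prod>i<n. z - m i)" by (simp add: pE prod.distrib)
  qed
  interpret e: inner_form "local_inner p e" by (rule inner_form_at[OF e])
  interpret E: inner_form "local_inner p E" by (rule inner_form_at[OF E])
  define ell where "ell u = \<sigma> * local_inner p e e u - \<alpha>\<^sup>2 * local_inner p e x u" for u
  have ell_lin: "ell (u - r *\<^sub>R v) = ell u - r * ell v" for u v r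
    by (simp add: ell_def e.bilin algebra_simps)
  define Q where "Q = S.q t"
  have ell_bound: "(ell u)\<^sup>2 \<le> Q * local_inner p E u u" for u
  proof -
    \<comment> \<open>Substituting x = (E - e) / t writes \<open>ell\<close> in terms of <e, .>_e
      and <E, .>_e; with the eigenvalues m the spectral bound then has exactly the factor q
      t.\<close>
    define a c' where "a = \<sigma> + \<alpha>\<^sup>2 / t" and "c' = - \<alpha>\<^sup>2 / t"
    have "local_inner p e E u = local_inner p e e u + t * local_inner p e x u"
      by (simp add: E_def e.bilin)
    then have "ell u = a * local_inner p e e u + c' * local_inner p e E u"
      using t_pos by (simp add: ell_def a_def c'_def field_simps)
    also have "(a * local_inner p e e u + c' * local_inner p e E u)\<^sup>2
        \<le> (\<Sum>i<n. (a / m i + c' / (m i)\<^sup>2)\<^sup>2) * local_inner p E u u"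
      by (rule local_inner_spectral_bound[OF E e lab]) (use f in \<open>simp add: m_def\<close>)
    also have "(\<Sum>i<n. (a / m i + c' / (m i)\<^sup>2)\<^sup>2) = Q"
      unfolding Q_def S.q_eq
    proof (intro sum.cong refl arg_cong[where f = "\<lambda>z. z\<^sup>2"])
      fix i assume "i \<in> {..<n}"
      have "a / m i + c' / (m i)\<^sup>2 = (1 + t * l i) * (a + c' * (1 + t * l i))"
        by (simp add: m_def power2_eq_square algebra_simps)
      also have "a + c' * (1 + t * l i) = \<sigma> - \<alpha>\<^sup>2 * l i"
        using t_pos by (simp add: a_def c'_def field_simps)
      finally show "a / m i + c' / (m i)\<^sup>2 = (1 + t * l i) * (S.\<sigma> - \<alpha>\<^sup>2 * l i)" by (simp add: \<sigma>)
    qed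
    finally show ?thesis .
  qed
  define N where "N = real n - \<alpha>\<^sup>2"
  have N: "N > 0" using alpha_sq_less by (simp add: N_def)
  have eig: "local_inner p e e x = \<sigma>" "\<alpha>\<^sup>2 * local_inner p e x x = \<sigma>\<^sup>2"
    using S.s2 local_inner_eigenvalues[OF e l] by (simp_all add: \<sigma>_def x_def \<sigma>)
  have ellE: "ell E = N * \<sigma>"
  proof -
    have "ell E = \<sigma> * (local_inner p e e e + t * local_inner p e e x)
        - (\<alpha>\<^sup>2 * local_inner p e x e + t * (\<alpha>\<^sup>2 * local_inner p e x x))"
      by (simp add: ell_def E_def e.bilin algebra_simps)
    also have "\<dots> = \<sigma> * (real n + t * \<sigma>) - (\<alpha>\<^sup>2 * \<sigma> + t * \<sigma>\<^sup>2)"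
      by (simp only: eig local_inner_self[OF e] local_inner_sym[OF e, of x e])
    finally show ?thesis by (simp add: N_def algebra_simps power2_eq_square)
  qed
  \<comment> \<open>The guaranteed drop of the quadratic from its value N \<sigma>^2 at 0, in units
    of \<sigma>^2.\<close>
  define \<delta> where "\<delta> = \<alpha>\<^sup>2 * (1 - \<alpha>) / 2"
  have Q: "Q \<le> \<sigma>\<^sup>2 * (N - \<delta>)" using S.q_minimum by (simp add: Q_def t \<sigma> N_def \<delta>_def)
  have \<delta>: "\<delta> > 0" "\<delta> \<le> 2 * N"
  proof -
    show "\<delta> > 0" using alpha by (simp add: \<delta>_def)
    have a1: "\<alpha>\<^sup>2 \<le> \<alpha>" using alpha by (simp add: power2_eq_square mult_left_le_one_le)
    then have "\<alpha>\<^sup>2 * (1 - \<alpha>) \<le> 1 * (1 - \<alpha>)" using alpha by (intro mult_right_mono) auto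
    also have "\<dots> \<le> N" using a1 degree_positive by (simp add: N_def)
    finally have "\<alpha>\<^sup>2 * (1 - \<alpha>) \<le> N" .
    then have "\<delta> \<le> N / 2" unfolding \<delta>_def by (rule divide_right_mono) simp
    then show "\<delta> \<le> 2 * N" using N by linarith
  qed
  show "\<sigma> * (\<alpha> * (1 - \<alpha>) / 4) * local_norm p (e + t *\<^sub>R x) u
      \<le> \<sigma> * local_inner p e e u - \<alpha>\<^sup>2 * local_inner p e x u" if u: "u \<in> Kcone p (e + t *\<^sub>R x) \<alpha>" for u
  proof -
    define k where "k = local_norm p E u"
    have k: "k \<ge> 0" "k\<^sup>2 = local_inner p E u u" using E.nonneg by (simp_all add: k_def local_norm_def)
    have Eu: "local_inner p E E u \<ge> \<alpha> * k" using u by (simp add: Kcone_def k_def E_def)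
    \<comment> \<open>This coefficient gives <w, w>_E <= (k / \<alpha>)^2 N. With \<delta> = 0 the
      resulting lower bound on \<open>ell u\<close> would be 0, so the whole margin comes from
      \<delta>, through (N - \<delta>) N <= (N - \<delta> / 2)^2.\<close>
    define w where "w = u - (k / \<alpha>) *\<^sub>R E"
    have "local_inner p E w w = k\<^sup>2 - 2 * (k / \<alpha>) * local_inner p E E u + (k / \<alpha>)\<^sup>2 * real n"
      unfolding k(2) using local_inner_self[OF E] E.sym[of u E]
      by (simp add: w_def E.bilin power2_eq_square algebra_simps)
    also have "\<dots> \<le> k\<^sup>2 - 2 * (k / \<alpha>) * (\<alpha> * k) + (k / \<alpha>)\<^sup>2 * real n"
      using Eu k alpha by (intro add_right_mono diff_left_mono mult_left_mono) auto
    also have "\<dots> = (k / \<alpha>)\<^sup>2 * N" using alpha by (simp add: N_def field_simps power2_eq_square)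
    finally have ww: "local_inner p E w w \<le> (k / \<alpha>)\<^sup>2 * N" .
    have "(ell w)\<^sup>2 \<le> Q * local_inner p E w w" by (rule ell_bound)
    also have "\<dots> \<le> (\<sigma>\<^sup>2 * (N - \<delta>)) * local_inner p E w w" using Q E.nonneg by (intro mult_right_mono)
    also have "\<dots> \<le> (\<sigma>\<^sup>2 * (N - \<delta>)) * ((k / \<alpha>)\<^sup>2 * N)"
    proof (intro mult_left_mono ww)
      have "Q \<ge> 0" unfolding Q_def S.q_eq by (intro sum_nonneg) auto
      then show "0 \<le> \<sigma>\<^sup>2 * (N - \<delta>)" using Q by linarith
    qed
    also have "\<dots> \<le> (\<sigma> * (k / \<alpha>) * (N - \<delta> / 2))\<^sup>2"
    proof -
      have "(N - \<delta>) * N \<le> (N - \<delta> / 2)\<^sup>2" by (simp add: power2_eq_square algebra_simps)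
      then have "(\<sigma> * (k / \<alpha>))\<^sup>2 * ((N - \<delta>) * N) \<le> (\<sigma> * (k / \<alpha>))\<^sup>2 * (N - \<delta> / 2)\<^sup>2"
        by (intro mult_left_mono) auto
      then show ?thesis by (simp only: power_mult_distrib mult_ac)
    qed
    finally have "\<bar>ell w\<bar> \<le> \<sigma> * (k / \<alpha>) * (N - \<delta> / 2)"
      using \<delta> k \<sigma>_pos alpha by (intro power2_le_imp_le[of "\<bar>ell w\<bar>"]) auto
    then have w_lower: "- (\<sigma> * (k / \<alpha>) * (N - \<delta> / 2)) \<le> ell w" by linarith
    have "\<sigma> * (\<alpha> * (1 - \<alpha>) / 4) * k = \<sigma> * (k / \<alpha>) * (\<delta> / 2)"
      using alpha by (simp add: \<delta>_def power2_eq_square)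
    also have "\<dots> = - (\<sigma> * (k / \<alpha>) * (N - \<delta> / 2)) + (k / \<alpha>) * (N * \<sigma>)"
      by (simp add: algebra_simps)
    also have "\<dots> \<le> ell w + (k / \<alpha>) * (N * \<sigma>)" by (rule add_right_mono[OF w_lower])
    also have "\<dots> = ell u" by (simp add: w_def ell_lin ellE)
    finally show ?thesis by (simp add: ell_def k_def E_def)
  qed
qed

text \<open>The gap at e is \<theta> N \<sigma>, the value of the old slack at e. Moving to e'
  contracts the primal part by 1 / (1 + t); the dual part gains the value of the old slack at the
  new optimum, which the slack bound estimates by its local norm.\<close>

lemma affine_scaling_step:
  assumes sw: "e \<in> swath p d A b c \<alpha>"
  defines "e' \<equiv> next_point p n A b c \<alpha> e" and "t \<equiv> t_step p n A b c e \<alpha>"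
  shows "e' \<in> swath p d A b c \<alpha>" "inner c e' < inner c e"
    "inner b (y_opt p A b c e \<alpha>) \<le> inner b (y_opt p A b c e' \<alpha>)"
    "gap p A b c e \<alpha> > 0" "local_norm p e (xo e) > 0" "t \<ge> \<alpha> / (2 * local_norm p e (xo e))"
    "gap p A b c e' \<alpha> \<le> gap p A b c e \<alpha> / (1 + t) *
       (1 - \<alpha> * (1 - \<alpha>) / (4 * (real n - \<alpha>\<^sup>2)) * local_norm p e' (xo e'))"
proof -
  note swe = swath_optimal[OF sw]
  interpret Q: quadratic_cone_program "local_inner p e" A b c e \<alpha> by (rule quadratic_cone_program_at[OF swe(1,2)])
  note eq = cone_eq_Kcone[OF Q.quadratic_cone_program_axioms]
  define x where "x = xo e"
  define \<sigma> where "\<sigma> = local_inner p e e x"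
  define E where "E = e + t *\<^sub>R x"
  define N where "N = real n - \<alpha>\<^sup>2"
  define \<beta> where "\<beta> = \<alpha> * (1 - \<alpha>) / 4"
  have \<beta>: "\<beta> > 0" using alpha by (simp add: \<beta>_def)
  have N: "N > 0" using alpha_sq_less by (simp add: N_def)
  have xopt: "Q.optimal x" using swe(3) eq(2) by (simp add: x_def)
  have Ax: "A x = b" using xopt by (simp add: Q.optimal_def)
  note slack = slack_lower_bound[OF sw, folded t_def x_def, folded \<sigma>_def E_def \<beta>_def]
  show nx: "local_norm p e (xo e) > 0" using Q.optimal_pos(1)[OF xopt] eq(3) by (simp add: x_def)
  have "\<sigma> = \<alpha> * local_norm p e x" using Q.optimal_boundary[OF xopt] eq(3) by (simp add: \<sigma>_def)
  then have "\<alpha>\<^sup>2 / (2 * \<sigma>) = \<alpha> / (2 * local_norm p e (xo e))"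
    using alpha nx by (simp add: x_def power2_eq_square)
  then show "t \<ge> \<alpha> / (2 * local_norm p e (xo e))" using slack(1) by simp
  have t: "t > 0"
    using alpha slack(2) by (intro order_less_le_trans[OF _ slack(1)]) simp
  \<comment> \<open>Since A E = (1 + t) b, the factor r restores feasibility. It leaves the cone
    unchanged and divides local norms by r.\<close>
  define r where "r = 1 / (1 + t)"
  have r: "r > 0" using t by (simp add: r_def)
  have e'_eq: "e' = r *\<^sub>R E"
    by (simp add: e'_def next_point_def Let_def r_def E_def t_def x_def)
  have e': "e' \<in> hcone p d" unfolding e'_eq by (rule hcone_scale[OF slack(3) r])
  have Ae': "A e' = b"
  proof -
    have "A e' = r *\<^sub>R ((1 + t) *\<^sub>R b)"
      using linA swe(2) Ax by (simp add: e'_eq E_def linear_add linear_scale scaleR_add_left)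
    then show ?thesis using t by (simp add: r_def)
  qed
  interpret Q': quadratic_cone_program "local_inner p e'" A b c e' \<alpha> by (rule quadratic_cone_program_at[OF e' Ae'])
  note eq' = cone_eq_Kcone[OF Q'.quadratic_cone_program_axioms]
  have norm': "local_norm p e' u = local_norm p E u / r" for u
    using r by (simp add: local_norm_def e'_eq local_inner_scale(1)[OF slack(3) r] real_sqrt_divide)
  have "local_inner p e' e' u = local_inner p E E u / r" for u
    by (simp add: e'_eq local_inner_scale(2)[OF slack(3) r])
  then have cone': "u \<in> Kcone p e' \<alpha> \<longleftrightarrow> u \<in> Kcone p E \<alpha>" for u
    using r by (simp add: Kcone_def norm' field_simps)
  obtain \<theta> y where \<theta>: "\<theta> > 0" and
    y: "\<And>u. inner (c - adjoint A y) u = \<theta> * (\<sigma> * local_inner p e e u - \<alpha>\<^sup>2 * local_inner p e x u)"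
    using Q.optimal_multiplier[OF xopt] unfolding \<sigma>_def by blast
  have y_lower: "inner (c - adjoint A y) u \<ge> \<theta> * \<sigma> * \<beta> * r * local_norm p e' u" if "u \<in> Kcone p e' \<alpha>" for u
  proof -
    have "\<theta> * (\<sigma> * \<beta> * local_norm p E u) \<le> inner (c - adjoint A y) u"
      unfolding y using \<theta> slack(4)[of u] that cone' by (intro mult_left_mono) auto
    then show ?thesis using r by (simp add: norm')
  qed
  have "e' \<in> Q'.cone"
  proof -
    have "\<alpha> * sqrt (real n) \<le> 1 * sqrt (real n)" using alpha by (intro mult_right_mono) auto
    also have "\<dots> \<le> real n" using degree_positive by (simp add: real_sqrt_le_iff real_le_lsqrt power2_eq_square)
    finally show ?thesis unfolding eq'(1) by (simp add: Kcone_def local_norm_def local_inner_self[OF e'])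
  qed
  moreover have "\<theta> * \<sigma> * \<beta> * r > 0" using \<theta> slack(2) \<beta> r by simp
  ultimately have "\<exists>x. Q'.optimal x"
    using y_lower by (intro Q'.optimal_exists) (auto simp: eq')
  then show sw': "e' \<in> swath p d A b c \<alpha>"
    using e' Ae' eq'(2) by (auto simp: swath_def)
  note swe' = swath_optimal[OF sw']
  have diff: "inner c u - inner c v = inner (c - adjoint A y) u - inner (c - adjoint A y) v" if "A u = A v" for u v
    using that by (simp add: inner_diff_left adjoint_clauses(2)[OF linA])
  have y_x: "inner (c - adjoint A y) x = 0"
    unfolding y using Q.optimal_pos(3)[OF xopt] by (simp add: \<sigma>_def power2_eq_square)
  have y_e: "inner (c - adjoint A y) e = \<theta> * (N * \<sigma>)"
    unfolding y by (simp add: local_inner_self[OF swe(1)] local_inner_sym[OF swe(1), of x e] N_def algebra_simps flip: \<sigma>_def)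
  have gap_eq: "gap p A b c f \<alpha> = inner c f - inner c (xo f)" if "f \<in> swath p d A b c \<alpha>" for f
    using dual_optimal_value[OF that] by (simp add: gap_def)
  have gap_e: "gap p A b c e \<alpha> = \<theta> * (N * \<sigma>)"
    using diff[of e x] Ax swe(2) y_x y_e gap_eq[OF sw] by (simp add: x_def)
  then show gap_pos: "gap p A b c e \<alpha> > 0" using \<theta> N slack(2) by simp
  \<comment> \<open>Here e' - x = r (e - x).\<close>
  have ce': "inner c e' - inner c x = gap p A b c e \<alpha> * r"
  proof -
    have "inner c e' - inner c x = r * (inner c e + t * inner c x) - r * (1 + t) * inner c x"
      using t by (simp add: e'_eq E_def inner_add_right r_def)
    also have "\<dots> = (inner c e - inner c x) * r" by (simp add: algebra_simps)
    finally show ?thesis using gap_eq[OF sw] by (simp add: x_def)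
  qed
  have "gap p A b c e \<alpha> * r < gap p A b c e \<alpha> * 1"
    using gap_pos t by (intro mult_strict_left_mono) (auto simp: r_def)
  then show "inner c e' < inner c e" using ce' gap_eq[OF sw] by (simp add: x_def)
  define x' where "x' = xo e'"
  have x': "A x' = b" "x' \<in> Kcone p e' \<alpha>"
    using swe'(3) by (auto simp: x'_def qp_optimal_def qp_feasible_def)
  have gain: "inner c x' - inner c x \<ge> \<theta> * \<sigma> * \<beta> * r * local_norm p e' x'"
    using diff[of x' x] Ax x'(1) y_x y_lower[OF x'(2)] by simp
  have "\<theta> * \<sigma> * \<beta> * r * local_norm p e' x' \<ge> 0"
  proof -
    have "local_norm p e' x' \<ge> 0" using Q'.nrm_nonneg[of x'] eq'(3) by simp
    then show ?thesis using \<open>\<theta> * \<sigma> * \<beta> * r > 0\<close> by simp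
  qed
  then show "inner b (y_opt p A b c e \<alpha>) \<le> inner b (y_opt p A b c e' \<alpha>)"
    using gain dual_optimal_value[OF sw] dual_optimal_value[OF sw'] by (simp add: x_def x'_def)
  have "gap p A b c e' \<alpha> = gap p A b c e \<alpha> * r - (inner c x' - inner c x)"
    using gap_eq[OF sw'] ce' by (simp add: x'_def)
  also have "\<dots> \<le> gap p A b c e \<alpha> * r - \<theta> * \<sigma> * \<beta> * r * local_norm p e' x'" using gain by simp
  also have "\<dots> = gap p A b c e \<alpha> * r * (1 - \<beta> / N * local_norm p e' x')"
    using N by (simp add: gap_e field_simps)
  finally show "gap p A b c e' \<alpha> \<le> gap p A b c e \<alpha> / (1 + t) *
       (1 - \<alpha> * (1 - \<alpha>) / (4 * (real n - \<alpha>\<^sup>2)) * local_norm p e' (xo e'))"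
    by (simp add: r_def \<beta>_def N_def x'_def)
qed

text \<open>If the first of two consecutive steps fails to reduce the gap by the stated factor, then
  \<open>\<parallel>x\<^sub>e\<^sub>'(\<alpha>)\<parallel>\<^sub>e\<^sub>'\<close> is so small that the second step length is at least \<open>\<kappa> / \<surd>n\<close>.\<close>

lemma gap_reduction_two_steps:
  assumes sw: "e \<in> swath p d A b c \<alpha>"
  defines "e' \<equiv> next_point p n A b c \<alpha> e" and "\<kappa> \<equiv> \<alpha> * sqrt ((1 - \<alpha>) / 8)"
  defines "e'' \<equiv> next_point p n A b c \<alpha> e'" and "\<phi> \<equiv> 1 - \<kappa> / (\<kappa> + sqrt (real n))"
  shows "gap p A b c e' \<alpha> / gap p A b c e \<alpha> \<le> \<phi> \<or> gap p A b c e'' \<alpha> / gap p A b c e' \<alpha> \<le> \<phi>"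
proof (rule disjCI)
  assume no: "\<not> gap p A b c e'' \<alpha> / gap p A b c e' \<alpha> \<le> \<phi>"
  note step = affine_scaling_step[OF sw, folded e'_def]
  note step' = affine_scaling_step[OF step(1), folded e''_def]
  note step'' = affine_scaling_step[OF step'(1)]
  define N where "N = real n - \<alpha>\<^sup>2"
  define t where "t = t_step p n A b c e \<alpha>"
  define t' where "t' = t_step p n A b c e' \<alpha>"
  define \<nu> where "\<nu> = local_norm p e' (xo e')"
  define R where "R = sqrt (real n)"
  have R: "R > 0" "R\<^sup>2 = real n" using degree_positive by (simp_all add: R_def)
  have N: "N > 0" "N \<le> R\<^sup>2" using alpha_sq_less R by (simp_all add: N_def)
  have \<kappa>: "\<kappa> > 0" "\<kappa>\<^sup>2 = \<alpha>\<^sup>2 * (1 - \<alpha>) / 8" using alpha by (simp_all add: \<kappa>_def power_mult_distrib)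
  have \<phi>: "\<phi> = R / (\<kappa> + R)" using \<kappa> R by (simp add: \<phi>_def R_def[symmetric] field_simps)
  have \<nu>: "\<nu> > 0" using step'(5) by (simp add: \<nu>_def)
  have t: "t > 0" using step(5,6) alpha by (intro order_less_le_trans[OF _ step(6)[folded t_def]]) simp
  have t': "t' \<ge> \<alpha> / (2 * \<nu>)" using step'(6) by (simp add: t'_def \<nu>_def)
  have t'0: "t' > 0" using \<nu> alpha by (intro order_less_le_trans[OF _ t']) simp
  have pos: "gap p A b c e \<alpha> > 0" "gap p A b c e' \<alpha> > 0" "gap p A b c e'' \<alpha> > 0"
    using step(4) step'(4) step''(4) by auto
  \<comment> \<open>The threshold \<kappa> / R is where 1 / (1 + t') equals \<phi>.\<close>
  have t'_small: "t' * R < \<kappa>"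
  proof (rule ccontr)
    assume ge: "\<not> ?thesis"
    have "gap p A b c e'' \<alpha> \<le> gap p A b c e' \<alpha> / (1 + t') * 1"
    proof (rule order_trans[OF step'(7)[folded t'_def] mult_left_mono])
      have "local_norm p e'' (xo e'') \<ge> 0" using step''(5) by simp
      then show "1 - \<alpha> * (1 - \<alpha>) / (4 * (real n - \<alpha>\<^sup>2)) * local_norm p e'' (xo e'') \<le> 1"
        using alpha N by (simp add: N_def[symmetric])
    qed (use pos t'0 in simp)
    then have "gap p A b c e'' \<alpha> / gap p A b c e' \<alpha> \<le> 1 / (1 + t')" using pos t'0 by (simp add: field_simps)
    also have "\<dots> \<le> \<phi>" unfolding \<phi> using ge \<kappa> R t'0 by (simp add: field_simps)
    finally show False using no by simp
  qed
  define w where "w = \<alpha> * (1 - \<alpha>) / (4 * N) * \<nu>"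
  \<comment> \<open>The bounds \<alpha> / (2 \<nu>) <= t' < \<kappa> / R give \<nu> > \<alpha> R /
    (2 \<kappa>); with 8 \<kappa>^2 = \<alpha>^2 (1 - \<alpha>) and N <= R^2 this makes w at least
    \<kappa> / R.\<close>
  have "\<kappa> / R \<le> w"
  proof -
    have "\<alpha> / (2 * \<nu>) * R < \<kappa>" using t' t'_small R mult_right_mono[OF t', of R] by linarith
    then have "\<alpha> * R < 2 * \<nu> * \<kappa>" using \<nu> by (simp add: field_simps)
    then have "(\<alpha> * (1 - \<alpha>)) * (\<alpha> * R) \<le> (\<alpha> * (1 - \<alpha>)) * (2 * \<nu> * \<kappa>)" using alpha by (intro mult_left_mono) auto
    moreover have "8 * \<kappa>\<^sup>2 * R = (\<alpha> * (1 - \<alpha>)) * (\<alpha> * R)" by (simp only: \<kappa>(2)) (simp add: power2_eq_square)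
    ultimately have "8 * \<kappa>\<^sup>2 * R \<le> 2 * \<kappa> * (\<alpha> * (1 - \<alpha>) * \<nu>)" by (simp only: mult_ac)
    moreover have "8 * \<kappa>\<^sup>2 * R = 2 * (\<kappa> * (4 * \<kappa> * R))" by (simp add: power2_eq_square)
    ultimately have "2 * (\<kappa> * (4 * \<kappa> * R)) \<le> 2 * (\<kappa> * (\<alpha> * (1 - \<alpha>) * \<nu>))" by (simp only: mult.assoc)
    then have "\<kappa> * (4 * \<kappa> * R) \<le> \<kappa> * (\<alpha> * (1 - \<alpha>) * \<nu>)" by linarith
    then have le: "4 * \<kappa> * R \<le> \<alpha> * (1 - \<alpha>) * \<nu>" using \<kappa>(1) by (simp only: mult_le_cancel_left_pos)
    have "\<kappa> / R * (4 * N) \<le> \<kappa> / R * (4 * R\<^sup>2)" using N \<kappa> R by (intro mult_left_mono) auto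
    also have "\<dots> = 4 * \<kappa> * R" using R(1) by (simp add: power2_eq_square)
    also note le
    finally show ?thesis using N by (simp add: w_def field_simps)
  qed
  moreover have "\<kappa> / (\<kappa> + R) \<le> \<kappa> / R" using \<kappa> R by (intro divide_left_mono) auto
  ultimately have w: "1 - w \<le> \<phi>" unfolding \<phi>_def R_def[symmetric] by linarith
  have g: "gap p A b c e' \<alpha> \<le> gap p A b c e \<alpha> / (1 + t) * (1 - w)"
    using step(7) by (simp add: t_def w_def N_def \<nu>_def)
  \<comment> \<open>Positivity of the new gap supplies the sign needed to drop the factor 1 / (1 +
    t).\<close>
  have "1 - w > 0"
  proof -
    have "0 < gap p A b c e \<alpha> / (1 + t) * (1 - w)" using g pos by linarith
    moreover have "gap p A b c e \<alpha> / (1 + t) > 0" using pos t by simp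
    ultimately show ?thesis by (simp only: zero_less_mult_pos)
  qed
  then have "gap p A b c e \<alpha> / (1 + t) * (1 - w) \<le> gap p A b c e \<alpha> * (1 - w)"
    using pos t by (intro mult_right_mono) (auto simp: field_simps)
  then have "gap p A b c e' \<alpha> \<le> gap p A b c e \<alpha> * (1 - w)" using g by linarith
  then have "gap p A b c e' \<alpha> / gap p A b c e \<alpha> \<le> 1 - w" using pos by (simp add: field_simps)
  then show "gap p A b c e' \<alpha> / gap p A b c e \<alpha> \<le> \<phi>" using w by linarith
qed

end

theorem mainTheorem2:
  fixes p :: "'a::euclidean_space \<Rightarrow> real" and n :: nat and d :: "'a"
    and A :: "'a \<Rightarrow> 'b::euclidean_space" and b :: 'b and c :: 'a
    and \<alpha> :: real and e :: 'a
  assumes hyp: "hyperbolic p n d"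
    and pos: "\<forall>x\<in>hcone p d. p x > 0"
    and reg: "regular_cone (hcone_closed p d)"
    and linA: "linear A" and fullrank: "surj A"
    and b_nz: "b \<noteq> 0"
    and c_notin: "c \<notin> range (adjoint A)"
    and alpha: "0 < \<alpha>" "\<alpha> < 1"
    and e_sw: "e \<in> swath p d A b c \<alpha>"
  shows "strictly_convex_on UNIV (qtilde p n A b c e \<alpha>)
    \<and> next_point p n A b c \<alpha> e \<in> swath p d A b c \<alpha>
    \<and> inner c e > inner c (next_point p n A b c \<alpha> e)
    \<and> inner b (y_opt p A b c e \<alpha>) \<le> inner b (y_opt p A b c (next_point p n A b c \<alpha> e) \<alpha>)
    \<and> (\<forall>e0\<in>swath p d A b c \<alpha>. \<forall>i::nat.
         let es = (\<lambda>k. (next_point p n A b c \<alpha> ^^ k) e0);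
             \<kappa> = \<alpha> * sqrt ((1 - \<alpha>) / 8);
             bound = 1 - \<kappa> / (\<kappa> + sqrt (real n))
         in gap p A b c (es (Suc i)) \<alpha> / gap p A b c (es i) \<alpha> \<le> bound
          \<or> gap p A b c (es (Suc (Suc i))) \<alpha> / gap p A b c (es (Suc i)) \<alpha> \<le> bound)"
proof -
  obtain F where F: "complexifies p F"
    using hyp poly_fun_complexifies unfolding hyperbolic_def by blast
  interpret hyperbolic_program p n F d A b c \<alpha>
    by (intro hyperbolic_program.intro hyperbolic_cone.intro complexified_form.intro
        hyperbolic_cone_axioms.intro hyperbolic_program_axioms.intro) (use F hyp pos reg linA b_nz c_notin alpha in \<open>auto simp: hyperbolic_def\<close>)
  have "(next_point p n A b c \<alpha> ^^ k) e0 \<in> swath p d A b c \<alpha>" if "e0 \<in> swath p d A b c \<alpha>" for e0 k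
    using that by (induction k) (auto intro: affine_scaling_step(1))
  then show ?thesis
    using qtilde_strictly_convex[OF e_sw] affine_scaling_step(1-3)[OF e_sw] gap_reduction_two_steps
    by (auto simp: Let_def)
qed

end
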